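(* Let $I_1$ and $I_2$ be disjoint subsets of $\mathbb{N}$ and let $\varphi_1$ and $\varphi_2$ be states of $\mathcal{A}(I_1)$ and $\mathcal{A}(I_2)$. Assume that the GNS representations $\pi_{\varphi_1}$ and $\pi_{\varphi_1\Theta}$ of $\mathcal{A}(I_1)$ are disjoint. Then a joint extension of $\varphi_1$ and $\varphi_2$ exists if and only if $\varphi_2$ is even.
   Context: $\mathbb{N}=\{1,2,\dots\}$. $\mathcal{A}$ is the CAR (Fermion) algebra: the unital $C^*$-algebra generated by elements $a_i, a_i^*$, $i\in\mathbb{N}$, satisfying $\{a_i^*,a_j\}=\delta_{i,j}\mathbf{1}$ and $\{a_i^*,a_j^*\}=\{a_i,a_j\}=0$ for all $i,j$, where $\{A,B\}=AB+BA$. For $I\subset\mathbb{N}$, $\mathcal{A}(I)$ is the (unital) $C^*$-subalgebra generated by $a_i,a_i^*$, $i\in I$. $\Theta$ is the unique automorphism of $\mathcal{A}$ with $\Theta(a_i)=-a_i$, $\Theta(a_i^* )=-a_i^*$ for all $i$; it preserves each $\mathcal{A}(I)$. A state $\varphi$ of $\mathcal{A}(I)$ is even if $\varphi(\Theta(A))=\varphi(A)$ for all $A\in\mathcal{A}(I)$. For a state $\varphi$, $\varphi\Theta$ denotes the state $A\mapsto\varphi(\Theta(A))$, and $\pi_\varphi$ denotes the GNS representation of $\varphi$. A joint extension of $\varphi_1$ and $\varphi_2$ is a state of $\mathcal{A}(I_1\cup I_2)$ whose restrictions to $\mathcal{A}(I_1)$ and $\mathcal{A}(I_2)$ are $\varphi_1$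 and $\varphi_2$. Two representations of a $C^*$-algebra are disjoint if they have no unitarily equivalent non-zero subrepresentations (equivalently, no non-zero intertwiner). *)

theory Defs
  imports "HOL-Analysis.Analysis"
begin

section \<open>Complex Hilbert spaces and unital C*-algebras\<close>

class complex_vector = real_vector +
  fixes scaleC :: "complex \<Rightarrow> 'a \<Rightarrow> 'a" (infixr "*\<^sub>C" 75)
  assumes scaleC_add_right: "c *\<^sub>C (x + y) = c *\<^sub>C x + c *\<^sub>C y"
    and scaleC_add_left: "(c + d) *\<^sub>C x = c *\<^sub>C x + d *\<^sub>C x"
    and scaleC_scaleC: "c *\<^sub>C (d *\<^sub>C x) = (c * d) *\<^sub>C x"
    and scaleC_of_real: "complex_of_real r *\<^sub>C x = r *\<^sub>R x"

text \<open>The inner product is linear in the second argument.  Its real part is the real inner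
  product of the class \<^class>\<open>real_inner\<close>, so the norm of \<open>x\<close> is the square root of \<open>cinner x x\<close>,
  and positive definiteness is inherited.\<close>

class complex_hilbert = complex_vector + real_inner + complete_space +
  fixes cinner :: "'a \<Rightarrow> 'a \<Rightarrow> complex"
  assumes cinner_commute: "cinner x y = cnj (cinner y x)"
    and cinner_add_right: "cinner x (y + z) = cinner x y + cinner x z"
    and cinner_scaleC_right: "cinner x (c *\<^sub>C y) = c * cinner x y"
    and Re_cinner: "Re (cinner x y) = inner x y"

text \<open>The class \<^class>\<open>real_normed_algebra_1\<close> contains \<open>0 \<noteq> 1\<close>.\<close>

class cstar_algebra = complex_vector + real_normed_algebra_1 + complete_space +
  fixes star :: "'a \<Rightarrow> 'a"
  assumes scaleC_mult_left: "(c *\<^sub>C x) * y = c *\<^sub>C (x * y)"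
    and scaleC_mult_right: "x * (c *\<^sub>C y) = c *\<^sub>C (x * y)"
    and norm_scaleC: "norm (c *\<^sub>C x) = cmod c * norm x"
    and star_star: "star (star x) = x"
    and star_add: "star (x + y) = star x + star y"
    and star_scaleC: "star (c *\<^sub>C x) = cnj c *\<^sub>C star x"
    and star_mult: "star (x * y) = star y * star x"
    and cstar_identity: "norm (star x * x) = (norm x)\<^sup>2"

definition cstar_subalgebra :: "'a::cstar_algebra set \<Rightarrow> bool" where
  "cstar_subalgebra B \<longleftrightarrow>
     closed B \<and> 1 \<in> B \<and>
     (\<forall>x\<in>B. \<forall>y\<in>B. x + y \<in> B \<and> x * y \<in> B) \<and>
     (\<forall>c. \<forall>x\<in>B. c *\<^sub>C x \<in> B) \<and>
     (\<forall>x\<in>B. star x \<in> B)"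

definition cstar_generated :: "'a::cstar_algebra set \<Rightarrow> 'a set" where
  "cstar_generated S = cstar_subalgebra hull S"

lemma cstar_subalgebra_generated: "cstar_subalgebra (cstar_generated S)"
  unfolding cstar_generated_def
  by (rule hull_in) (auto simp: cstar_subalgebra_def intro!: closed_Inter)

definition star_automorphism :: "('a::cstar_algebra \<Rightarrow> 'a) \<Rightarrow> bool" where
  "star_automorphism \<theta> \<longleftrightarrow>
     bij \<theta> \<and>
     (\<forall>x y. \<theta> (x + y) = \<theta> x + \<theta> y) \<and>
     (\<forall>c x. \<theta> (c *\<^sub>C x) = c *\<^sub>C \<theta> x) \<and>
     (\<forall>x y. \<theta> (x * y) = \<theta> x * \<theta> y) \<and>
     (\<forall>x. \<theta> (star x) = star (\<theta> x))"

text \<open>Functionals and representations of a subalgebra \<open>B\<close> are total functions on the ambient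
  type; only their values on \<open>B\<close> matter.\<close>

definition state_on :: "'a::cstar_algebra set \<Rightarrow> ('a \<Rightarrow> complex) \<Rightarrow> bool" where
  "state_on B \<phi> \<longleftrightarrow>
     (\<forall>x\<in>B. \<forall>y\<in>B. \<phi> (x + y) = \<phi> x + \<phi> y) \<and>
     (\<forall>c. \<forall>x\<in>B. \<phi> (c *\<^sub>C x) = c * \<phi> x) \<and>
     (\<forall>x\<in>B. \<phi> (star x * x) \<in> \<real> \<and> 0 \<le> Re (\<phi> (star x * x))) \<and>
     \<phi> 1 = 1"


section \<open>Representations\<close>

definition closed_csubspace :: "'h::complex_hilbert set \<Rightarrow> bool" where
  "closed_csubspace H \<longleftrightarrow>
     closed H \<and> 0 \<in> H \<and>
     (\<forall>x\<in>H. \<forall>y\<in>H. x + y \<in> H) \<and>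
     (\<forall>c. \<forall>x\<in>H. c *\<^sub>C x \<in> H)"

definition bounded_clinear_on ::
    "'h::complex_hilbert set \<Rightarrow> ('h \<Rightarrow> 'h) \<Rightarrow> bool" where
  "bounded_clinear_on H T \<longleftrightarrow>
     (\<forall>x\<in>H. T x \<in> H) \<and>
     (\<forall>x\<in>H. \<forall>y\<in>H. T (x + y) = T x + T y) \<and>
     (\<forall>c. \<forall>x\<in>H. T (c *\<^sub>C x) = c *\<^sub>C T x) \<and>
     (\<exists>K. \<forall>x\<in>H. norm (T x) \<le> K * norm x)"

text \<open>The Hilbert space of a representation is a closed subspace \<open>H\<close> of an arbitrary Hilbert space
  type rather than the whole type, so that it (in particular its dimension) may depend on terms
  such as a state.\<close>

definition representation ::
    "'a::cstar_algebra set \<Rightarrow> 'h::complex_hilbert set \<Rightarrow> ('a \<Rightarrow> 'h \<Rightarrow> 'h) \<Rightarrow> bool" where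
  "representation B H \<pi> \<longleftrightarrow>
     closed_csubspace H \<and>
     (\<forall>b\<in>B. bounded_clinear_on H (\<pi> b)) \<and>
     (\<forall>x\<in>H. \<pi> 1 x = x) \<and>
     (\<forall>b\<in>B. \<forall>c\<in>B. \<forall>x\<in>H. \<pi> (b + c) x = \<pi> b x + \<pi> c x \<and> \<pi> (b * c) x = \<pi> b (\<pi> c x)) \<and>
     (\<forall>k. \<forall>b\<in>B. \<forall>x\<in>H. \<pi> (k *\<^sub>C b) x = k *\<^sub>C \<pi> b x) \<and>
     (\<forall>b\<in>B. \<forall>x\<in>H. \<forall>y\<in>H. cinner (\<pi> b x) y = cinner x (\<pi> (star b) y))"

text \<open>The GNS triple of a state \<open>\<phi>\<close> (unique up to unitary equivalence): a representation with
  a cyclic vector \<open>\<Omega>\<close> whose vector state is \<open>\<phi>\<close>.\<close>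

definition gns_triple ::
    "'a::cstar_algebra set \<Rightarrow> ('a \<Rightarrow> complex) \<Rightarrow>
     'h::complex_hilbert set \<Rightarrow> ('a \<Rightarrow> 'h \<Rightarrow> 'h) \<Rightarrow> 'h \<Rightarrow> bool" where
  "gns_triple B \<phi> H \<pi> \<Omega> \<longleftrightarrow>
     representation B H \<pi> \<and> \<Omega> \<in> H \<and>
     closure ((\<lambda>b. \<pi> b \<Omega>) ` B) = H \<and>
     (\<forall>b\<in>B. \<phi> b = cinner \<Omega> (\<pi> b \<Omega>))"

definition subrepresentation ::
    "'a::cstar_algebra set \<Rightarrow> 'h::complex_hilbert set \<Rightarrow> ('a \<Rightarrow> 'h \<Rightarrow> 'h) \<Rightarrow> 'h set \<Rightarrow> bool" where
  "subrepresentation B H \<pi> K \<longleftrightarrow>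
     closed_csubspace K \<and> K \<subseteq> H \<and> (\<forall>b\<in>B. \<forall>x\<in>K. \<pi> b x \<in> K)"

definition unitarily_equivalent ::
    "'a::cstar_algebra set \<Rightarrow>
     'h1::complex_hilbert set \<Rightarrow> ('a \<Rightarrow> 'h1 \<Rightarrow> 'h1) \<Rightarrow>
     'h2::complex_hilbert set \<Rightarrow> ('a \<Rightarrow> 'h2 \<Rightarrow> 'h2) \<Rightarrow> bool" where
  "unitarily_equivalent B K1 \<pi>1 K2 \<pi>2 \<longleftrightarrow>
     (\<exists>U. bij_betw U K1 K2 \<and>
        (\<forall>x\<in>K1. \<forall>y\<in>K1. U (x + y) = U x + U y) \<and>
        (\<forall>c. \<forall>x\<in>K1. U (c *\<^sub>C x) = c *\<^sub>C U x) \<and>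
        (\<forall>x\<in>K1. \<forall>y\<in>K1. cinner (U x) (U y) = cinner x y) \<and>
        (\<forall>b\<in>B. \<forall>x\<in>K1. U (\<pi>1 b x) = \<pi>2 b (U x)))"

definition disjoint_representations ::
    "'a::cstar_algebra set \<Rightarrow>
     'h1::complex_hilbert set \<Rightarrow> ('a \<Rightarrow> 'h1 \<Rightarrow> 'h1) \<Rightarrow>
     'h2::complex_hilbert set \<Rightarrow> ('a \<Rightarrow> 'h2 \<Rightarrow> 'h2) \<Rightarrow> bool" where
  "disjoint_representations B H1 \<pi>1 H2 \<pi>2 \<longleftrightarrow>
     \<not> (\<exists>K1 K2. subrepresentation B H1 \<pi>1 K1 \<and> K1 \<noteq> {0} \<and>
                subrepresentation B H2 \<pi>2 K2 \<and> K2 \<noteq> {0} \<and>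
                unitarily_equivalent B K1 \<pi>1 K2 \<pi>2)"


section \<open>The CAR algebra\<close>

definition anticomm :: "'a::cstar_algebra \<Rightarrow> 'a \<Rightarrow> 'a" where
  "anticomm x y = x * y + y * x"

text \<open>The local algebra \<open>\<A>(I)\<close> for generators \<open>a\<close>.\<close>

definition car_local :: "(nat \<Rightarrow> 'a::cstar_algebra) \<Rightarrow> nat set \<Rightarrow> 'a set" where
  "car_local a I = cstar_generated (a ` I \<union> (\<lambda>i. star (a i)) ` I)"

text \<open>The type \<open>'a\<close>, with generators \<open>a i\<close> for \<open>i \<ge> 1\<close>, is the CAR algebra.  This determines it
  up to *-isomorphism.  The value \<open>a 0\<close> is irrelevant.\<close>

definition car_algebra :: "(nat \<Rightarrow> 'a::cstar_algebra) \<Rightarrow> bool" where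
  "car_algebra a \<longleftrightarrow>
     (\<forall>i\<ge>1. \<forall>j\<ge>1. anticomm (star (a i)) (a j) = (if i = j then 1 else 0) \<and>
                    anticomm (star (a i)) (star (a j)) = 0 \<and>
                    anticomm (a i) (a j) = 0) \<and>
     car_local a {1..} = UNIV"

definition parity_automorphism :: "(nat \<Rightarrow> 'a::cstar_algebra) \<Rightarrow> ('a \<Rightarrow> 'a) \<Rightarrow> bool" where
  "parity_automorphism a \<Theta> \<longleftrightarrow>
     star_automorphism \<Theta> \<and>
     (\<forall>i\<ge>1. \<Theta> (a i) = - a i \<and> \<Theta> (star (a i)) = - star (a i))"

definition even_on :: "('a::cstar_algebra \<Rightarrow> 'a) \<Rightarrow> 'a set \<Rightarrow> ('a \<Rightarrow> complex) \<Rightarrow> bool" where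
  "even_on \<Theta> B \<phi> \<longleftrightarrow> (\<forall>x\<in>B. \<phi> (\<Theta> x) = \<phi> x)"

definition joint_extension ::
    "(nat \<Rightarrow> 'a::cstar_algebra) \<Rightarrow> nat set \<Rightarrow> nat set \<Rightarrow>
     ('a \<Rightarrow> complex) \<Rightarrow> ('a \<Rightarrow> complex) \<Rightarrow> ('a \<Rightarrow> complex) \<Rightarrow> bool" where
  "joint_extension a I1 I2 \<phi>1 \<phi>2 \<phi> \<longleftrightarrow>
     state_on (car_local a (I1 \<union> I2)) \<phi> \<and>
     (\<forall>x\<in>car_local a I1. \<phi> x = \<phi>1 x) \<and>
     (\<forall>x\<in>car_local a I2. \<phi> x = \<phi>2 x)"

end

theory Submission
  imports Defs "HOL-Library.Complex_Order"
begin

text \<open>Let \<open>\<phi>\<close> be a joint extension and \<open>u\<close> an odd element of \<open>\<A>(I2)\<close>.  Since \<open>x u = u \<Theta>(x)\<close> for \<open>x\<close> in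
  \<open>\<A>(I1)\<close>, the Cauchy-Schwarz inequality bounds \<open>|\<phi>((x u)* y)|\<^sup>2\<close> by \<open>\<parallel>u\<parallel>\<^sup>2 \<phi>1(\<Theta>(x* x)) \<phi>1(y* y)\<close>.  Hence
  \<open>y \<mapsto> \<phi>(u* y)\<close> is represented by a vector \<open>\<xi>\<close> of the GNS space of \<open>\<phi>1\<close>, and the vector functional
  of \<open>\<xi>\<close> is dominated by a multiple of \<open>\<phi>1 \<Theta>\<close>.  A Radon-Nikodym argument then makes the cyclic
  subrepresentation generated by \<open>\<xi>\<close> equivalent to one of the GNS representation of \<open>\<phi>1 \<Theta>\<close>, so
  disjointness forces \<open>\<xi> = 0\<close> and \<open>\<phi>(u) = 0\<close>.

  Conversely, if \<open>\<phi>2\<close> is even, \<open>x y \<mapsto> \<phi>1(x) \<phi>2(y)\<close> extends to a state.  Adjoining the self-adjoint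
  unitaries \<open>a + a*\<close> and \<open>i (a - a*)\<close> of the modes in \<open>I2\<close> to \<open>\<A>(I1)\<close> one at a time gives an
  increasing sequence of C*-algebras with dense union, on each of which the product functional is
  well defined; its positivity is that of a Schur product of Gram matrices, because
  \<open>\<phi>(w y w') = \<phi>1(w w') \<phi>2(y)\<close> when \<open>\<phi>2\<close> vanishes on odd elements.\<close>

text \<open>Since A(I1) and A(I2) do not commute, the product functional does not come from a tensor
  product, and neither its being well defined nor its positivity is automatic. Self-adjoint
  unitaries are adjoined instead of the \<open>a j\<close> because the elements of the enlarged
  algebra are then \<open>x + y * g\<close>, with components recovered by an explicit continuous
  averaging map. This gives uniqueness of the components and closedness of the enlarged algebra at
  once. Evenness of \<phi>2 removes the twist by \<Theta> that appears when an odd element of A(I2)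
  is moved past A(I1).

  In the other direction it is enough to treat odd elements, because \<open>x - \<Theta> x\<close>
  is odd.

  The one analytic tool is the power series of the square root of 1 - t, absolutely convergent up to
  t = 1. It serves three times: to bound \<open>\<phi> (star (x * y) * (x * y))\<close> and thereby
  show that states are continuous, to show that automorphisms are contractive, and to take the
  square root in the Radon-Nikodym argument.\<close>

instance complex_hilbert \<subseteq> banach ..
instance cstar_algebra \<subseteq> banach ..

section \<open>Consequences of the axioms: complex scalars, the involution, C*-subalgebras\<close>

lemma linear_scaleC: "linear ((*\<^sub>C) c :: 'a::complex_vector \<Rightarrow> 'a)"
proof (rule linearI)
  fix r and x :: 'a
  show "c *\<^sub>C r *\<^sub>R x = r *\<^sub>R c *\<^sub>C x"
    by (metis scaleC_of_real scaleC_scaleC mult.commute)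
qed (rule scaleC_add_right)

lemmas scaleC_zero_right [simp] = linear_0 [OF linear_scaleC]
lemmas scaleC_diff_right = linear_diff [OF linear_scaleC]
lemmas scaleC_minus_right = linear_neg [OF linear_scaleC]
lemmas scaleC_scaleR = linear_scale [OF linear_scaleC]

lemma scaleC_one [simp]: "1 *\<^sub>C x = (x::'a::complex_vector)"
  using scaleC_of_real [of 1 x] by simp

lemma scaleC_zero_left [simp]: "0 *\<^sub>C x = (0::'a::complex_vector)"
  using scaleC_of_real [of 0 x] by simp

lemma scaleC_minus_left: "(- c) *\<^sub>C x = - (c *\<^sub>C (x::'a::complex_vector))"
  using scaleC_add_left [of "-c" c x] by (simp add: eq_neg_iff_add_eq_0)

lemma star_zero [simp]: "star 0 = (0::'a::cstar_algebra)"
  using star_add [of 0 0] by simp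

lemma star_one [simp]: "star 1 = (1::'a::cstar_algebra)"
  by (metis mult.right_neutral mult.left_neutral star_mult star_star)

lemma star_scaleR: "star (r *\<^sub>R x) = r *\<^sub>R star (x::'a::cstar_algebra)"
  by (metis complex_cnj_complex_of_real scaleC_of_real star_scaleC)

lemma star_minus: "star (- x) = - star (x::'a::cstar_algebra)"
  using star_scaleR [of "-1" x] by simp

lemma star_diff: "star (x - y) = star x - star (y::'a::cstar_algebra)"
  using star_add [of x "-y"] by (simp add: star_minus)

lemma star_power: "star (x ^ n) = star (x::'a::cstar_algebra) ^ n"
  by (induction n) (simp_all add: star_mult power_commutes)

text \<open>The C*-identity and submultiplicativity give
  \<open>norm y * norm y \<le> norm (star y) * norm y\<close>; the reverse inequality is the same
  one at \<open>star x\<close>.\<close>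

lemma norm_star [simp]: "norm (star x) = norm (x::'a::cstar_algebra)"
proof -
  have le: "norm y \<le> norm (star y)" for y :: 'a
  proof (cases "y = 0")
    case False
    have "norm y * norm y \<le> norm (star y) * norm y"
      using cstar_identity [of y] norm_mult_ineq [of "star y" y] by (simp add: power2_eq_square)
    then show ?thesis using False by simp
  qed simp
  show ?thesis using le [of x] le [of "star x"] by (simp add: star_star)
qed

lemma bounded_linear_star: "bounded_linear (star :: 'a::cstar_algebra \<Rightarrow> 'a)"
  by (rule bounded_linear_intro [where K = 1]) (simp_all add: star_add star_scaleR)

lemma bounded_linear_scaleC_cstar: "bounded_linear ((*\<^sub>C) c :: 'a::cstar_algebra \<Rightarrow> 'a)"
  by (rule bounded_linear_intro [where K = "cmod c"])
     (simp_all add: scaleC_add_right scaleC_scaleR norm_scaleC)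

lemmas tendsto_star = bounded_linear.tendsto [OF bounded_linear_star]
lemmas tendsto_scaleC_cstar = bounded_linear.tendsto [OF bounded_linear_scaleC_cstar]

lemma cstar_subalgebraD:
  assumes "cstar_subalgebra (B::'a::cstar_algebra set)"
  shows "closed B" "1 \<in> B" "0 \<in> B"
    "\<And>x y. \<lbrakk>x \<in> B; y \<in> B\<rbrakk> \<Longrightarrow> x + y \<in> B" "\<And>x y. \<lbrakk>x \<in> B; y \<in> B\<rbrakk> \<Longrightarrow> x * y \<in> B"
    "\<And>c x. x \<in> B \<Longrightarrow> c *\<^sub>C x \<in> B" "\<And>x. x \<in> B \<Longrightarrow> star x \<in> B"
    "\<And>x. x \<in> B \<Longrightarrow> - x \<in> B" "\<And>x y. \<lbrakk>x \<in> B; y \<in> B\<rbrakk> \<Longrightarrow> x - y \<in> B"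
    "\<And>r x. x \<in> B \<Longrightarrow> r *\<^sub>R x \<in> B"
proof -
  show *: "closed B" "1 \<in> B" "\<And>x y. \<lbrakk>x \<in> B; y \<in> B\<rbrakk> \<Longrightarrow> x + y \<in> B" "\<And>x y. \<lbrakk>x \<in> B; y \<in> B\<rbrakk> \<Longrightarrow> x * y \<in> B"
    "\<And>c x. x \<in> B \<Longrightarrow> c *\<^sub>C x \<in> B" "\<And>x. x \<in> B \<Longrightarrow> star x \<in> B"
    using assms unfolding cstar_subalgebra_def by auto
  show "0 \<in> B" using *(5) [OF *(2), of 0] by simp
  show m: "- x \<in> B" if "x \<in> B" for x using *(5) [OF that, of "-1"] by (simp add: scaleC_minus_left)
  show "x - y \<in> B" if "x \<in> B" "y \<in> B" for x y using *(3) [OF that(1) m [OF that(2)]] by simp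
  show "r *\<^sub>R x \<in> B" if "x \<in> B" for r x using *(5) [OF that, of "of_real r"] by (simp add: scaleC_of_real)
qed

lemma cstar_subalgebra_sum:
  assumes "cstar_subalgebra B" "\<And>i. i \<in> S \<Longrightarrow> f i \<in> B"
  shows "sum f S \<in> B"
  using assms(2) by (induction S rule: infinite_finite_induct) (auto intro: cstar_subalgebraD [OF assms(1)])

lemma cstar_subalgebra_power:
  assumes "cstar_subalgebra B" "x \<in> B"
  shows "x ^ n \<in> B"
  by (induction n) (auto intro: cstar_subalgebraD [OF assms(1)] assms(2))

lemma cstar_generated_minimal:
  "\<lbrakk>cstar_subalgebra B; S \<subseteq> B\<rbrakk> \<Longrightarrow> cstar_generated S \<subseteq> B"
  unfolding cstar_generated_def by (rule hull_minimal)

lemma cstar_generated_superset: "S \<subseteq> cstar_generated S"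
  unfolding cstar_generated_def by (rule hull_subset)

subsection \<open>Square roots by the binomial series\<close>

text \<open>The Taylor coefficients at 0 of the square root of 1 - t.\<close>

definition sqrt_coeff :: "nat \<Rightarrow> real" where
  "sqrt_coeff n = ((1/2) gchoose n) * (-1) ^ n"

text \<open>Vandermonde convolution with 1/2 + 1/2 = 1: squaring the series for the square root of 1
  - t returns the polynomial 1 - t.\<close>

lemma sqrt_coeff_convolution:
  "(\<Sum>i\<le>k. sqrt_coeff i * sqrt_coeff (k - i)) = (if k = 0 then 1 else if k = 1 then -1 else 0)"
proof -
  have "(\<Sum>i\<le>k. sqrt_coeff i * sqrt_coeff (k - i))
      = (\<Sum>i\<le>k. (-1) ^ k * (((1/2) gchoose i) * ((1/2) gchoose (k - i))))"
    by (rule sum.cong) (auto simp: sqrt_coeff_def power_add [symmetric])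
  also have "\<dots> = (-1) ^ k * ((1/2 + 1/2 :: real) gchoose k)"
    by (simp only: sum_distrib_left [symmetric] atMost_atLeast0 gbinomial_Vandermonde)
  also have "((1/2 + 1/2 :: real) gchoose k) = real (1 choose k)"
    using binomial_gbinomial [of 1 k, where 'a = real] by simp
  finally show ?thesis
    by (cases k) (auto simp: binomial_eq_0)
qed

lemma gbinomial_Suc_real: "(x::real) gchoose Suc n = (x gchoose n) * (x - n) / (n + 1)"
  by (simp add: gbinomial_prod_rev field_simps)

text \<open>Convergence at the endpoint t = 1 is what later admits elements of norm exactly 1. All
  coefficients after the leading 1 are nonpositive, so their absolute values add up to 1 minus a
  partial sum of the series, and these partial sums are nonnegative.\<close>

lemma summable_abs_sqrt_coeff: "summable (\<lambda>n. \<bar>sqrt_coeff n\<bar>)"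
proof -
  have nonpos: "sqrt_coeff (Suc n) \<le> 0" for n
  proof (induction n)
    case (Suc n)
    have "sqrt_coeff (Suc (Suc n)) = sqrt_coeff (Suc n) * ((real (Suc n) - 1/2) / (real (Suc n) + 1))"
      unfolding sqrt_coeff_def gbinomial_Suc_real [of _ "Suc n"] by (simp add: field_simps)
    also have "\<dots> \<le> 0" by (rule mult_nonpos_nonneg [OF Suc.IH]) simp
    finally show ?case .
  qed (simp add: sqrt_coeff_def)
  \<comment> \<open>This is the closed form of the partial sums of \<open>sqrt_coeff\<close>: an
    alternating sum of binomials with upper entry 1/2 collapses to one binomial with upper entry
    -1/2.\<close>
  have nonneg: "0 \<le> (-1) ^ n * ((-1/2 :: real) gchoose n)" for n
  proof (induction n)
    case (Suc n)
    have "(-1) ^ Suc n * ((-1/2 :: real) gchoose Suc n)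
        = (-1) ^ n * ((-1/2) gchoose n) * ((real n + 1/2) / (real n + 1))"
      unfolding gbinomial_Suc_real by (simp add: field_simps)
    also have "\<dots> \<ge> 0" by (rule mult_nonneg_nonneg [OF Suc.IH]) simp
    finally show ?case .
  qed simp
  have "(\<Sum>k\<le>n. sqrt_coeff k) = (-1) ^ n * ((1/2 - 1 :: real) gchoose n)" for n
    unfolding sqrt_coeff_def by (rule gbinomial_sum_lower_neg)
  then have pos: "0 \<le> (\<Sum>k\<le>n. sqrt_coeff k)" for n
    using nonneg [of n] by simp
  have le_1: "(\<Sum>k<n. \<bar>sqrt_coeff (Suc k)\<bar>) \<le> 1" for n
  proof -
    have "(\<Sum>k<n. \<bar>sqrt_coeff (Suc k)\<bar>) = - (\<Sum>k<n. sqrt_coeff (Suc k))"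
      using nonpos by (simp add: sum_negf [symmetric] abs_of_nonpos)
    also have "\<dots> = sqrt_coeff 0 - (\<Sum>k\<le>n. sqrt_coeff k)"
      by (subst sum.atMost_shift) simp
    finally show ?thesis using pos [of n] by (simp add: sqrt_coeff_def)
  qed
  have "summable (\<lambda>n. \<bar>sqrt_coeff (Suc n)\<bar>)"
    using le_1 [of "Suc _"] by (intro bounded_imp_summable [where B = 1]) (simp_all only: lessThan_Suc_atMost abs_ge_zero)
  then show ?thesis by (subst (asm) summable_Suc_iff)
qed

text \<open>The root is a limit of real polynomials in \<open>h\<close>; hence it stays in
  \<open>B\<close>, is self-adjoint and commutes with whatever commutes with
  \<open>h\<close>.\<close>

lemma cstar_sqrt_one_minus:
  assumes B: "cstar_subalgebra B" and h: "h \<in> B" "star h = h" "norm h \<le> 1"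
  obtains s where "s \<in> B" "star s = s" "s * s = 1 - h" "\<And>y. y * h = h * y \<Longrightarrow> y * s = s * y"
proof -
  define f where "f n = sqrt_coeff n *\<^sub>R h ^ n" for n
  define s where "s = suminf f"
  have summ: "summable (\<lambda>n. norm (f n))"
  proof (rule summable_comparison_test' [OF summable_abs_sqrt_coeff])
    show "norm (norm (f n)) \<le> \<bar>sqrt_coeff n\<bar>" if "0 \<le> n" for n
      using power_le_one [of "norm h" n] norm_power_ineq [of h n] h(3)
      by (simp add: f_def mult_left_le)
  qed
  then have "f sums s"
    unfolding s_def by (rule summable_sums [OF summable_norm_cancel])
  then have lim: "(\<lambda>n. \<Sum>k<n. f k) \<longlonglongrightarrow> s" by (simp add: sums_def)
  have "f k \<in> B" for k
    using cstar_subalgebraD(10) [OF B cstar_subalgebra_power [OF B h(1)]] by (simp add: f_def)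
  then have "(\<Sum>k<n. f k) \<in> B" for n
    by (rule cstar_subalgebra_sum [OF B])
  then have "s \<in> B"
    by (rule closed_sequentially [OF cstar_subalgebraD(1) [OF B] _ lim])
  moreover have "star s = s"
  proof -
    have "star (\<Sum>k<n. f k) = (\<Sum>k<n. f k)" for n
      by (simp add: linear_sum [OF bounded_linear.linear [OF bounded_linear_star]] f_def star_scaleR star_power h)
    then show ?thesis using tendsto_star [OF lim] lim by (simp add: LIMSEQ_unique)
  qed
  moreover have "s * s = 1 - h"
  proof -
    have "(\<lambda>k. \<Sum>i\<le>k. f i * f (k - i)) sums (s * s)"
      unfolding s_def by (rule Cauchy_product_sums [OF summ summ])
    moreover have "(\<Sum>i\<le>k. f i * f (k - i)) = (if k \<in> {0, 1} then (if k = 0 then 1 else - h) else 0)" for k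
    proof -
      have "(\<Sum>i\<le>k. f i * f (k - i)) = (\<Sum>i\<le>k. sqrt_coeff i * sqrt_coeff (k - i)) *\<^sub>R h ^ k"
        by (simp add: scaleR_sum_left f_def power_add [symmetric] mult.commute)
      then show ?thesis by (simp add: sqrt_coeff_convolution)
    qed
    moreover have "(\<lambda>k::nat. if k \<in> {0, 1} then (if k = 0 then 1 else - h) else 0) sums (\<Sum>k\<in>{0::nat, 1}. if k = 0 then 1 else - h)"
      by (rule sums_If_finite_set) simp
    ultimately show ?thesis by (simp add: sums_unique2)
  qed
  moreover have "y * s = s * y" if "y * h = h * y" for y
  proof -
    have "y * h ^ n = h ^ n * y" for n
      by (induction n) (simp_all add: mult.assoc, metis that mult.assoc)
    then have "y * (\<Sum>k<n. f k) = (\<Sum>k<n. f k) * y" for n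
      by (simp add: sum_distrib_left sum_distrib_right f_def)
    then show ?thesis
      using tendsto_mult_left [OF lim, of y] tendsto_mult_right [OF lim, of y] by (simp add: LIMSEQ_unique)
  qed
  ultimately show ?thesis by (rule that)
qed

subsection \<open>States\<close>

text \<open>This quadratic is a positive form at x + l y with l = - t cnj b, where b is the mixed
  term, n is the square of its modulus, and a, d are the diagonal terms.\<close>

lemma discriminant_bound:
  fixes a d n :: real
  assumes "\<And>t. 0 \<le> a - 2 * t * n + t\<^sup>2 * n * d" "0 \<le> n" "0 \<le> d"
  shows "n \<le> a * d"
proof (cases "d = 0")
  case True
  have "n = 0"
  proof (rule ccontr)
    assume "n \<noteq> 0"
    \<comment> \<open>For d = 0 this value of t makes the quadratic equal to -1.\<close>
    then show False using assms(1) [of "(a + 1) / (2 * n)"] True by (simp add: field_simps)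
  qed
  then show ?thesis using True by simp
next
  case False
  then show ?thesis using assms(1) [of "1 / d"] assms(3) by (simp add: field_simps power2_eq_square)
qed

context
  fixes B :: "'a::cstar_algebra set" and \<phi> :: "'a \<Rightarrow> complex"
  assumes B: "cstar_subalgebra B" and st: "state_on B \<phi>"
begin

lemma state_add: "\<lbrakk>x \<in> B; y \<in> B\<rbrakk> \<Longrightarrow> \<phi> (x + y) = \<phi> x + \<phi> y"
  and state_scaleC: "x \<in> B \<Longrightarrow> \<phi> (c *\<^sub>C x) = c * \<phi> x"
  and state_one: "\<phi> 1 = 1"
  using st unfolding state_on_def by auto

lemma state_nonneg: "x \<in> B \<Longrightarrow> 0 \<le> \<phi> (star x * x)"
  using st unfolding state_on_def by (auto simp: less_eq_complex_def complex_is_Real_iff)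

lemma state_zero: "\<phi> 0 = 0"
  using state_scaleC [of 0 0] cstar_subalgebraD [OF B] by simp

lemma state_minus: "x \<in> B \<Longrightarrow> \<phi> (- x) = - \<phi> x"
  using state_scaleC [of x "-1"] by (simp add: scaleC_minus_left)

lemma state_diff: "\<lbrakk>x \<in> B; y \<in> B\<rbrakk> \<Longrightarrow> \<phi> (x - y) = \<phi> x - \<phi> y"
  using state_add [of x "-y"] state_minus [of y] cstar_subalgebraD [OF B] by simp

lemma state_sum: "(\<And>i. i \<in> S \<Longrightarrow> f i \<in> B) \<Longrightarrow> \<phi> (sum f S) = (\<Sum>i\<in>S. \<phi> (f i))"
  by (induction S rule: infinite_finite_induct) (auto simp: state_zero state_add cstar_subalgebra_sum [OF B])

text \<open>The definition of a state demands positivity, and hermiticity has to be extracted from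
  it: expanding at \<open>1 + y\<close> shows that \<open>\<phi> y + \<phi> (star y)\<close> is
  real, and the choice y = \<i> x turns this into the equality of the real parts.\<close>

lemma state_star:
  assumes x: "x \<in> B"
  shows "\<phi> (star x) = cnj (\<phi> x)"
proof -
  note m = cstar_subalgebraD [OF B]
  have im: "Im (\<phi> y) + Im (\<phi> (star y)) = 0" if y: "y \<in> B" for y
  proof -
    have "star (1 + y) * (1 + y) = (1 + y) + (star y + star y * y)"
      by (simp add: star_add algebra_simps)
    then have "\<phi> (star (1 + y) * (1 + y)) = (1 + \<phi> y) + (\<phi> (star y) + \<phi> (star y * y))"
      using y by (simp add: state_add state_one m)
    then show ?thesis
      using state_nonneg [OF y] state_nonneg [of "1 + y"] y m by (simp add: less_eq_complex_def)
  qed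
  have "\<phi> (star (\<i> *\<^sub>C x)) = - \<i> * \<phi> (star x)" "\<phi> (\<i> *\<^sub>C x) = \<i> * \<phi> x"
    using x m by (simp_all add: star_scaleC state_scaleC scaleC_minus_left state_minus)
  then show ?thesis
    using im [OF x] im [of "\<i> *\<^sub>C x"] x m by (auto simp: complex_eq_iff)
qed

lemma state_Cauchy_Schwarz:
  assumes x: "x \<in> B" and y: "y \<in> B"
  shows "(cmod (\<phi> (star x * y)))\<^sup>2 \<le> Re (\<phi> (star x * x)) * Re (\<phi> (star y * y))"
proof (rule discriminant_bound)
  note m = cstar_subalgebraD [OF B]
  define b where "b = \<phi> (star x * y)"
  fix t :: real
  \<comment> \<open>This scalar turns both mixed terms into - t times the squared modulus of b,
    whatever the phase of b.\<close>
  define l where "l = - of_real t * cnj b"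
  have yx: "\<phi> (star y * x) = cnj b"
    using state_star [of "star x * y"] x y m by (simp add: b_def star_mult star_star)
  have "star (x + l *\<^sub>C y) * (x + l *\<^sub>C y)
      = (star x * x + l *\<^sub>C (star x * y)) + (cnj l *\<^sub>C (star y * x) + (l * cnj l) *\<^sub>C (star y * y))"
    by (simp add: star_add star_scaleC algebra_simps scaleC_mult_left scaleC_mult_right scaleC_scaleC scaleC_add_right)
  then have "\<phi> (star (x + l *\<^sub>C y) * (x + l *\<^sub>C y))
      = (\<phi> (star x * x) + l * b) + (cnj l * cnj b + (l * cnj l) * \<phi> (star y * y))"
    using x y m by (simp add: state_add state_scaleC b_def [symmetric] yx)
  moreover have "l * b = - of_real (t * (cmod b)\<^sup>2)"
    using complex_norm_square [of b] by (simp add: l_def mult_ac)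
  moreover have "cnj l * cnj b = - of_real (t * (cmod b)\<^sup>2)"
    using complex_norm_square [of b] by (simp add: l_def mult_ac)
  moreover have "l * cnj l = of_real (t\<^sup>2 * (cmod b)\<^sup>2)"
    using complex_norm_square [of b] by (simp add: l_def power2_eq_square mult_ac)
  ultimately have "\<phi> (star (x + l *\<^sub>C y) * (x + l *\<^sub>C y))
      = \<phi> (star x * x) - of_real (2 * t * (cmod b)\<^sup>2) + of_real (t\<^sup>2 * (cmod b)\<^sup>2) * \<phi> (star y * y)"
    by simp
  then show "0 \<le> Re (\<phi> (star x * x)) - 2 * t * (cmod (\<phi> (star x * y)))\<^sup>2
      + t\<^sup>2 * (cmod (\<phi> (star x * y)))\<^sup>2 * Re (\<phi> (star y * y))"
    using state_nonneg [of "x + l *\<^sub>C y"] x y m by (simp add: less_eq_complex_def b_def [symmetric])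
next
  show "0 \<le> Re (\<phi> (star y * y))"
    using state_nonneg [OF y] by (simp add: less_eq_complex_def)
qed simp

text \<open>With c the square of \<open>norm x\<close>, the element c - x* x is c times the square
  of a self-adjoint \<open>s\<close>, and \<open>star (s * y) * (s * y)\<close> has a nonnegative
  value. At y = 1 this makes states continuous.\<close>

lemma state_conj_bound:
  assumes x: "x \<in> B" and y: "y \<in> B"
  shows "Re (\<phi> (star (x * y) * (x * y))) \<le> (norm x)\<^sup>2 * Re (\<phi> (star y * y))"
proof (cases "x = 0")
  case False
  note m = cstar_subalgebraD [OF B]
  define c where "c = (norm x)\<^sup>2"
  have c: "c > 0" using False by (simp add: c_def)
  define h where "h = (1 / c) *\<^sub>R (star x * x)"
  have "h \<in> B" using x m by (simp add: h_def)
  moreover have "star h = h" by (simp add: h_def star_scaleR star_mult star_star)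
  moreover have "norm h \<le> 1" using c by (simp add: h_def cstar_identity c_def [symmetric])
  ultimately obtain s where s: "s \<in> B" "star s = s" "s * s = 1 - h"
    using cstar_sqrt_one_minus [OF B] by metis
  have "star (s * y) * (s * y) = star y * (s * s) * y"
    by (simp only: star_mult s(2) mult.assoc)
  also have "\<dots> = star y * y - (1 / c) *\<^sub>R (star (x * y) * (x * y))"
    unfolding s h_def by (simp add: star_mult algebra_simps)
  finally have "0 \<le> \<phi> (star y * y - of_real (1 / c) *\<^sub>C (star (x * y) * (x * y)))"
    using state_nonneg [of "s * y"] s y m by (simp only: scaleC_of_real)
  also have "\<dots> = \<phi> (star y * y) - of_real (1 / c) * \<phi> (star (x * y) * (x * y))"
    using x y m by (simp only: state_diff state_scaleC)
  finally show ?thesis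
    using c by (simp add: less_eq_complex_def c_def [symmetric] field_simps)
qed (simp add: state_zero)

lemma state_norm_le:
  assumes x: "x \<in> B"
  shows "cmod (\<phi> x) \<le> norm x"
proof -
  note m = cstar_subalgebraD [OF B]
  have "(cmod (\<phi> (star 1 * x)))\<^sup>2 \<le> Re (\<phi> (star 1 * 1)) * Re (\<phi> (star x * x))"
    by (rule state_Cauchy_Schwarz) (simp_all add: m x)
  also have "\<dots> \<le> (norm x)\<^sup>2"
    using state_conj_bound [OF x m(2)] by (simp add: state_one)
  finally have "(cmod (\<phi> x))\<^sup>2 \<le> (norm x)\<^sup>2" by simp
  then show ?thesis by (rule power2_le_imp_le) simp
qed

lemma state_tendsto:
  assumes "\<And>n. s n \<in> B" "s \<longlonglongrightarrow> x" "x \<in> B"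
  shows "(\<lambda>n. \<phi> (s n)) \<longlonglongrightarrow> \<phi> x"
proof (rule LIM_zero_cancel, rule Lim_null_comparison)
  show "\<forall>\<^sub>F n in sequentially. norm (\<phi> (s n) - \<phi> x) \<le> norm (s n - x)"
    using assms state_norm_le [of "s _ - x"] cstar_subalgebraD(9) [OF B] by (auto simp: state_diff)
  show "(\<lambda>n. norm (s n - x)) \<longlonglongrightarrow> 0"
    using assms(2) by (simp add: LIM_zero tendsto_norm_zero)
qed

end

lemma state_on_subset: "\<lbrakk>state_on B \<phi>; A \<subseteq> B\<rbrakk> \<Longrightarrow> state_on A \<phi>"
  unfolding state_on_def by blast

subsection \<open>Complex Hilbert spaces\<close>

lemma cinner_add_left: "cinner (x + y) z = cinner x z + cinner y z"
  by (metis cinner_commute cinner_add_right complex_cnj_add)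

lemma cinner_scaleC_left: "cinner (c *\<^sub>C x) y = cnj c * cinner x y"
  by (metis cinner_commute cinner_scaleC_right complex_cnj_mult)

lemma cinner_scaleR_right: "cinner x (r *\<^sub>R y) = of_real r * cinner x y"
  by (metis scaleC_of_real cinner_scaleC_right)

lemma cinner_scaleR_left: "cinner (r *\<^sub>R x) y = of_real r * cinner x y"
  by (metis complex_cnj_complex_of_real scaleC_of_real cinner_scaleC_left)

lemma cinner_self: "cinner x x = of_real ((norm x)\<^sup>2)"
proof -
  have "Im (cinner x x) = 0" using cinner_commute [of x x] by (simp add: complex_eq_iff)
  then show ?thesis by (simp add: complex_eq_iff Re_cinner power2_norm_eq_inner)
qed

lemma norm_scaleC_hilbert: "norm (c *\<^sub>C x) = cmod c * norm (x::'h::complex_hilbert)"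
proof -
  have "complex_of_real ((norm (c *\<^sub>C x))\<^sup>2) = cinner (c *\<^sub>C x) (c *\<^sub>C x)"
    by (simp only: cinner_self)
  also have "\<dots> = (c * cnj c) * cinner x x"
    by (simp add: cinner_scaleC_left cinner_scaleC_right mult_ac)
  also have "\<dots> = of_real ((cmod c * norm x)\<^sup>2)"
    by (simp only: complex_norm_square [symmetric] cinner_self of_real_mult power_mult_distrib)
  finally have "(norm (c *\<^sub>C x))\<^sup>2 = (cmod c * norm x)\<^sup>2" by (simp only: of_real_eq_iff)
  then show ?thesis by (rule power2_eq_imp_eq) simp_all
qed

lemma cmod_cinner_le: "cmod (cinner x y) \<le> norm x * norm y"
proof (cases "cinner x y = 0")
  case False
  define b where "b = cinner x y"
  have "(cmod b)\<^sup>2 = Re (cinner x (cnj b *\<^sub>C y))"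
    using cmod_power2 [of b] by (simp add: cinner_scaleC_right b_def [symmetric] power2_eq_square)
  also have "\<dots> \<le> norm x * norm (cnj b *\<^sub>C y)"
    unfolding Re_cinner by (rule norm_cauchy_schwarz)
  finally have "cmod b * cmod b \<le> cmod b * (norm x * norm y)"
    by (simp add: norm_scaleC_hilbert power2_eq_square mult_ac)
  then show ?thesis using False by (simp add: b_def)
qed simp

lemma bounded_bilinear_cinner: "bounded_bilinear (cinner :: 'h::complex_hilbert \<Rightarrow> _)"
  by standard (auto simp: cinner_add_left cinner_add_right cinner_scaleR_left cinner_scaleR_right scaleR_conv_of_real
      intro!: exI [of _ 1] cmod_cinner_le)

lemmas tendsto_cinner = bounded_bilinear.tendsto [OF bounded_bilinear_cinner]
lemmas cinner_diff_left = bounded_bilinear.diff_left [OF bounded_bilinear_cinner]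
lemmas cinner_diff_right = bounded_bilinear.diff_right [OF bounded_bilinear_cinner]
lemmas cinner_sum_left = bounded_bilinear.sum_left [OF bounded_bilinear_cinner]
lemmas cinner_sum_right = bounded_bilinear.sum_right [OF bounded_bilinear_cinner]

lemma bounded_linear_scaleC_hilbert: "bounded_linear ((*\<^sub>C) c :: 'h::complex_hilbert \<Rightarrow> 'h)"
  by (rule bounded_linear_intro [where K = "cmod c"])
     (simp_all add: scaleC_add_right scaleC_scaleR norm_scaleC_hilbert)

lemmas tendsto_scaleC_hilbert = bounded_linear.tendsto [OF bounded_linear_scaleC_hilbert]

lemma closed_csubspaceD:
  assumes "closed_csubspace (H::'h::complex_hilbert set)"
  shows "closed H" "0 \<in> H" "\<And>x y. \<lbrakk>x \<in> H; y \<in> H\<rbrakk> \<Longrightarrow> x + y \<in> H" "\<And>c x. x \<in> H \<Longrightarrow> c *\<^sub>C x \<in> H"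
    "\<And>x y. \<lbrakk>x \<in> H; y \<in> H\<rbrakk> \<Longrightarrow> x - y \<in> H" "\<And>r x. x \<in> H \<Longrightarrow> r *\<^sub>R x \<in> H"
proof -
  show *: "closed H" "0 \<in> H" "\<And>x y. \<lbrakk>x \<in> H; y \<in> H\<rbrakk> \<Longrightarrow> x + y \<in> H" "\<And>c x. x \<in> H \<Longrightarrow> c *\<^sub>C x \<in> H"
    using assms unfolding closed_csubspace_def by auto
  show "x - y \<in> H" if "x \<in> H" "y \<in> H" for x y
    using *(3) [OF that(1) *(4) [OF that(2), of "-1"]] by (simp add: scaleC_minus_left)
  show "r *\<^sub>R x \<in> H" if "x \<in> H" for r x using *(4) [OF that, of "of_real r"] by (simp add: scaleC_of_real)
qed

text \<open>The families \<open>x\<close> and \<open>y\<close> may be neither linear nor injective;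
  the Lipschitz bound makes the limit depend on \<open>z\<close> alone. The conclusion speaks of
  sequences because linearity, norm bounds and intertwining are all obtained by passing to the
  limit. It is applied to cyclic vectors and, with \<open>x\<close> the identity, to a functional on
  a union of algebras.\<close>

lemma dense_extension:
  fixes x :: "'b \<Rightarrow> 'm::real_normed_vector" and y :: "'b \<Rightarrow> 'n::banach"
  assumes bound: "\<And>b c. \<lbrakk>b \<in> B; c \<in> B\<rbrakk> \<Longrightarrow> norm (y b - y c) \<le> M * norm (x b - x c)"
  obtains T where "\<And>s z. \<lbrakk>\<And>n. s n \<in> B; (\<lambda>n. x (s n)) \<longlonglongrightarrow> z\<rbrakk> \<Longrightarrow> (\<lambda>n. y (s n)) \<longlonglongrightarrow> T z"
proof -
  define adm where "adm z s \<longleftrightarrow> (\<forall>n::nat. s n \<in> B) \<and> (\<lambda>n. x (s n)) \<longlonglongrightarrow> z" for z s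
  have conv: "convergent (\<lambda>n. y (s n))" if s: "adm z s" for z s
  proof -
    have "Cauchy (\<lambda>n. y (s n))"
    proof (rule metric_CauchyI)
      fix e :: real assume e: "0 < e"
      \<comment> \<open>The absolute value covers a negative M, the summand 1 covers M = 0.\<close>
      define d where "d = e / (\<bar>M\<bar> + 1)"
      have d: "d > 0" using e by (simp add: d_def)
      have "Cauchy (\<lambda>n. x (s n))" using s by (auto simp: adm_def intro: LIMSEQ_imp_Cauchy)
      then obtain N where N: "\<And>m n. \<lbrakk>m \<ge> N; n \<ge> N\<rbrakk> \<Longrightarrow> dist (x (s m)) (x (s n)) < d"
        using d by (metis metric_CauchyD)
      have "dist (y (s m)) (y (s n)) < e" if "m \<ge> N" "n \<ge> N" for m n
      proof -
        have "dist (y (s m)) (y (s n)) \<le> M * dist (x (s m)) (x (s n))"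
          using s bound by (simp add: adm_def dist_norm)
        also have "\<dots> \<le> (\<bar>M\<bar> + 1) * dist (x (s m)) (x (s n))"
          by (rule mult_right_mono) auto
        also have "\<dots> < (\<bar>M\<bar> + 1) * d"
          using N [OF that] by (simp add: mult_strict_left_mono)
        finally show ?thesis by (simp add: d_def)
      qed
      then show "\<exists>N. \<forall>m\<ge>N. \<forall>n\<ge>N. dist (y (s m)) (y (s n)) < e"
        by (intro exI [of _ N]) simp
    qed
    then show ?thesis by (simp add: Cauchy_convergent_iff)
  qed
  define T where "T z = lim (\<lambda>n. y ((SOME s. adm z s) n))" for z
  show ?thesis
  proof (rule that)
    fix s z assume "\<And>n. s n \<in> B" "(\<lambda>n. x (s n)) \<longlonglongrightarrow> z"
    then have s: "adm z s" by (simp add: adm_def)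
    define t where "t = (SOME s. adm z s)"
    have t: "adm z t" unfolding t_def by (rule someI [where P = "adm z"]) (rule s)
    have lim_t: "(\<lambda>n. y (t n)) \<longlonglongrightarrow> T z"
      unfolding T_def t_def [symmetric] using conv [OF t] by (simp add: convergent_LIMSEQ_iff)
    have "(\<lambda>n. y (s n) - y (t n)) \<longlonglongrightarrow> 0"
    proof (rule Lim_null_comparison)
      show "\<forall>\<^sub>F n in sequentially. norm (y (s n) - y (t n)) \<le> M * norm (x (s n) - x (t n))"
        using s t bound by (simp add: adm_def)
      have "(\<lambda>n. M * norm (x (s n) - x (t n))) \<longlonglongrightarrow> M * norm (z - z)"
        by (intro tendsto_intros) (use s t in \<open>auto simp: adm_def\<close>)
      then show "(\<lambda>n. M * norm (x (s n) - x (t n))) \<longlonglongrightarrow> 0" by simp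
    qed
    then show "(\<lambda>n. y (s n)) \<longlonglongrightarrow> T z"
      using tendsto_add [OF _ lim_t] by fastforce
  qed
qed

section \<open>Linear families in a Hilbert space: extension by density and the Riesz
  theorem\<close>

definition clinear_family :: "'a::cstar_algebra set \<Rightarrow> ('a \<Rightarrow> 'h::complex_hilbert) \<Rightarrow> bool" where
  "clinear_family B x \<longleftrightarrow>
     (\<forall>b\<in>B. \<forall>c\<in>B. x (b + c) = x b + x c) \<and> (\<forall>k. \<forall>b\<in>B. x (k *\<^sub>C b) = k *\<^sub>C x b)"

lemma clinear_familyD:
  assumes "cstar_subalgebra B" "clinear_family B x"
  shows "\<And>b c. \<lbrakk>b \<in> B; c \<in> B\<rbrakk> \<Longrightarrow> x (b + c) = x b + x c"
    "\<And>b k. b \<in> B \<Longrightarrow> x (k *\<^sub>C b) = k *\<^sub>C x b"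
    "x 0 = 0" "\<And>b c. \<lbrakk>b \<in> B; c \<in> B\<rbrakk> \<Longrightarrow> x (b - c) = x b - x c"
    "\<And>b r. b \<in> B \<Longrightarrow> x (r *\<^sub>R b) = r *\<^sub>R x b"
proof -
  note m = cstar_subalgebraD [OF assms(1)]
  show add: "x (b + c) = x b + x c" if "b \<in> B" "c \<in> B" for b c
    using assms(2) that unfolding clinear_family_def by blast
  show sc: "x (k *\<^sub>C b) = k *\<^sub>C x b" if "b \<in> B" for b k
    using assms(2) that unfolding clinear_family_def by blast
  show "x 0 = 0" using sc [OF m(3), of 0] by simp
  show "x (b - c) = x b - x c" if "b \<in> B" "c \<in> B" for b c
    using add [OF that(1) m(8) [OF that(2)]] sc [OF that(2), of "-1"] by (simp add: scaleC_minus_left)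
  show "x (r *\<^sub>R b) = r *\<^sub>R x b" if "b \<in> B" for b r
    using sc [OF that, of "of_real r"] by (simp add: scaleC_of_real)
qed

lemma closure_range_sequence:
  assumes "z \<in> closure (x ` B)"
  obtains s where "\<And>n::nat. s n \<in> B" "(\<lambda>n. x (s n)) \<longlonglongrightarrow> (z::'m::metric_space)"
proof -
  from assms obtain t where t: "\<forall>n. t n \<in> x ` B" "t \<longlonglongrightarrow> z"
    unfolding closure_sequential by blast
  have "\<forall>n. \<exists>b. b \<in> B \<and> t n = x b" using t(1) by (simp add: image_iff Bex_def)
  then obtain s where "\<And>n. s n \<in> B" "\<And>n. t n = x (s n)" by metis
  moreover from this have "t = (\<lambda>n. x (s n))" by blast
  ultimately show ?thesis using t(2) that by blast
qed

lemma sequence_in_closure_range: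
  "\<lbrakk>\<And>n::nat. s n \<in> B; (\<lambda>n. x (s n)) \<longlonglongrightarrow> (z::'m::metric_space)\<rbrakk> \<Longrightarrow> z \<in> closure (x ` B)"
  unfolding closure_sequential by (intro exI [of _ "\<lambda>n. x (s n)"]) auto

lemma closed_csubspace_closure_range:
  assumes B: "cstar_subalgebra B" and x: "clinear_family B x"
  shows "closed_csubspace (closure (x ` B))"
proof -
  note m = cstar_subalgebraD [OF B] and l = clinear_familyD [OF B x]
  have "0 \<in> closure (x ` B)" using l(3) m(3) by (metis closure_subset imageI subsetD)
  moreover have "u + v \<in> closure (x ` B)" if uv: "u \<in> closure (x ` B)" "v \<in> closure (x ` B)" for u v
  proof -
    obtain s t where "\<And>n::nat. s n \<in> B" "(\<lambda>n. x (s n)) \<longlonglongrightarrow> u" "\<And>n::nat. t n \<in> B" "(\<lambda>n. x (t n)) \<longlonglongrightarrow> v"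
      using uv by (metis closure_range_sequence)
    then show ?thesis
      using tendsto_add [of "\<lambda>n. x (s n)" u _ "\<lambda>n. x (t n)" v]
      by (intro sequence_in_closure_range [where s = "\<lambda>n. s n + t n"]) (auto simp: l m)
  qed
  moreover have "c *\<^sub>C u \<in> closure (x ` B)" if u: "u \<in> closure (x ` B)" for u c
  proof -
    obtain s where "\<And>n::nat. s n \<in> B" "(\<lambda>n. x (s n)) \<longlonglongrightarrow> u"
      using u by (metis closure_range_sequence)
    then show ?thesis
      using tendsto_scaleC_hilbert [of "\<lambda>n. x (s n)" u _ c]
      by (intro sequence_in_closure_range [where s = "\<lambda>n. c *\<^sub>C s n"]) (auto simp: l m)
  qed
  ultimately show ?thesis unfolding closed_csubspace_def by auto
qed

text \<open>The model for \<open>x\<close> is \<open>b \<mapsto> \<pi> b \<Omega>\<close>. A map on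
  the cyclic subspace is prescribed by its values \<open>y b\<close> at the vectors
  \<open>x b\<close>; the bound makes this independent of the choice of \<open>b\<close> and
  continuous.\<close>

lemma linear_extension:
  fixes x :: "'a::cstar_algebra \<Rightarrow> 'm::complex_hilbert" and y :: "'a \<Rightarrow> 'n::complex_hilbert"
  assumes B: "cstar_subalgebra B" and x: "clinear_family B x" and y: "clinear_family B y"
    and bound: "\<And>b. b \<in> B \<Longrightarrow> norm (y b) \<le> M * norm (x b)"
  obtains T where
    "\<And>s z. \<lbrakk>\<And>n. s n \<in> B; (\<lambda>n. x (s n)) \<longlonglongrightarrow> z\<rbrakk> \<Longrightarrow> (\<lambda>n. y (s n)) \<longlonglongrightarrow> T z"
    "\<And>b. b \<in> B \<Longrightarrow> T (x b) = y b"
    "\<And>z. z \<in> closure (x ` B) \<Longrightarrow> T z \<in> closure (y ` B)"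
    "\<And>u v. \<lbrakk>u \<in> closure (x ` B); v \<in> closure (x ` B)\<rbrakk> \<Longrightarrow> T (u + v) = T u + T v"
    "\<And>c u. u \<in> closure (x ` B) \<Longrightarrow> T (c *\<^sub>C u) = c *\<^sub>C T u"
    "\<And>u. u \<in> closure (x ` B) \<Longrightarrow> norm (T u) \<le> M * norm u"
proof -
  note m = cstar_subalgebraD [OF B] and lx = clinear_familyD [OF B x] and ly = clinear_familyD [OF B y]
  have "norm (y b - y c) \<le> M * norm (x b - x c)" if "b \<in> B" "c \<in> B" for b c
    using bound [OF m(9) [OF that]] that by (simp add: lx ly)
  then obtain T where T: "\<And>s z. \<lbrakk>\<And>n. s n \<in> B; (\<lambda>n. x (s n)) \<longlonglongrightarrow> z\<rbrakk> \<Longrightarrow> (\<lambda>n. y (s n)) \<longlonglongrightarrow> T z"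
    using dense_extension [of B y M x] by blast
  show ?thesis
  proof (rule that [OF T])
    show "T (x b) = y b" if "b \<in> B" for b
      using T [of "\<lambda>_. b" "x b"] that by (simp add: LIMSEQ_const_iff)
  next
    fix z assume "z \<in> closure (x ` B)"
    then show "T z \<in> closure (y ` B)"
      by (metis T closure_range_sequence sequence_in_closure_range)
  next
    fix u v assume "u \<in> closure (x ` B)" "v \<in> closure (x ` B)"
    then obtain s t where s: "\<And>n::nat. s n \<in> B" "(\<lambda>n. x (s n)) \<longlonglongrightarrow> u"
      and t: "\<And>n::nat. t n \<in> B" "(\<lambda>n. x (t n)) \<longlonglongrightarrow> v"
      by (metis closure_range_sequence)
    have "(\<lambda>n. y (s n + t n)) \<longlonglongrightarrow> T (u + v)"
      using s t by (intro T) (auto simp: lx m intro!: tendsto_intros)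
    moreover have "(\<lambda>n. y (s n + t n)) \<longlonglongrightarrow> T u + T v"
      using tendsto_add [OF T [OF s] T [OF t]] s t by (simp add: ly)
    ultimately show "T (u + v) = T u + T v" by (rule LIMSEQ_unique)
  next
    fix c u assume "u \<in> closure (x ` B)"
    then obtain s where s: "\<And>n::nat. s n \<in> B" "(\<lambda>n. x (s n)) \<longlonglongrightarrow> u" by (metis closure_range_sequence)
    have "(\<lambda>n. y (c *\<^sub>C s n)) \<longlonglongrightarrow> T (c *\<^sub>C u)"
      using s by (intro T) (auto simp: lx m intro!: tendsto_scaleC_hilbert)
    moreover have "(\<lambda>n. y (c *\<^sub>C s n)) \<longlonglongrightarrow> c *\<^sub>C T u"
      using tendsto_scaleC_hilbert [OF T [OF s]] s by (simp add: ly)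
    ultimately show "T (c *\<^sub>C u) = c *\<^sub>C T u" by (rule LIMSEQ_unique)
  next
    fix u assume "u \<in> closure (x ` B)"
    then obtain s where s: "\<And>n::nat. s n \<in> B" "(\<lambda>n. x (s n)) \<longlonglongrightarrow> u" by (metis closure_range_sequence)
    show "norm (T u) \<le> M * norm u"
      by (rule LIMSEQ_le [OF tendsto_norm [OF T [OF s]] tendsto_mult_left [OF tendsto_norm [OF s(2)]]])
         (use s bound in auto)
  qed
qed

text \<open>The first-order condition at a minimum: a small t of sign opposite to p lets the linear
  term win. The denominator r + 1 in the witness also covers r = 0.\<close>

lemma linear_term_zero:
  fixes p r :: real
  assumes "\<And>t. 0 \<le> 2 * t * p + t\<^sup>2 * r" "0 \<le> r"
  shows "p = 0"
proof (rule ccontr)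
  assume "p \<noteq> 0"
  define t where "t = - p / (r + 1)"
  have p: "p = - t * (r + 1)" using assms(2) by (simp add: t_def)
  have "t * p = - (t\<^sup>2 * (r + 1))"
    using arg_cong [OF p, of "(*) t"] by (simp add: power2_eq_square)
  then have "2 * t * p + t\<^sup>2 * r = - (t\<^sup>2 * (r + 2))" by (simp add: algebra_simps)
  moreover have "t\<^sup>2 * (r + 2) > 0" using \<open>p \<noteq> 0\<close> assms(2) by (simp add: t_def)
  ultimately show False using assms(1) [of t] by simp
qed

text \<open>Direct minimization of a quadratic functional, so that the computation takes place among
  the vectors \<open>x b\<close> and the closure enters as the place where the limit lies.\<close>

lemma Riesz_representation:
  fixes x :: "'a::cstar_algebra \<Rightarrow> 'm::complex_hilbert" and f :: "'a \<Rightarrow> complex"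
  assumes B: "cstar_subalgebra B" and x: "clinear_family B x"
    and f_add: "\<And>b c. \<lbrakk>b \<in> B; c \<in> B\<rbrakk> \<Longrightarrow> f (b + c) = f b + f c"
    and f_scaleC: "\<And>k b. b \<in> B \<Longrightarrow> f (k *\<^sub>C b) = k * f b"
    and bound: "\<And>b. b \<in> B \<Longrightarrow> cmod (f b) \<le> M * norm (x b)"
  obtains v where "v \<in> closure (x ` B)" "\<And>b. b \<in> B \<Longrightarrow> cinner v (x b) = f b"
proof -
  note m = cstar_subalgebraD [OF B] and l = clinear_familyD [OF B x]
  have f_scaleR: "f (r *\<^sub>R b) = of_real r * f b" if "b \<in> B" for r b
    using f_scaleC [OF that, of "of_real r"] by (simp add: scaleC_of_real)
  \<comment> \<open>For the vector v sought, \<open>q b\<close> is the square of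
    \<open>norm (x b - v)\<close> minus the square of \<open>norm v\<close>; minimizing it drives
    \<open>x b\<close> towards v.\<close>
  define q where "q b = (norm (x b))\<^sup>2 - 2 * Re (f b)" for b
  define I where "I = Inf (q ` B)"
  have "- M\<^sup>2 \<le> q b" if "b \<in> B" for b
  proof -
    have "0 \<le> (norm (x b) - M)\<^sup>2" by simp
    then show ?thesis
      using order_trans [OF complex_Re_le_cmod bound [OF that]] unfolding q_def power2_diff
      by (simp add: algebra_simps)
  qed
  then have bdd: "bdd_below (q ` B)" by (rule bdd_belowI2)
  have I_le: "I \<le> q b" if "b \<in> B" for b
    unfolding I_def by (rule cINF_lower [OF bdd that])
  have "\<exists>b\<in>B. q b < I + e" if "e > 0" for e
    using cINF_less_iff [OF _ bdd, of "I + e"] m(2) that by (auto simp: I_def)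
  then have "\<exists>b\<in>B. q b < I + inverse (Suc n)" for n by simp
  then obtain s where s: "\<And>n. s n \<in> B" "\<And>n. q (s n) < I + inverse (Suc n)" by metis
  have q_lim: "(\<lambda>n. q (s n)) \<longlonglongrightarrow> I"
  proof (rule tendsto_sandwich [where f = "\<lambda>_. I"])
    show "(\<lambda>n. I + inverse (Suc n)) \<longlonglongrightarrow> I" by (rule LIMSEQ_inverse_real_of_nat_add)
  qed (use s I_le in \<open>auto simp: less_imp_le\<close>)
  have "Cauchy (\<lambda>n. x (s n))"
  proof (rule metric_CauchyI)
    fix e :: real assume e: "0 < e"
    obtain N where N: "\<And>n. n \<ge> N \<Longrightarrow> q (s n) < I + e\<^sup>2 / 4"
      using order_tendstoD(2) [OF q_lim, of "I + e\<^sup>2 / 4"] e by (auto simp: eventually_sequentially)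
    have "dist (x (s i)) (x (s j)) < e" if "i \<ge> N" "j \<ge> N" for i j
    proof -
      \<comment> \<open>The parallelogram identity at the midpoint: two near-minimizers are close to
        each other because \<open>q c\<close> cannot fall below \<open>I\<close>.\<close>
      define c where "c = (1/2) *\<^sub>R (s i + s j)"
      have c: "c \<in> B" using s m by (simp add: c_def)
      have xc: "x c = (1/2) *\<^sub>R (x (s i) + x (s j))" and fc: "f c = of_real (1/2) * (f (s i) + f (s j))"
        using s m unfolding c_def by (simp_all only: l f_scaleR f_add)
      have "(norm (x (s i) - x (s j)))\<^sup>2 = 2 * q (s i) + 2 * q (s j) - 4 * q c"
        unfolding q_def xc fc power2_norm_eq_inner
        by (simp add: inner_add_left inner_add_right inner_diff_left inner_diff_right inner_commute field_simps)
      also have "\<dots> < e\<^sup>2" using N [OF that(1)] N [OF that(2)] I_le [OF c] by simp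
      finally show ?thesis using e by (simp add: dist_norm power2_less_imp_less)
    qed
    then show "\<exists>N. \<forall>i\<ge>N. \<forall>j\<ge>N. dist (x (s i)) (x (s j)) < e" by blast
  qed
  then obtain v where v: "(\<lambda>n. x (s n)) \<longlonglongrightarrow> v"
    by (auto simp: Cauchy_convergent_iff convergent_def)
  have re: "inner v (x b) = Re (f b)" if b: "b \<in> B" for b
  proof -
    have "0 \<le> 2 * t * (inner v (x b) - Re (f b)) + t\<^sup>2 * (norm (x b))\<^sup>2" for t
    proof -
      have "q (s n + t *\<^sub>R b) = q (s n) + (2 * t * (inner (x (s n)) (x b) - Re (f b)) + t\<^sup>2 * (norm (x b))\<^sup>2)" for n
        using s b m unfolding q_def power2_norm_eq_inner
        by (simp add: l f_add f_scaleR inner_add_left inner_add_right inner_commute power2_eq_square algebra_simps)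
      then have "I \<le> q (s n) + (2 * t * (inner (x (s n)) (x b) - Re (f b)) + t\<^sup>2 * (norm (x b))\<^sup>2)" for n
        using I_le [of "s n + t *\<^sub>R b"] s b m by simp
      moreover have "(\<lambda>n. q (s n) + (2 * t * (inner (x (s n)) (x b) - Re (f b)) + t\<^sup>2 * (norm (x b))\<^sup>2))
          \<longlonglongrightarrow> I + (2 * t * (inner v (x b) - Re (f b)) + t\<^sup>2 * (norm (x b))\<^sup>2)"
        by (intro tendsto_intros q_lim v)
      ultimately have "I \<le> I + (2 * t * (inner v (x b) - Re (f b)) + t\<^sup>2 * (norm (x b))\<^sup>2)"
        by (intro LIMSEQ_le_const) auto
      then show ?thesis by simp
    qed
    then have "inner v (x b) - Re (f b) = 0" by (rule linear_term_zero) simp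
    then show ?thesis by simp
  qed
  have "cinner v (x b) = f b" if b: "b \<in> B" for b
  proof -
    have "Re (cinner v (x b)) = Re (f b)" using re [OF b] by (simp add: Re_cinner)
    \<comment> \<open>The variation controls real parts; taken at -\<i> b it yields the imaginary
      part.\<close>
    moreover have "Re (cinner v (x (- \<i> *\<^sub>C b))) = Re (f (- \<i> *\<^sub>C b))"
      using re [OF m(6) [OF b, of "- \<i>"]] by (simp only: Re_cinner)
    then have "Im (cinner v (x b)) = Im (f b)"
      using b by (simp add: l f_scaleC cinner_scaleC_right del: complex_cnj_minus)
    ultimately show ?thesis by (simp add: complex_eq_iff)
  qed
  moreover have "v \<in> closure (x ` B)" using s(1) v by (rule sequence_in_closure_range)
  ultimately show ?thesis using that by blast
qed

subsection \<open>Representations\<close>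

context
  fixes B :: "'a::cstar_algebra set" and H :: "'h::complex_hilbert set" and \<pi> :: "'a \<Rightarrow> 'h \<Rightarrow> 'h"
  assumes B: "cstar_subalgebra B" and rep: "representation B H \<pi>"
begin

lemma rep_closed_csubspace: "closed_csubspace H"
  and rep_bounded: "b \<in> B \<Longrightarrow> bounded_clinear_on H (\<pi> b)"
  and rep_one: "x \<in> H \<Longrightarrow> \<pi> 1 x = x"
  and rep_add_left: "\<lbrakk>b \<in> B; c \<in> B; x \<in> H\<rbrakk> \<Longrightarrow> \<pi> (b + c) x = \<pi> b x + \<pi> c x"
  and rep_mult: "\<lbrakk>b \<in> B; c \<in> B; x \<in> H\<rbrakk> \<Longrightarrow> \<pi> (b * c) x = \<pi> b (\<pi> c x)"
  and rep_scaleC_left: "\<lbrakk>b \<in> B; x \<in> H\<rbrakk> \<Longrightarrow> \<pi> (k *\<^sub>C b) x = k *\<^sub>C \<pi> b x"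
  and rep_adjoint: "\<lbrakk>b \<in> B; x \<in> H; y \<in> H\<rbrakk> \<Longrightarrow> cinner (\<pi> b x) y = cinner x (\<pi> (star b) y)"
  using rep unfolding representation_def by blast+

lemma rep_mem: "\<lbrakk>b \<in> B; x \<in> H\<rbrakk> \<Longrightarrow> \<pi> b x \<in> H"
  and rep_add: "\<lbrakk>b \<in> B; x \<in> H; y \<in> H\<rbrakk> \<Longrightarrow> \<pi> b (x + y) = \<pi> b x + \<pi> b y"
  and rep_scaleC: "\<lbrakk>b \<in> B; x \<in> H\<rbrakk> \<Longrightarrow> \<pi> b (k *\<^sub>C x) = k *\<^sub>C \<pi> b x"
  using rep_bounded [of b] unfolding bounded_clinear_on_def by blast+

lemma rep_diff: "\<lbrakk>b \<in> B; x \<in> H; y \<in> H\<rbrakk> \<Longrightarrow> \<pi> b (x - y) = \<pi> b x - \<pi> b y"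
  using rep_add [of b x "(-1) *\<^sub>C y"] rep_scaleC [of b y "-1"]
    closed_csubspaceD(4) [OF rep_closed_csubspace, of y "-1"]
  by (simp add: scaleC_minus_left)

lemma rep_sum_scaleR:
  assumes b: "b \<in> B" and x: "\<And>i. x i \<in> H"
  shows "\<pi> b (\<Sum>i\<in>S. r i *\<^sub>R x i) = (\<Sum>i\<in>S. r i *\<^sub>R \<pi> b (x i))"
proof -
  note h = closed_csubspaceD [OF rep_closed_csubspace]
  have zero: "\<pi> b 0 = 0" using rep_scaleC [OF b h(2), of 0] by simp
  have sc: "\<pi> b (r *\<^sub>R y) = r *\<^sub>R \<pi> b y" if "y \<in> H" for r y
    using rep_scaleC [OF b that, of "of_real r"] by (simp add: scaleC_of_real)
  have mem: "(\<Sum>i\<in>S. r i *\<^sub>R x i) \<in> H" for S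
    by (induction S rule: infinite_finite_induct) (auto simp: h x)
  show ?thesis
    by (induction S rule: infinite_finite_induct) (auto simp: zero sc x rep_add [OF b] mem h)
qed

lemma rep_tendsto:
  assumes b: "b \<in> B" and s: "\<And>n. s n \<in> H" "s \<longlonglongrightarrow> z"
  shows "(\<lambda>n. \<pi> b (s n)) \<longlonglongrightarrow> \<pi> b z"
proof -
  note h = closed_csubspaceD [OF rep_closed_csubspace]
  have z: "z \<in> H" using h(1) s by (metis closed_sequentially)
  obtain K where K: "\<And>x. x \<in> H \<Longrightarrow> norm (\<pi> b x) \<le> K * norm x"
    using rep_bounded [OF b] unfolding bounded_clinear_on_def by blast
  show ?thesis
  proof (rule LIM_zero_cancel, rule Lim_null_comparison)
    show "\<forall>\<^sub>F n in sequentially. norm (\<pi> b (s n) - \<pi> b z) \<le> K * norm (s n - z)"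
      using K [OF h(5) [OF s(1) z]] by (simp add: rep_diff b s(1) z)
    have "(\<lambda>n. K * norm (s n - z)) \<longlonglongrightarrow> K * norm (z - z)" by (intro tendsto_intros s)
    then show "(\<lambda>n. K * norm (s n - z)) \<longlonglongrightarrow> 0" by simp
  qed
qed

lemma rep_cinner:
  "\<lbrakk>b \<in> B; c \<in> B; x \<in> H; y \<in> H\<rbrakk> \<Longrightarrow> cinner (\<pi> b x) (\<pi> c y) = cinner x (\<pi> (star b * c) y)"
  using cstar_subalgebraD [OF B] by (simp add: rep_adjoint rep_mem rep_mult)

lemma rep_clinear_family: "\<omega> \<in> H \<Longrightarrow> clinear_family B (\<lambda>b. \<pi> b \<omega>)"
  unfolding clinear_family_def by (simp add: rep_add_left rep_scaleC_left)

lemma rep_cyclic_subset: "\<omega> \<in> H \<Longrightarrow> closure ((\<lambda>b. \<pi> b \<omega>) ` B) \<subseteq> H"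
  using closed_csubspaceD(1) [OF rep_closed_csubspace] by (intro closure_minimal) (auto simp: rep_mem)

lemma rep_cyclic_mem: "\<omega> \<in> H \<Longrightarrow> \<omega> \<in> closure ((\<lambda>b. \<pi> b \<omega>) ` B)"
  using cstar_subalgebraD(2) [OF B] rep_one closure_subset by (metis (no_types, lifting) image_eqI subsetD)

lemma rep_cyclic_invariant:
  assumes w: "\<omega> \<in> H" and b: "b \<in> B" and z: "z \<in> closure ((\<lambda>b. \<pi> b \<omega>) ` B)"
  shows "\<pi> b z \<in> closure ((\<lambda>b. \<pi> b \<omega>) ` B)"
proof -
  obtain s where s: "\<And>n::nat. s n \<in> B" "(\<lambda>n. \<pi> (s n) \<omega>) \<longlonglongrightarrow> z"
    using closure_range_sequence [OF z] by blast
  have "(\<lambda>n. \<pi> (b * s n) \<omega>) \<longlonglongrightarrow> \<pi> b z"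
    using rep_tendsto [OF b _ s(2)] s(1) w b by (simp add: rep_mult rep_mem)
  then show ?thesis
    using s(1) b cstar_subalgebraD(5) [OF B] by (intro sequence_in_closure_range [where s = "\<lambda>n. b * s n"]) auto
qed

lemma rep_cyclic_subrepresentation:
  "\<omega> \<in> H \<Longrightarrow> subrepresentation B H \<pi> (closure ((\<lambda>b. \<pi> b \<omega>) ` B))"
  unfolding subrepresentation_def
  using rep_cyclic_subset rep_cyclic_invariant closed_csubspace_closure_range [OF B rep_clinear_family] by blast

end

section \<open>Cyclic subrepresentations and the Radon-Nikodym argument\<close>

lemma cyclic_subrepresentations_equivalent:
  assumes B: "cstar_subalgebra B" and r1: "representation B H1 \<pi>1" and r2: "representation B H2 \<pi>2"
    and xi: "\<xi> \<in> H1" and eta: "\<eta> \<in> H2"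
    and eq: "\<And>b. b \<in> B \<Longrightarrow> cinner \<xi> (\<pi>1 b \<xi>) = cinner \<eta> (\<pi>2 b \<eta>)"
  shows "unitarily_equivalent B (closure ((\<lambda>b. \<pi>1 b \<xi>) ` B)) \<pi>1 (closure ((\<lambda>b. \<pi>2 b \<eta>) ` B)) \<pi>2"
proof -
  note m = cstar_subalgebraD [OF B]
  \<comment> \<open>A vector functional determines all inner products inside the orbit of its
    vector. Hence \<open>\<pi>1 b \<xi> \<mapsto> \<pi>2 b \<eta>\<close> is isometric in both
    directions, and the inverse of \<open>U\<close> is obtained by extending the reverse
    assignment.\<close>
  have inner_eq: "cinner (\<pi>1 b \<xi>) (\<pi>1 c \<xi>) = cinner (\<pi>2 b \<eta>) (\<pi>2 c \<eta>)" if "b \<in> B" "c \<in> B" for b c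
    using that m by (simp add: rep_cinner [OF B r1] rep_cinner [OF B r2] xi eta eq)
  have norm_eq: "norm (\<pi>1 b \<xi>) = norm (\<pi>2 b \<eta>)" if "b \<in> B" for b
  proof -
    have "(norm (\<pi>1 b \<xi>))\<^sup>2 = (norm (\<pi>2 b \<eta>))\<^sup>2"
      using inner_eq [OF that that] by (simp only: cinner_self of_real_eq_iff)
    then show ?thesis by (rule power2_eq_imp_eq) simp_all
  qed
  note f1 = rep_clinear_family [OF B r1 xi] and f2 = rep_clinear_family [OF B r2 eta]
  let ?K1 = "closure ((\<lambda>b. \<pi>1 b \<xi>) ` B)" and ?K2 = "closure ((\<lambda>b. \<pi>2 b \<eta>) ` B)"
  obtain U where U: "\<And>s z. \<lbrakk>\<And>n. s n \<in> B; (\<lambda>n. \<pi>1 (s n) \<xi>) \<longlonglongrightarrow> z\<rbrakk> \<Longrightarrow> (\<lambda>n. \<pi>2 (s n) \<eta>) \<longlonglongrightarrow> U z"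
    and UK: "\<And>z. z \<in> ?K1 \<Longrightarrow> U z \<in> ?K2"
    and Uadd: "\<And>u v. \<lbrakk>u \<in> ?K1; v \<in> ?K1\<rbrakk> \<Longrightarrow> U (u + v) = U u + U v"
    and Usc: "\<And>c u. u \<in> ?K1 \<Longrightarrow> U (c *\<^sub>C u) = c *\<^sub>C U u"
    by (rule linear_extension [OF B f1 f2, of 1]) (simp add: norm_eq, blast)
  obtain V where V: "\<And>s z. \<lbrakk>\<And>n. s n \<in> B; (\<lambda>n. \<pi>2 (s n) \<eta>) \<longlonglongrightarrow> z\<rbrakk> \<Longrightarrow> (\<lambda>n. \<pi>1 (s n) \<xi>) \<longlonglongrightarrow> V z"
    and VK: "\<And>z. z \<in> ?K2 \<Longrightarrow> V z \<in> ?K1"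
    by (rule linear_extension [OF B f2 f1, of 1]) (simp add: norm_eq, blast)
  have VU: "V (U z) = z" if "z \<in> ?K1" for z
    using that by (rule closure_range_sequence) (metis U V LIMSEQ_unique)
  have UV: "U (V z) = z" if "z \<in> ?K2" for z
    using that by (rule closure_range_sequence) (metis U V LIMSEQ_unique)
  have "bij_betw U ?K1 ?K2"
    by (rule bij_betwI [where g = V]) (auto simp: UK VK VU UV)
  moreover have "cinner (U u) (U v) = cinner u v" if u: "u \<in> ?K1" and v: "v \<in> ?K1" for u v
  proof -
    obtain s where s: "\<And>n::nat. s n \<in> B" "(\<lambda>n. \<pi>1 (s n) \<xi>) \<longlonglongrightarrow> u"
      using closure_range_sequence [OF u] by blast
    obtain t where t: "\<And>n::nat. t n \<in> B" "(\<lambda>n. \<pi>1 (t n) \<xi>) \<longlonglongrightarrow> v"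
      using closure_range_sequence [OF v] by blast
    have "(\<lambda>n. cinner (\<pi>1 (s n) \<xi>) (\<pi>1 (t n) \<xi>)) \<longlonglongrightarrow> cinner (U u) (U v)"
      using tendsto_cinner [OF U [OF s] U [OF t]] by (simp add: inner_eq s(1) t(1))
    then show ?thesis
      using tendsto_cinner [OF s(2) t(2)] by (rule LIMSEQ_unique)
  qed
  moreover have "U (\<pi>1 b z) = \<pi>2 b (U z)" if b: "b \<in> B" and z: "z \<in> ?K1" for b z
  proof -
    obtain s where s: "\<And>n::nat. s n \<in> B" "(\<lambda>n. \<pi>1 (s n) \<xi>) \<longlonglongrightarrow> z"
      using closure_range_sequence [OF z] by blast
    have "(\<lambda>n. \<pi>1 (b * s n) \<xi>) \<longlonglongrightarrow> \<pi>1 b z"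
      using rep_tendsto [OF B r1 b _ s(2)] s(1) b xi by (simp add: rep_mult [OF B r1] rep_mem [OF B r1])
    then have "(\<lambda>n. \<pi>2 (b * s n) \<eta>) \<longlonglongrightarrow> U (\<pi>1 b z)"
      using s(1) b m by (intro U) auto
    moreover have "(\<lambda>n. \<pi>2 (b * s n) \<eta>) \<longlonglongrightarrow> \<pi>2 b (U z)"
      using rep_tendsto [OF B r2 b _ U [OF s]] s(1) b eta by (simp add: rep_mult [OF B r2] rep_mem [OF B r2])
    ultimately show ?thesis by (rule LIMSEQ_unique)
  qed
  ultimately show ?thesis
    unfolding unitarily_equivalent_def using Uadd Usc by blast
qed

text \<open>Squaring a partial sum of the series yields a square of index pairs, whereas the
  convolution identity evaluates triangles; absolute summability makes the remaining corner
  negligible. The limit is the polynomial 1 - t with \<open>f n\<close> in place of the n-th power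
  of t.\<close>

lemma sqrt_coeff_double_sum:
  fixes f :: "nat \<Rightarrow> complex"
  assumes bound: "\<And>k. cmod (f k) \<le> F"
  shows "(\<lambda>N. \<Sum>i<N. \<Sum>j<N. of_real (sqrt_coeff i * sqrt_coeff j) * f (i + j)) \<longlonglongrightarrow> f 0 - f 1"
proof -
  define g where "g = (\<lambda>(i, j). of_real (sqrt_coeff i * sqrt_coeff j) * f (i + j))"
  define h where "h = (\<lambda>(i, j). \<bar>sqrt_coeff i\<bar> * \<bar>sqrt_coeff j\<bar>)"
  define Q where "Q N = {..<N} \<times> {..<N}" for N :: nat
  define R where "R N = {(i, j). i + j < N}" for N :: nat
  have RQ: "R N \<subseteq> Q N" "finite (Q N)" for N by (auto simp: R_def Q_def)
  have gh: "cmod (g p) \<le> F * h p" for p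
    using bound by (auto simp: g_def h_def norm_mult mult_left_mono mult.commute [of F] abs_mult split: prod.split)
  have tri: "(\<Sum>p\<in>R N. g p) = f 0 - f 1" if "N \<ge> 2" for N
  proof -
    have "(\<Sum>p\<in>R N. g p) = (\<Sum>k<N. \<Sum>i\<le>k. of_real (sqrt_coeff i * sqrt_coeff (k - i)) * f k)"
      unfolding R_def g_def by (subst sum.triangle_reindex) simp
    also have "\<dots> = (\<Sum>k<N. of_real (if k = 0 then 1 else if k = 1 then -1 else 0) * f k)"
      by (simp only: sum_distrib_right [symmetric] of_real_sum [symmetric] sqrt_coeff_convolution)
    also have "\<dots> = (\<Sum>k\<in>{0, 1}. of_real (if k = 0 then 1 else if k = 1 then -1 else 0) * f k)"
      using that by (intro sum.mono_neutral_right) auto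
    finally show ?thesis by simp
  qed
  have diff: "(\<lambda>N. (\<Sum>p\<in>Q N. g p) - (\<Sum>p\<in>R N. g p)) \<longlonglongrightarrow> 0"
  proof (rule Lim_null_comparison)
    show "\<forall>\<^sub>F N in sequentially. norm ((\<Sum>p\<in>Q N. g p) - (\<Sum>p\<in>R N. g p))
        \<le> F * ((\<Sum>p\<in>Q N. h p) - (\<Sum>p\<in>R N. h p))"
    proof (rule always_eventually, rule allI)
      fix N
      have "norm ((\<Sum>p\<in>Q N. g p) - (\<Sum>p\<in>R N. g p)) = norm (\<Sum>p\<in>Q N - R N. g p)"
        using RQ by (simp add: sum_diff)
      also have "\<dots> \<le> (\<Sum>p\<in>Q N - R N. F * h p)" using gh by (intro sum_norm_le)
      also have "\<dots> = F * ((\<Sum>p\<in>Q N. h p) - (\<Sum>p\<in>R N. h p))"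
        using RQ by (simp add: sum_diff sum_distrib_left right_diff_distrib)
      finally show "norm ((\<Sum>p\<in>Q N. g p) - (\<Sum>p\<in>R N. g p)) \<le> F * ((\<Sum>p\<in>Q N. h p) - (\<Sum>p\<in>R N. h p))" .
    qed
    define A where "A = (\<Sum>k. \<bar>sqrt_coeff k\<bar>)"
    have summ: "summable (\<lambda>k. norm \<bar>sqrt_coeff k\<bar>)" using summable_abs_sqrt_coeff by simp
    have "(\<Sum>p\<in>Q N. h p) = (\<Sum>i<N. \<bar>sqrt_coeff i\<bar>) * (\<Sum>i<N. \<bar>sqrt_coeff i\<bar>)" for N
      unfolding Q_def h_def by (simp add: sum.cartesian_product [symmetric] sum_product)
    moreover have "(\<lambda>N. \<Sum>i<N. \<bar>sqrt_coeff i\<bar>) \<longlonglongrightarrow> A"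
      unfolding A_def using summable_LIMSEQ [OF summable_abs_sqrt_coeff] .
    ultimately have "(\<lambda>N. \<Sum>p\<in>Q N. h p) \<longlonglongrightarrow> A * A" by (simp add: tendsto_mult)
    moreover have "(\<lambda>N. \<Sum>p\<in>R N. h p) \<longlonglongrightarrow> A * A"
      using Cauchy_product_sums [OF summ summ] unfolding sums_def A_def R_def h_def
      by (subst sum.triangle_reindex)
    ultimately have "(\<lambda>N. F * ((\<Sum>p\<in>Q N. h p) - (\<Sum>p\<in>R N. h p))) \<longlonglongrightarrow> F * (A * A - A * A)"
      by (intro tendsto_intros)
    then show "(\<lambda>N. F * ((\<Sum>p\<in>Q N. h p) - (\<Sum>p\<in>R N. h p))) \<longlonglongrightarrow> 0" by simp
  qed
  have "(\<lambda>N. \<Sum>p\<in>R N. g p) \<longlonglongrightarrow> f 0 - f 1"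
    by (rule tendsto_eventually) (use tri in \<open>auto simp: eventually_sequentially\<close>)
  then have "(\<lambda>N. \<Sum>p\<in>Q N. g p) \<longlonglongrightarrow> f 0 - f 1"
    by (rule Lim_transform [OF _ diff])
  then show ?thesis by (simp add: Q_def g_def sum.cartesian_product)
qed

lemma cinner_eq_cyclic:
  fixes x :: "'b \<Rightarrow> 'h::complex_hilbert"
  assumes u: "u \<in> closure (x ` B)" and v: "v \<in> closure (x ` B)"
    and eq: "\<And>b. b \<in> B \<Longrightarrow> cinner u (x b) = cinner v (x b)"
  shows "u = v"
proof -
  have eq': "cinner (u - v) z = 0" if z: "z \<in> closure (x ` B)" for z
  proof -
    obtain s where s: "\<And>n::nat. s n \<in> B" "(\<lambda>n. x (s n)) \<longlonglongrightarrow> z"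
      using closure_range_sequence [OF z] by blast
    have "(\<lambda>n. cinner (u - v) (x (s n))) \<longlonglongrightarrow> cinner (u - v) z"
      by (rule tendsto_cinner [OF tendsto_const s(2)])
    then show ?thesis by (simp add: cinner_diff_left eq s(1) LIMSEQ_const_iff)
  qed
  have "cinner (u - v) (u - v) = 0"
    using eq' [OF u] eq' [OF v] by (simp add: cinner_diff_right)
  then show ?thesis by (simp add: cinner_self)
qed

text \<open>Let \<open>T\<close> be the contraction with \<open>T (\<pi>2 b \<Omega>) = \<pi>1 b \<xi>\<close>.  The vector \<open>\<eta>\<close> is the square root of
  \<open>D = T* T\<close>, which commutes with \<open>\<pi>2\<close>, applied to \<open>\<Omega>\<close>.\<close>

lemma dominated_vector_functional:
  assumes B: "cstar_subalgebra B" and r1: "representation B H1 \<pi>1" and r2: "representation B H2 \<pi>2"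
    and xi: "\<xi> \<in> H1" and Omega: "\<Omega> \<in> H2"
    and le: "\<And>b. b \<in> B \<Longrightarrow> norm (\<pi>1 b \<xi>) \<le> norm (\<pi>2 b \<Omega>)"
  obtains \<eta> where "\<eta> \<in> H2" "\<And>b. b \<in> B \<Longrightarrow> cinner \<xi> (\<pi>1 b \<xi>) = cinner \<eta> (\<pi>2 b \<eta>)"
proof -
  note m = cstar_subalgebraD [OF B]
  note f1 = rep_clinear_family [OF B r1 xi] and f2 = rep_clinear_family [OF B r2 Omega]
  define K where "K = closure ((\<lambda>b. \<pi>2 b \<Omega>) ` B)"
  define L where "L = closure ((\<lambda>b. \<pi>1 b \<xi>) ` B)"
  have K_csub: "closed_csubspace K" unfolding K_def by (rule closed_csubspace_closure_range [OF B f2])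
  note k = closed_csubspaceD [OF K_csub]
  have KH: "z \<in> H2" if "z \<in> K" for z using rep_cyclic_subset [OF B r2 Omega] that unfolding K_def by blast
  have LH: "z \<in> H1" if "z \<in> L" for z using rep_cyclic_subset [OF B r1 xi] that unfolding L_def by blast
  have OK: "\<Omega> \<in> K" unfolding K_def by (rule rep_cyclic_mem [OF B r2 Omega])
  have Kinv: "\<pi>2 b z \<in> K" if "b \<in> B" "z \<in> K" for b z
    using rep_cyclic_invariant [OF B r2 Omega] that unfolding K_def by blast
  have seqK: "\<exists>s. (\<forall>n::nat. s n \<in> B) \<and> (\<lambda>n. \<pi>2 (s n) \<Omega>) \<longlonglongrightarrow> z" if "z \<in> K" for z
    using closure_range_sequence [OF that [unfolded K_def]] by blast
  have eqK: "u = v" if "u \<in> K" "v \<in> K" "\<And>b. b \<in> B \<Longrightarrow> cinner u (\<pi>2 b \<Omega>) = cinner v (\<pi>2 b \<Omega>)" for u v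
    using cinner_eq_cyclic [OF that(1,2) [unfolded K_def]] that(3) by blast
  obtain T where T: "\<And>s z. \<lbrakk>\<And>n. s n \<in> B; (\<lambda>n. \<pi>2 (s n) \<Omega>) \<longlonglongrightarrow> z\<rbrakk> \<Longrightarrow> (\<lambda>n. \<pi>1 (s n) \<xi>) \<longlonglongrightarrow> T z"
    and Tb: "\<And>b. b \<in> B \<Longrightarrow> T (\<pi>2 b \<Omega>) = \<pi>1 b \<xi>"
    and TL: "\<And>z. z \<in> K \<Longrightarrow> T z \<in> L"
    and T_norm: "\<And>u. u \<in> K \<Longrightarrow> norm (T u) \<le> norm u"
    by (rule linear_extension [OF B f2 f1, of 1, folded K_def L_def]) (simp add: le, simp, blast)
  have T_pi: "T (\<pi>2 b z) = \<pi>1 b (T z)" if b: "b \<in> B" and z: "z \<in> K" for b z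
  proof -
    obtain s where s: "\<And>n::nat. s n \<in> B" "(\<lambda>n. \<pi>2 (s n) \<Omega>) \<longlonglongrightarrow> z" using seqK [OF z] by blast
    have "(\<lambda>n. \<pi>2 (b * s n) \<Omega>) \<longlonglongrightarrow> \<pi>2 b z"
      using rep_tendsto [OF B r2 b _ s(2)] s(1) b Omega by (simp add: rep_mult [OF B r2] rep_mem [OF B r2])
    then have "(\<lambda>n. \<pi>1 (b * s n) \<xi>) \<longlonglongrightarrow> T (\<pi>2 b z)"
      using s(1) b m by (intro T) auto
    moreover have "(\<lambda>n. \<pi>1 (b * s n) \<xi>) \<longlonglongrightarrow> \<pi>1 b (T z)"
      using rep_tendsto [OF B r1 b _ T [OF s]] s(1) b xi by (simp add: rep_mult [OF B r1] rep_mem [OF B r1])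
    ultimately show ?thesis by (rule LIMSEQ_unique)
  qed
  \<comment> \<open>The vector \<open>d\<close> is T* T z, obtained as the Riesz vector of the
    functional \<open>\<pi>2 b \<Omega> \<mapsto> cinner (T z) (\<pi>1 b \<xi>)\<close>.\<close>
  have "\<exists>d. d \<in> K \<and> (\<forall>b\<in>B. cinner d (\<pi>2 b \<Omega>) = cinner (T z) (\<pi>1 b \<xi>))" if z: "z \<in> K" for z
  proof -
    have bd: "cmod (cinner (T z) (\<pi>1 b \<xi>)) \<le> norm (T z) * norm (\<pi>2 b \<Omega>)" if "b \<in> B" for b
      using cmod_cinner_le [of "T z" "\<pi>1 b \<xi>"] mult_left_mono [OF le [OF that], of "norm (T z)"] by simp
    obtain d where "d \<in> K" "\<And>b. b \<in> B \<Longrightarrow> cinner d (\<pi>2 b \<Omega>) = cinner (T z) (\<pi>1 b \<xi>)"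
    proof (rule Riesz_representation [OF B f2, of "\<lambda>b. cinner (T z) (\<pi>1 b \<xi>)" "norm (T z)", folded K_def])
    qed (simp_all add: bd cinner_add_right cinner_scaleC_right rep_add_left [OF B r1] rep_scaleC_left [OF B r1] xi)
    then show ?thesis by blast
  qed
  then obtain D where DK: "\<And>z. z \<in> K \<Longrightarrow> D z \<in> K"
    and Db: "\<And>z b. \<lbrakk>z \<in> K; b \<in> B\<rbrakk> \<Longrightarrow> cinner (D z) (\<pi>2 b \<Omega>) = cinner (T z) (\<pi>1 b \<xi>)"
    by metis
  have DT: "cinner (D u) v = cinner (T u) (T v)" if u: "u \<in> K" and v: "v \<in> K" for u v
  proof -
    obtain s where s: "\<And>n::nat. s n \<in> B" "(\<lambda>n. \<pi>2 (s n) \<Omega>) \<longlonglongrightarrow> v" using seqK [OF v] by blast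
    have "(\<lambda>n. cinner (D u) (\<pi>2 (s n) \<Omega>)) \<longlonglongrightarrow> cinner (D u) v"
      by (rule tendsto_cinner [OF tendsto_const s(2)])
    then have "(\<lambda>n. cinner (T u) (\<pi>1 (s n) \<xi>)) \<longlonglongrightarrow> cinner (D u) v"
      by (simp add: Db u s(1))
    then show ?thesis
      using tendsto_cinner [OF tendsto_const T [OF s]] by (rule LIMSEQ_unique)
  qed
  have DT': "cinner u (D v) = cinner (T u) (T v)" if "u \<in> K" "v \<in> K" for u v
    using DT [OF that(2,1)] by (metis cinner_commute)
  have D_pi: "D (\<pi>2 b z) = \<pi>2 b (D z)" if b: "b \<in> B" and z: "z \<in> K" for b z
  proof (rule eqK)
    fix c assume c: "c \<in> B"
    have "cinner (D (\<pi>2 b z)) (\<pi>2 c \<Omega>) = cinner (\<pi>1 b (T z)) (\<pi>1 c \<xi>)"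
      by (simp add: Db Kinv T_pi b c z)
    also have "\<dots> = cinner (T z) (\<pi>1 (star b * c) \<xi>)"
      by (simp add: rep_adjoint [OF B r1] rep_mult [OF B r1] rep_mem [OF B r1] b c m xi LH TL z)
    also have "\<dots> = cinner (D z) (\<pi>2 (star b * c) \<Omega>)" by (simp add: Db z b c m)
    also have "\<dots> = cinner (\<pi>2 b (D z)) (\<pi>2 c \<Omega>)"
      by (simp add: rep_adjoint [OF B r2] rep_mult [OF B r2] rep_mem [OF B r2] b c m Omega KH DK z)
    finally show "cinner (D (\<pi>2 b z)) (\<pi>2 c \<Omega>) = cinner (\<pi>2 b (D z)) (\<pi>2 c \<Omega>)" .
  qed (simp_all add: DK Kinv b z)
  \<comment> \<open>As D = 1 - R, the binomial series in R is a square root of D once R is known to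
    be a contraction.\<close>
  define R where "R z = z - D z" for z
  have RK: "R z \<in> K" if "z \<in> K" for z using that by (simp add: R_def k DK)
  have R_pi: "R (\<pi>2 b z) = \<pi>2 b (R z)" if "b \<in> B" "z \<in> K" for b z
    using that by (simp add: R_def D_pi rep_diff [OF B r2] KH DK)
  have R_adj: "cinner (R u) v = cinner u (R v)" if "u \<in> K" "v \<in> K" for u v
    using that by (simp add: R_def cinner_diff_left cinner_diff_right DT DT')
  \<comment> \<open>The comparison is with \<open>norm (T z)\<close>, not with
    \<open>norm z\<close>: in the expansion of the squared norm of \<open>R z\<close>, the square of
    \<open>norm (D z)\<close> must be absorbed by the negative term in
    \<open>norm (T z)\<close>.\<close>
  have D_le: "norm (D z) \<le> norm (T z)" if z: "z \<in> K" for z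
  proof (cases "D z = 0")
    case False
    have "of_real ((norm (D z))\<^sup>2) = cinner (T z) (T (D z))"
      using DT [OF z DK [OF z]] by (simp only: cinner_self)
    then have "(norm (D z))\<^sup>2 = cmod (cinner (T z) (T (D z)))"
      by (metis abs_of_nonneg norm_of_real zero_le_power2)
    also have "\<dots> \<le> norm (T z) * norm (T (D z))" by (rule cmod_cinner_le)
    also have "\<dots> \<le> norm (T z) * norm (D z)" by (intro mult_left_mono T_norm DK z norm_ge_zero)
    finally show ?thesis using False by (simp add: power2_eq_square)
  qed simp
  have R_norm: "norm (R z) \<le> norm z" if z: "z \<in> K" for z
  proof -
    have "inner z (D z) = (norm (T z))\<^sup>2"
      using DT' [OF z z] by (metis Re_cinner cinner_self Re_complex_of_real)
    then have "(norm (R z))\<^sup>2 = (norm z)\<^sup>2 - 2 * (norm (T z))\<^sup>2 + (norm (D z))\<^sup>2"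
      unfolding R_def power2_norm_eq_inner
      by (simp add: inner_diff_left inner_diff_right inner_commute [of "D z" z])
    moreover have "(norm (D z))\<^sup>2 \<le> (norm (T z))\<^sup>2" using D_le [OF z] by (simp add: power_mono)
    ultimately have "(norm (R z))\<^sup>2 \<le> (norm z)\<^sup>2"
      using zero_le_power2 [of "norm (T z)"] by linarith
    then show ?thesis by (rule power2_le_imp_le) simp
  qed
  \<comment> \<open>The series is summed on the orbit of this one vector, so no operator-valued
    limit has to be formed.\<close>
  define v where "v n = (R ^^ n) \<Omega>" for n
  have vK: "v n \<in> K" for n unfolding v_def by (induction n) (simp_all add: OK RK)
  have v_norm: "norm (v n) \<le> norm \<Omega>" for n
  proof (induction n)
    case (Suc n)
    then show ?case using R_norm [OF vK [of n]] by (simp add: v_def)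
  qed (simp add: v_def)
  \<comment> \<open>R is symmetric and commutes with \<open>\<pi>2 b\<close>, so all its powers can
    be collected in the left argument. Matrix coefficients then depend on i + j alone, as the double
    sum requires.\<close>
  have v_pi: "cinner (v i) (\<pi>2 b (v j)) = cinner (v (i + j)) (\<pi>2 b \<Omega>)" if b: "b \<in> B" for i j b
  proof (induction j arbitrary: i)
    case (Suc j)
    have "cinner (v i) (\<pi>2 b (v (Suc j))) = cinner (v i) (R (\<pi>2 b (v j)))"
      using R_pi [OF b vK [of j]] by (simp add: v_def)
    also have "\<dots> = cinner (v (Suc i)) (\<pi>2 b (v j))"
      using R_adj [OF vK [of i] Kinv [OF b vK [of j]]] by (simp add: v_def)
    finally show ?case using Suc [of "Suc i"] by simp
  qed (simp add: v_def)
  have summ: "summable (\<lambda>n. norm (sqrt_coeff n *\<^sub>R v n))"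
  proof (rule summable_comparison_test')
    show "summable (\<lambda>n. \<bar>sqrt_coeff n\<bar> * norm \<Omega>)" by (intro summable_mult2 summable_abs_sqrt_coeff)
    show "norm (norm (sqrt_coeff n *\<^sub>R v n)) \<le> \<bar>sqrt_coeff n\<bar> * norm \<Omega>" if "0 \<le> n" for n
      using v_norm [of n] by (simp add: mult_left_mono)
  qed
  define \<eta> where "\<eta> = (\<Sum>n. sqrt_coeff n *\<^sub>R v n)"
  define e where "e N = (\<Sum>n<N. sqrt_coeff n *\<^sub>R v n)" for N
  have e_lim: "e \<longlonglongrightarrow> \<eta>"
    unfolding e_def \<eta>_def using summable_LIMSEQ [OF summable_norm_cancel [OF summ]] .
  have eK: "e N \<in> K" for N unfolding e_def by (induction N) (simp_all add: k vK)
  have eta: "\<eta> \<in> K" using closed_sequentially [OF k(1) _ e_lim] eK by blast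
  show ?thesis
  proof (rule that)
    show "\<eta> \<in> H2" using KH [OF eta] .
    fix b assume b: "b \<in> B"
    define f where "f n = cinner (v n) (\<pi>2 b \<Omega>)" for n
    have "cmod (f n) \<le> norm \<Omega> * norm (\<pi>2 b \<Omega>)" for n
      unfolding f_def by (rule order_trans [OF cmod_cinner_le]) (simp add: v_norm mult_right_mono)
    then have "(\<lambda>N. \<Sum>i<N. \<Sum>j<N. of_real (sqrt_coeff i * sqrt_coeff j) * f (i + j)) \<longlonglongrightarrow> f 0 - f 1"
      by (rule sqrt_coeff_double_sum)
    moreover have "(\<Sum>i<N. \<Sum>j<N. of_real (sqrt_coeff i * sqrt_coeff j) * f (i + j)) = cinner (e N) (\<pi>2 b (e N))" for N
      unfolding e_def using vK KH b
      by (simp add: rep_sum_scaleR [OF B r2] cinner_sum_left cinner_sum_right cinner_scaleR_left cinner_scaleR_right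
          v_pi f_def sum_distrib_left mult.assoc add.commute)
    moreover have "(\<lambda>N. cinner (e N) (\<pi>2 b (e N))) \<longlonglongrightarrow> cinner \<eta> (\<pi>2 b \<eta>)"
      by (intro tendsto_cinner e_lim rep_tendsto [OF B r2 b]) (simp add: KH eK)
    ultimately have "cinner \<eta> (\<pi>2 b \<eta>) = f 0 - f 1" by (simp add: LIMSEQ_unique)
    also have "\<dots> = cinner (D \<Omega>) (\<pi>2 b \<Omega>)" by (simp add: f_def v_def R_def cinner_diff_left)
    also have "\<dots> = cinner \<xi> (\<pi>1 b \<xi>)"
      using Tb [OF m(2)] by (simp add: Db OK b rep_one [OF B r1] rep_one [OF B r2] xi Omega)
    finally show "cinner \<xi> (\<pi>1 b \<xi>) = cinner \<eta> (\<pi>2 b \<eta>)" by simp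
  qed
qed

text \<open>The constant is absorbed by scaling \<Omega> with \<open>\<bar>M\<bar>\<close>. The
  resulting \<eta> has the vector functional of \<xi>, in particular its norm, so a nonzero \<xi>
  would give equivalent nonzero cyclic subrepresentations on both sides.\<close>

lemma disjoint_dominated_imp_zero:
  assumes B: "cstar_subalgebra B" and r1: "representation B H1 \<pi>1" and r2: "representation B H2 \<pi>2"
    and disj: "disjoint_representations B H1 \<pi>1 H2 \<pi>2"
    and xi: "\<xi> \<in> H1" and Omega: "\<Omega> \<in> H2"
    and le: "\<And>b. b \<in> B \<Longrightarrow> norm (\<pi>1 b \<xi>) \<le> M * norm (\<pi>2 b \<Omega>)"
  shows "\<xi> = 0"
proof (rule ccontr)
  assume nz: "\<xi> \<noteq> 0"
  define \<omega> where "\<omega> = complex_of_real \<bar>M\<bar> *\<^sub>C \<Omega>"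
  have w: "\<omega> \<in> H2" using closed_csubspaceD(4) [OF rep_closed_csubspace [OF B r2] Omega] by (simp add: \<omega>_def)
  have "norm (\<pi>1 b \<xi>) \<le> norm (\<pi>2 b \<omega>)" if b: "b \<in> B" for b
  proof -
    have "norm (\<pi>2 b \<omega>) = \<bar>M\<bar> * norm (\<pi>2 b \<Omega>)"
      by (simp add: \<omega>_def rep_scaleC [OF B r2 b Omega] norm_scaleC_hilbert)
    moreover have "M * norm (\<pi>2 b \<Omega>) \<le> \<bar>M\<bar> * norm (\<pi>2 b \<Omega>)" by (simp add: mult_right_mono)
    ultimately show ?thesis using le [OF b] by linarith
  qed
  then obtain \<eta> where eta: "\<eta> \<in> H2" "\<And>b. b \<in> B \<Longrightarrow> cinner \<xi> (\<pi>1 b \<xi>) = cinner \<eta> (\<pi>2 b \<eta>)"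
    using dominated_vector_functional [OF B r1 r2 xi w] by blast
  have "cinner \<xi> \<xi> = cinner \<eta> \<eta>"
    using eta(2) [OF cstar_subalgebraD(2) [OF B]] by (simp add: rep_one [OF B r1 xi] rep_one [OF B r2 eta(1)])
  then have "\<eta> \<noteq> 0" using nz by (auto simp: cinner_self)
  have "closure ((\<lambda>b. \<pi>1 b \<xi>) ` B) \<noteq> {0}" "closure ((\<lambda>b. \<pi>2 b \<eta>) ` B) \<noteq> {0}"
    using rep_cyclic_mem [OF B r1 xi] nz rep_cyclic_mem [OF B r2 eta(1)] \<open>\<eta> \<noteq> 0\<close> by blast+
  then show False
    using disj rep_cyclic_subrepresentation [OF B r1 xi] rep_cyclic_subrepresentation [OF B r2 eta(1)]
      cyclic_subrepresentations_equivalent [OF B r1 r2 xi eta]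
    unfolding disjoint_representations_def by blast
qed

subsection \<open>Parity and graded commutation\<close>

lemma cstar_subalgebraI:
  assumes "\<And>s x. \<lbrakk>\<And>n::nat. s n \<in> B; s \<longlonglongrightarrow> x\<rbrakk> \<Longrightarrow> x \<in> B" "1 \<in> B"
    "\<And>x y. \<lbrakk>x \<in> B; y \<in> B\<rbrakk> \<Longrightarrow> x + y \<in> B" "\<And>x y. \<lbrakk>x \<in> B; y \<in> B\<rbrakk> \<Longrightarrow> x * y \<in> B"
    "\<And>c x. x \<in> B \<Longrightarrow> c *\<^sub>C x \<in> B" "\<And>x. x \<in> B \<Longrightarrow> star x \<in> B"
  shows "cstar_subalgebra (B::'a::cstar_algebra set)"
proof -
  have "closed B"
    unfolding closed_sequential_limits by (intro allI impI, elim conjE, rule assms(1)) simp_all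
  then show ?thesis
    unfolding cstar_subalgebra_def by (intro conjI ballI allI assms(2-)) simp_all
qed

lemma cstar_subalgebra_car_local: "cstar_subalgebra (car_local a I)"
  unfolding car_local_def by (rule cstar_subalgebra_generated)

lemma car_local_generator: "i \<in> I \<Longrightarrow> a i \<in> car_local a I" "i \<in> I \<Longrightarrow> star (a i) \<in> car_local a I"
  unfolding car_local_def by (rule subsetD [OF cstar_generated_superset]; simp)+

lemma car_local_minimal:
  "\<lbrakk>cstar_subalgebra B; \<And>i. i \<in> I \<Longrightarrow> a i \<in> B\<rbrakk> \<Longrightarrow> car_local a I \<subseteq> B"
  unfolding car_local_def by (rule cstar_generated_minimal) (auto simp: cstar_subalgebraD(7))

lemma car_local_mono: "I \<subseteq> J \<Longrightarrow> car_local a I \<subseteq> car_local a J"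
  by (rule car_local_minimal [OF cstar_subalgebra_car_local]) (simp add: car_local_generator subset_eq)

context
  fixes \<Theta> :: "'a::cstar_algebra \<Rightarrow> 'a"
  assumes aut: "star_automorphism \<Theta>"
begin

lemma auto_add: "\<Theta> (x + y) = \<Theta> x + \<Theta> y"
  and auto_scaleC: "\<Theta> (c *\<^sub>C x) = c *\<^sub>C \<Theta> x"
  and auto_mult: "\<Theta> (x * y) = \<Theta> x * \<Theta> y"
  and auto_star: "\<Theta> (star x) = star (\<Theta> x)"
  using aut by (simp_all add: star_automorphism_def)

lemma auto_one: "\<Theta> 1 = 1"
proof -
  obtain e where "\<Theta> e = 1"
    using aut unfolding star_automorphism_def by (metis bij_pointE)
  then show ?thesis using auto_mult [of 1 e] by simp
qed

lemma auto_scaleR: "\<Theta> (r *\<^sub>R x) = r *\<^sub>R \<Theta> x"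
  using auto_scaleC [of "of_real r" x] by (simp add: scaleC_of_real)

text \<open>A self-adjoint contraction \<open>h\<close> is the real part of the unitary \<open>h + i sqrt(1 - h\<^sup>2)\<close>, whose
  image under a *-homomorphism is again unitary.\<close>

lemma auto_contractive: "norm (\<Theta> x) \<le> norm x"
proof -
  have UNIV: "cstar_subalgebra (UNIV :: 'a set)" by (simp add: cstar_subalgebra_def)
  have contr: "norm (\<Theta> h) \<le> 1" if h: "star h = h" "norm h \<le> 1" for h :: 'a
  proof -
    have "norm (h * h) \<le> 1" using cstar_identity [of h] h by (simp add: power_le_one)
    then obtain s where s: "star s = s" "s * s = 1 - h * h" "h * s = s * h"
      using cstar_sqrt_one_minus [OF UNIV, of "h * h"] h by (metis UNIV_I mult.assoc star_mult)
    define u where "u = h + \<i> *\<^sub>C s"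
    have su: "star u = h - \<i> *\<^sub>C s"
      by (simp add: u_def star_add star_scaleC h s scaleC_minus_left)
    have "star u * u = 1"
      unfolding su by (simp add: u_def algebra_simps scaleC_mult_left scaleC_mult_right scaleC_scaleC scaleC_diff_right scaleC_add_right scaleC_minus_left s)
    then have "star (\<Theta> u) * \<Theta> u = 1" by (metis auto_mult auto_star auto_one)
    then have nu: "norm (\<Theta> u) = 1"
      using cstar_identity [of "\<Theta> u"] by (simp add: power2_eq_1_iff) (smt (verit) norm_ge_zero)
    have "2 *\<^sub>R h = u + star u" unfolding su by (simp add: u_def scaleR_2)
    then have "2 *\<^sub>R \<Theta> h = \<Theta> u + star (\<Theta> u)" by (metis auto_add auto_star scaleR_2)
    then have "2 * norm (\<Theta> h) \<le> 2"
      using norm_triangle_ineq [of "\<Theta> u" "star (\<Theta> u)"] nu by (metis norm_scaleR norm_star abs_numeral one_add_one)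
    then show ?thesis by simp
  qed
  show ?thesis
  proof (cases "x = 0")
    case False
    define c where "c = norm x ^ 2"
    have c: "c > 0" using False by (simp add: c_def)
    define h where "h = (1 / c) *\<^sub>R (star x * x)"
    have "star h = h" by (simp add: h_def star_scaleR star_mult star_star)
    moreover have "norm h \<le> 1" using c by (simp add: h_def cstar_identity c_def [symmetric])
    ultimately have "norm (\<Theta> h) \<le> 1" by (rule contr)
    moreover have "\<Theta> h = (1 / c) *\<^sub>R (star (\<Theta> x) * \<Theta> x)"
      by (simp only: h_def auto_scaleR auto_mult auto_star)
    ultimately have "norm (\<Theta> x) ^ 2 \<le> norm x ^ 2"
      using c by (simp add: cstar_identity c_def [symmetric])
    then show ?thesis by (rule power2_le_imp_le) simp
  qed (use auto_add [of 0 0] in simp)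
qed

lemma bounded_linear_auto: "bounded_linear \<Theta>"
  by (rule bounded_linear_intro [where K = 1])
     (simp_all add: auto_add auto_scaleR auto_contractive)

lemmas auto_tendsto = bounded_linear.tendsto [OF bounded_linear_auto]
lemmas auto_minus = linear_neg [OF bounded_linear.linear [OF bounded_linear_auto]]
lemmas auto_diff = linear_diff [OF bounded_linear.linear [OF bounded_linear_auto]]

lemma involution_split:
  assumes inv: "\<Theta> (\<Theta> x) = x"
  shows "x = (1/2) *\<^sub>R (x + \<Theta> x) + (1/2) *\<^sub>R (x - \<Theta> x)"
    "\<Theta> ((1/2) *\<^sub>R (x + \<Theta> x)) = (1/2) *\<^sub>R (x + \<Theta> x)"
    "\<Theta> ((1/2) *\<^sub>R (x - \<Theta> x)) = - ((1/2) *\<^sub>R (x - \<Theta> x))"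
proof -
  have "(x + \<Theta> x) + (x - \<Theta> x) = 2 *\<^sub>R x" by (simp add: scaleR_2)
  then show "x = (1/2) *\<^sub>R (x + \<Theta> x) + (1/2) *\<^sub>R (x - \<Theta> x)"
    by (simp only: scaleR_add_right [symmetric]) simp
  show "\<Theta> ((1/2) *\<^sub>R (x + \<Theta> x)) = (1/2) *\<^sub>R (x + \<Theta> x)"
    by (simp only: auto_scaleR auto_add inv add.commute)
  show "\<Theta> ((1/2) *\<^sub>R (x - \<Theta> x)) = - ((1/2) *\<^sub>R (x - \<Theta> x))"
    by (simp only: auto_scaleR auto_diff inv minus_diff_eq scaleR_minus_right [symmetric])
qed

text \<open>Together with the minimality of \<open>car_local\<close>, this reduces invariance of a
  local algebra to its generators.\<close>

lemma cstar_subalgebra_auto_vimage: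
  assumes "cstar_subalgebra B"
  shows "cstar_subalgebra {x. \<Theta> x \<in> B}"
proof -
  note m = cstar_subalgebraD [OF assms]
  show ?thesis
  proof (rule cstar_subalgebraI)
    fix s x assume "\<And>n::nat. s n \<in> {x. \<Theta> x \<in> B}" "s \<longlonglongrightarrow> x"
    then show "x \<in> {x. \<Theta> x \<in> B}"
      using closed_sequentially [OF m(1) _ auto_tendsto [of s x]] by simp
  qed (auto simp: auto_one auto_add auto_mult auto_scaleC auto_star m)
qed

lemma cstar_subalgebra_auto_square_fixed: "cstar_subalgebra {x. \<Theta> (\<Theta> x) = x}"
proof (rule cstar_subalgebraI)
  fix s x assume s: "\<And>n::nat. s n \<in> {x. \<Theta> (\<Theta> x) = x}" "s \<longlonglongrightarrow> x"
  have "(\<lambda>n. \<Theta> (\<Theta> (s n))) \<longlonglongrightarrow> \<Theta> (\<Theta> x)" by (intro auto_tendsto s)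
  then show "x \<in> {x. \<Theta> (\<Theta> x) = x}" using s LIMSEQ_unique by auto
qed (auto simp: auto_one auto_add auto_mult auto_scaleC auto_star)

end

context
  fixes a :: "nat \<Rightarrow> 'a::cstar_algebra" and \<Theta> :: "'a \<Rightarrow> 'a"
  assumes car: "car_algebra a" and par: "parity_automorphism a \<Theta>"
begin

lemma parity_auto: "star_automorphism \<Theta>"
  using par unfolding parity_automorphism_def by blast

lemma parity_generator: "i \<ge> 1 \<Longrightarrow> \<Theta> (a i) = - a i" "i \<ge> 1 \<Longrightarrow> \<Theta> (star (a i)) = - star (a i)"
  using par by (simp_all add: parity_automorphism_def)

lemma parity_involutive: "\<Theta> (\<Theta> x) = x"
proof -
  have "car_local a {1..} \<subseteq> {x. \<Theta> (\<Theta> x) = x}"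
    by (intro car_local_minimal cstar_subalgebra_auto_square_fixed parity_auto)
       (simp add: parity_generator auto_minus [OF parity_auto])
  then show ?thesis using car unfolding car_algebra_def by blast
qed

lemma parity_car_local:
  assumes "I \<subseteq> {1..}" "x \<in> car_local a I"
  shows "\<Theta> x \<in> car_local a I"
proof -
  have "car_local a I \<subseteq> {x. \<Theta> x \<in> car_local a I}"
    by (intro car_local_minimal cstar_subalgebra_auto_vimage parity_auto cstar_subalgebra_car_local)
       (use assms in \<open>auto simp: parity_generator subset_eq intro: cstar_subalgebraD [OF cstar_subalgebra_car_local] car_local_generator\<close>)
  then show ?thesis using assms by blast
qed

lemma CAR:
  assumes "i \<ge> 1" "j \<ge> 1"
  shows "star (a i) * a j + a j * star (a i) = (if i = j then 1 else 0)"
    "star (a i) * star (a j) + star (a j) * star (a i) = 0" "a i * a j + a j * a i = 0"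
proof -
  note * = conjunct1 [OF car [unfolded car_algebra_def anticomm_def], rule_format, OF assms]
  show "star (a i) * a j + a j * star (a i) = (if i = j then 1 else 0)" by (rule conjunct1 [OF *])
  show "star (a i) * star (a j) + star (a j) * star (a i) = 0" by (rule conjunct1 [OF conjunct2 [OF *]])
  show "a i * a j + a j * a i = 0" by (rule conjunct2 [OF conjunct2 [OF *]])
qed

lemma car_local_generator_commute:
  assumes I: "I \<subseteq> {1..}" and j: "j \<ge> 1" "j \<notin> I" and x: "x \<in> car_local a I"
  shows "x * a j = a j * \<Theta> x" "x * star (a j) = star (a j) * \<Theta> x"
proof -
  \<comment> \<open>Both relations are kept in one set because adjoints exchange them: closure under
    \<open>star\<close> derives the rule for \<open>star (a j)\<close> from the rule for
    \<open>a j\<close>, and conversely.\<close>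
  let ?S = "{x. x * a j = a j * \<Theta> x \<and> x * star (a j) = star (a j) * \<Theta> x}"
  note th = auto_one [OF parity_auto] auto_add [OF parity_auto] auto_mult [OF parity_auto]
    auto_scaleC [OF parity_auto] auto_star [OF parity_auto] auto_minus [OF parity_auto]
  have "cstar_subalgebra ?S"
  proof (rule cstar_subalgebraI)
    fix s x assume s: "\<And>n::nat. s n \<in> ?S" "s \<longlonglongrightarrow> x"
    have "(\<lambda>n. s n * g) \<longlonglongrightarrow> x * g" "(\<lambda>n. g * \<Theta> (s n)) \<longlonglongrightarrow> g * \<Theta> x" for g
      by (intro tendsto_intros auto_tendsto [OF parity_auto] s)+
    from this [of "a j"] this [of "star (a j)"] show "x \<in> ?S"
      using s(1) LIMSEQ_unique by auto
  next
    fix x y assume xy: "x \<in> ?S" "y \<in> ?S"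
    have "x * y * g = g * \<Theta> (x * y)" if "x * g = g * \<Theta> x" "y * g = g * \<Theta> y" for g
    proof -
      have "x * y * g = (x * g) * \<Theta> y" by (simp only: that(2) mult.assoc)
      then show ?thesis by (simp only: that(1) th mult.assoc)
    qed
    then show "x * y \<in> ?S" using xy by simp
  next
    fix x assume x: "x \<in> ?S"
    have "star x * star g = star g * \<Theta> (star x)" if g: "x * g = g * \<Theta> x" and "\<Theta> g = - g" for g
    proof -
      have "star g * star x = star (\<Theta> x) * star g"
        using arg_cong [OF g, of star] by (simp add: star_mult)
      then have "\<Theta> (star g * star x) = \<Theta> (star (\<Theta> x) * star g)" by simp
      then show ?thesis using that(2) by (simp add: th parity_involutive star_minus)
    qed
    from this [of "a j"] this [of "star (a j)"] show "star x \<in> ?S"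
      using x j by (simp add: parity_generator star_star)
  qed (auto simp: th algebra_simps scaleC_mult_left scaleC_mult_right)
  moreover have "a i \<in> ?S" if "i \<in> I" for i
  proof -
    have i: "i \<ge> 1" "i \<noteq> j" using that I j by auto
    show ?thesis
      using CAR(3) [OF i(1) j(1)] CAR(1) [OF j(1) i(1)] i
      by (simp add: parity_generator eq_neg_iff_add_eq_0 add.commute)
  qed
  ultimately have "car_local a I \<subseteq> ?S" by (rule car_local_minimal)
  then show "x * a j = a j * \<Theta> x" "x * star (a j) = star (a j) * \<Theta> x" using x by blast+
qed

lemma
  assumes I: "I1 \<subseteq> {1..}" "I2 \<subseteq> {1..}" "I1 \<inter> I2 = {}"
    and x: "x \<in> car_local a I1" and v: "v \<in> car_local a I2"
  shows car_local_commute_even: "\<Theta> v = v \<Longrightarrow> x * v = v * x"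
    and car_local_commute_odd: "\<Theta> v = - v \<Longrightarrow> x * v = v * \<Theta> x"
proof -
  \<comment> \<open>The two relations of the statement presuppose a homogeneous v and do not combine
    under sums of an even and an odd one. For homogeneous x the rule that an odd x turns v into
    \<open>\<Theta> v\<close> makes sense for every v and is preserved by sums, products, adjoints
    and limits.\<close>
  define P where "P v \<longleftrightarrow> (\<forall>x\<in>car_local a I1. (\<Theta> x = x \<longrightarrow> x * v = v * x) \<and> (\<Theta> x = - x \<longrightarrow> x * v = \<Theta> v * x))" for v
  have PE: "x * v = v * x" if "P v" "x \<in> car_local a I1" "\<Theta> x = x" for v x
    by (rule mp [OF conjunct1 [OF bspec [OF that(1) [unfolded P_def] that(2)]] that(3)])
  have PO: "x * v = \<Theta> v * x" if "P v" "x \<in> car_local a I1" "\<Theta> x = - x" for v x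
    by (rule mp [OF conjunct2 [OF bspec [OF that(1) [unfolded P_def] that(2)]] that(3)])
  have PI: "P v" if "\<And>x. \<lbrakk>x \<in> car_local a I1; \<Theta> x = x\<rbrakk> \<Longrightarrow> x * v = v * x"
    "\<And>x. \<lbrakk>x \<in> car_local a I1; \<Theta> x = - x\<rbrakk> \<Longrightarrow> x * v = \<Theta> v * x" for v
    unfolding P_def by (intro ballI conjI impI that)
  note th = auto_one [OF parity_auto] auto_add [OF parity_auto] auto_mult [OF parity_auto]
    auto_scaleC [OF parity_auto] auto_star [OF parity_auto] auto_minus [OF parity_auto]
  note m1 = cstar_subalgebraD [OF cstar_subalgebra_car_local [of a I1]]
  have "cstar_subalgebra {v. P v}"
  proof (rule cstar_subalgebraI; unfold mem_Collect_eq)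
    fix s v assume s: "\<And>n::nat. P (s n)" "s \<longlonglongrightarrow> v"
    note lim = tendsto_mult_left [OF s(2)] tendsto_mult_right [OF s(2)]
      tendsto_mult_right [OF auto_tendsto [OF parity_auto s(2)]]
    show "P v"
    proof (rule PI)
      fix x assume x: "x \<in> car_local a I1" "\<Theta> x = x"
      have "(\<lambda>n. x * s n) = (\<lambda>n. s n * x)" by (rule ext) (rule PE [OF s(1) x])
      then show "x * v = v * x" using lim(1) [of x] lim(2) [of x] LIMSEQ_unique by metis
    next
      fix x assume x: "x \<in> car_local a I1" "\<Theta> x = - x"
      have "(\<lambda>n. x * s n) = (\<lambda>n. \<Theta> (s n) * x)" by (rule ext) (rule PO [OF s(1) x])
      then show "x * v = \<Theta> v * x" using lim(1) [of x] lim(3) [of x] LIMSEQ_unique by metis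
    qed
  next
    show "P 1" by (rule PI) (simp_all add: th)
  next
    fix v w assume vw: "P v" "P w"
    show "P (v + w)"
      by (rule PI) (simp_all only: distrib_left distrib_right th PE [OF vw(1)] PE [OF vw(2)] PO [OF vw(1)] PO [OF vw(2)])
    show "P (v * w)"
    proof (rule PI)
      fix x assume x: "x \<in> car_local a I1" "\<Theta> x = x"
      show "x * (v * w) = (v * w) * x"
        using PE [OF vw(1) x] PE [OF vw(2) x] by (metis mult.assoc)
    next
      fix x assume x: "x \<in> car_local a I1" "\<Theta> x = - x"
      show "x * (v * w) = \<Theta> (v * w) * x"
        using PO [OF vw(1) x] PO [OF vw(2) x] unfolding th by (metis mult.assoc)
    qed
  next
    fix c v assume v: "P v"
    show "P (c *\<^sub>C v)"
      by (rule PI) (simp_all only: scaleC_mult_left scaleC_mult_right th PE [OF v] PO [OF v])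
  next
    fix v assume v: "P v"
    show "P (star v)"
    proof (rule PI)
      fix x assume x: "x \<in> car_local a I1" "\<Theta> x = x"
      have "star x * v = v * star x" using x by (intro PE [OF v]) (simp_all add: m1 th)
      from arg_cong [OF this, of star] show "x * star v = star v * x" by (simp add: star_mult star_star)
    next
      fix x assume x: "x \<in> car_local a I1" "\<Theta> x = - x"
      have "star x * v = \<Theta> v * star x" using x by (intro PO [OF v]) (simp_all add: m1 th star_minus)
      from arg_cong [OF this, of "\<lambda>y. \<Theta> (star y)"] show "x * star v = \<Theta> (star v) * x"
        by (simp add: th star_mult star_star x parity_involutive)
    qed
  qed
  moreover have "a j \<in> {v. P v}" if "j \<in> I2" for j
  proof -
    have j: "j \<ge> 1" "j \<notin> I1" using that I by auto
    have "P (a j)"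
      by (rule PI) (simp_all add: car_local_generator_commute(1) [OF I(1) j] parity_generator(1) [OF j(1)])
    then show ?thesis by simp
  qed
  ultimately have "car_local a I2 \<subseteq> {v. P v}" by (rule car_local_minimal)
  then have Pv: "P v" using v by blast
  define e where "e = (1/2) *\<^sub>R (x + \<Theta> x)"
  define d where "d = (1/2) *\<^sub>R (x - \<Theta> x)"
  have x_eq: "x = e + d" and e: "\<Theta> e = e" and d: "\<Theta> d = - d"
    unfolding e_def d_def by (rule involution_split [OF parity_auto parity_involutive])+
  have "e \<in> car_local a I1" "d \<in> car_local a I1"
    unfolding e_def d_def using x parity_car_local [OF I(1) x] m1 by simp_all
  then have ev: "e * v = v * e" and dv: "d * v = \<Theta> v * d" using PE [OF Pv] PO [OF Pv] e d by blast+
  show "x * v = v * x" if "\<Theta> v = v" using ev dv that by (simp add: x_eq algebra_simps)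
  show "x * v = v * \<Theta> x" if "\<Theta> v = - v"
    using ev dv that by (simp add: x_eq th e d algebra_simps)
qed

section \<open>Necessity: a joint extension forces evenness\<close>

lemma joint_extension_imp_even:
  assumes I: "I1 \<subseteq> {1..}" "I2 \<subseteq> {1..}" "I1 \<inter> I2 = {}"
    and g1: "gns_triple (car_local a I1) \<phi>1 H1 \<pi>1 \<Omega>1"
    and g2: "gns_triple (car_local a I1) (\<phi>1 \<circ> \<Theta>) H2 \<pi>2 \<Omega>2"
    and disj: "disjoint_representations (car_local a I1) H1 \<pi>1 H2 \<pi>2"
    and ext: "joint_extension a I1 I2 \<phi>1 \<phi>2 \<phi>"
  shows "even_on \<Theta> (car_local a I2) \<phi>2"
proof -
  let ?A1 = "car_local a I1" and ?A2 = "car_local a I2" and ?A = "car_local a (I1 \<union> I2)"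
  have B: "cstar_subalgebra ?A1" and C: "cstar_subalgebra ?A" and B2: "cstar_subalgebra ?A2"
    by (rule cstar_subalgebra_car_local)+
  note m1 = cstar_subalgebraD [OF B] and m = cstar_subalgebraD [OF C] and m2 = cstar_subalgebraD [OF B2]
  have st: "state_on ?A \<phi>" and phi1: "\<And>x. x \<in> ?A1 \<Longrightarrow> \<phi> x = \<phi>1 x" and phi2: "\<And>x. x \<in> ?A2 \<Longrightarrow> \<phi> x = \<phi>2 x"
    using ext unfolding joint_extension_def by blast+
  have sub: "?A1 \<subseteq> ?A" "?A2 \<subseteq> ?A" by (rule car_local_mono; blast)+
  have r1: "representation ?A1 H1 \<pi>1" and O1: "\<Omega>1 \<in> H1"
    and cyc: "closure ((\<lambda>b. \<pi>1 b \<Omega>1) ` ?A1) = H1" and v1: "\<And>b. b \<in> ?A1 \<Longrightarrow> \<phi>1 b = cinner \<Omega>1 (\<pi>1 b \<Omega>1)"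
    using g1 unfolding gns_triple_def by blast+
  have r2: "representation ?A1 H2 \<pi>2" and O2: "\<Omega>2 \<in> H2" and v2: "\<And>b. b \<in> ?A1 \<Longrightarrow> \<phi>1 (\<Theta> b) = cinner \<Omega>2 (\<pi>2 b \<Omega>2)"
    using g2 unfolding gns_triple_def by auto
  note f1 = rep_clinear_family [OF B r1 O1]
  have norm1: "Re (\<phi> (star b * b)) = (norm (\<pi>1 b \<Omega>1))\<^sup>2" if b: "b \<in> ?A1" for b
  proof -
    have "\<phi> (star b * b) = cinner (\<pi>1 b \<Omega>1) (\<pi>1 b \<Omega>1)"
      using b m1 by (simp add: phi1 v1 rep_cinner [OF B r1 b b O1 O1])
    then show ?thesis by (simp add: cinner_self)
  qed
  have norm2: "Re (\<phi> (\<Theta> (star b * b))) = (norm (\<pi>2 b \<Omega>2))\<^sup>2" if b: "b \<in> ?A1" for b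
  proof -
    have "\<phi> (\<Theta> (star b * b)) = cinner (\<pi>2 b \<Omega>2) (\<pi>2 b \<Omega>2)"
      using b m1 parity_car_local [OF I(1), of "star b * b"]
      by (simp add: phi1 v2 rep_cinner [OF B r2 b b O2 O2])
    then show ?thesis by (simp add: cinner_self)
  qed
  have odd: "\<phi> u = 0" if u: "u \<in> ?A2" and u_odd: "\<Theta> u = - u" for u
  proof -
    have uC: "u \<in> ?A" using u sub by blast
    have bnd: "cmod (\<phi> (star (b * u) * c)) \<le> norm u * norm (\<pi>2 b \<Omega>2) * norm (\<pi>1 c \<Omega>1)"
      if b: "b \<in> ?A1" and c: "c \<in> ?A1" for b c
    proof (rule power2_le_imp_le)
      have bC: "b \<in> ?A" "c \<in> ?A" "\<Theta> b \<in> ?A" using b c sub parity_car_local [OF I(1) b] by blast+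
      have "(cmod (\<phi> (star (b * u) * c)))\<^sup>2 \<le> Re (\<phi> (star (b * u) * (b * u))) * Re (\<phi> (star c * c))"
        using bC uC m by (intro state_Cauchy_Schwarz [OF C st]) auto
      \<comment> \<open>With u to the left of b its norm can be pulled out of the state. The price
        is the twist of b, and it is this twist that brings in the representation
        \<open>\<pi>2\<close>.\<close>
      also have "\<dots> = Re (\<phi> (star (u * \<Theta> b) * (u * \<Theta> b))) * Re (\<phi> (star c * c))"
        by (simp only: car_local_commute_odd [OF I b u u_odd])
      also have "Re (\<phi> (star (u * \<Theta> b) * (u * \<Theta> b))) * Re (\<phi> (star c * c))
          \<le> ((norm u)\<^sup>2 * Re (\<phi> (star (\<Theta> b) * \<Theta> b))) * Re (\<phi> (star c * c))"
        by (rule mult_right_mono [OF state_conj_bound [OF C st uC bC(3)]]) (simp add: norm1 c)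
      also have "\<dots> = (norm u * norm (\<pi>2 b \<Omega>2) * norm (\<pi>1 c \<Omega>1))\<^sup>2"
        using norm2 [OF b] norm1 [OF c]
        by (simp add: auto_mult [OF parity_auto] auto_star [OF parity_auto] power_mult_distrib)
      finally show "(cmod (\<phi> (star (b * u) * c)))\<^sup>2 \<le> (norm u * norm (\<pi>2 b \<Omega>2) * norm (\<pi>1 c \<Omega>1))\<^sup>2" .
    qed simp
    have mem: "star u * b \<in> ?A" if "b \<in> ?A1" for b
      using m(5) [OF m(7) [OF uC] subsetD [OF sub(1) that]] .
    obtain \<xi> where xi: "\<xi> \<in> H1" and xi_eq: "\<And>b. b \<in> ?A1 \<Longrightarrow> cinner \<xi> (\<pi>1 b \<Omega>1) = \<phi> (star u * b)"
    proof (rule Riesz_representation [OF B f1, of "\<lambda>b. \<phi> (star u * b)" "norm u * norm \<Omega>2", unfolded cyc])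
      show "cmod (\<phi> (star u * b)) \<le> norm u * norm \<Omega>2 * norm (\<pi>1 b \<Omega>1)" if "b \<in> ?A1" for b
        using bnd [OF m1(2) that] by (simp add: rep_one [OF B r2 O2])
    qed (simp_all add: algebra_simps scaleC_mult_right state_add [OF C st] state_scaleC [OF C st] mem)
    \<comment> \<open>The norm is found by duality: the inner product of
      \<open>\<pi>1 b \<xi>\<close> with \<open>\<pi>1 c \<Omega>1\<close> is
      \<open>\<phi> (star (b * u) * c)\<close>, and by cyclicity the vectors
      \<open>\<pi>1 c \<Omega>1\<close> approach \<open>\<pi>1 b \<xi>\<close> itself.\<close>
    have "norm (\<pi>1 b \<xi>) \<le> norm u * norm (\<pi>2 b \<Omega>2)" if b: "b \<in> ?A1" for b
    proof (cases "\<pi>1 b \<xi> = 0")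
      case False
      define w where "w = \<pi>1 b \<xi>"
      define N where "N = norm u * norm (\<pi>2 b \<Omega>2)"
      have wH: "w \<in> H1" unfolding w_def by (rule rep_mem [OF B r1 b xi])
      have le: "cmod (cinner w (\<pi>1 c \<Omega>1)) \<le> N * norm (\<pi>1 c \<Omega>1)" if c: "c \<in> ?A1" for c
      proof -
        have "cinner w (\<pi>1 c \<Omega>1) = \<phi> (star (b * u) * c)"
          using b c m1 by (simp add: w_def rep_cinner [OF B r1 b c xi O1] xi_eq star_mult mult.assoc)
        then show ?thesis using bnd [OF b c] by (simp add: N_def)
      qed
      obtain s where s: "\<And>n::nat. s n \<in> ?A1" "(\<lambda>n. \<pi>1 (s n) \<Omega>1) \<longlonglongrightarrow> w"
        using closure_range_sequence [OF wH [folded cyc]] by blast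
      have "cmod (cinner w w) \<le> N * norm w"
        using tendsto_norm [OF tendsto_cinner [OF tendsto_const s(2)]] tendsto_mult_left [OF tendsto_norm [OF s(2)]]
        by (rule LIMSEQ_le) (use le s(1) in auto)
      then have "norm w * norm w \<le> N * norm w"
        by (simp add: cinner_self norm_power power2_eq_square norm_mult)
      then show ?thesis using False by (simp add: w_def N_def)
    qed simp
    then have "\<xi> = 0" by (rule disjoint_dominated_imp_zero [OF B r1 r2 disj xi O2])
    then have "\<phi> (star u) = 0"
      using xi_eq [OF m1(2)] cinner_scaleC_left [of 0 0 "\<pi>1 1 \<Omega>1"] by simp
    then show ?thesis using state_star [OF C st uC] by simp
  qed
  show ?thesis
    unfolding even_on_def
  proof
    fix x assume x: "x \<in> ?A2"
    have tx: "\<Theta> x \<in> ?A2" by (rule parity_car_local [OF I(2) x])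
    have "\<phi> (x - \<Theta> x) = 0"
      using x tx m2 by (intro odd) (simp_all add: auto_diff [OF parity_auto] parity_involutive)
    then show "\<phi>2 (\<Theta> x) = \<phi>2 x"
      using x tx sub state_diff [OF C st, of x "\<Theta> x"] by (simp add: phi2 subset_eq)
  qed
qed

end

subsection \<open>The Schur product\<close>

text \<open>The Schur product theorem at the all-ones vector, by elimination of one index. For a
  positive diagonal entry at s, G is a rank-one matrix built from row s plus a positive matrix H
  with vanishing row and column s; the rank-one part contributes the form of P at the vector
  \<open>G s\<close>. The recursion replaces G by its Schur complement and keeps P, hence G is
  generalized.\<close>

lemma Schur_product_nonneg:
  fixes G P :: "'i \<Rightarrow> 'i \<Rightarrow> complex"
  assumes "finite S"
    and "\<And>c. 0 \<le> (\<Sum>i\<in>S. \<Sum>j\<in>S. cnj (c i) * c j * G i j)"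
    and "\<And>i j. \<lbrakk>i \<in> S; j \<in> S\<rbrakk> \<Longrightarrow> G j i = cnj (G i j)"
    and "\<And>c. 0 \<le> (\<Sum>i\<in>S. \<Sum>j\<in>S. cnj (c i) * c j * P i j)"
  shows "0 \<le> (\<Sum>i\<in>S. \<Sum>j\<in>S. G i j * P i j)"
  using assms
proof (induction S arbitrary: G rule: finite_induct)
  case empty
  show ?case by simp
next
  case (insert s S)
  note G = insert.prems(1) and herm = insert.prems(2) and P = insert.prems(3)
  define g where "g = G s s"
  have split: "(\<Sum>i\<in>insert s S. \<Sum>j\<in>insert s S. f i j)
      = f s s + (\<Sum>j\<in>S. f s j) + (\<Sum>i\<in>S. f i s) + (\<Sum>i\<in>S. \<Sum>j\<in>S. f i j)" for f :: "'i \<Rightarrow> 'i \<Rightarrow> complex"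
    using insert.hyps by (simp add: sum.distrib)
  define q where "q c = (\<Sum>j\<in>S. c j * G s j)" for c
  define F where "F c = (\<Sum>i\<in>S. \<Sum>j\<in>S. cnj (c i) * c j * G i j)" for c
  \<comment> \<open>The full form with the coefficient z at s singled out. For g > 0, minimizing
    over z leaves the form of the Schur complement.\<close>
  have total: "0 \<le> cnj z * z * g + cnj z * q c + z * cnj (q c) + F c" for z c
  proof -
    define d where "d = c(s := z)"
    have d: "d s = z" "\<And>i. i \<in> S \<Longrightarrow> d i = c i" using insert.hyps by (auto simp: d_def)
    have "(\<Sum>j\<in>S. cnj (d s) * d j * G s j) = cnj z * q c"
      by (simp add: q_def sum_distrib_left d mult.assoc)
    moreover have "(\<Sum>i\<in>S. cnj (d i) * d s * G i s) = z * cnj (q c)"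
      unfolding q_def cnj_sum sum_distrib_left
      by (rule sum.cong [OF refl]) (simp add: d herm [of s])
    moreover have "(\<Sum>i\<in>S. \<Sum>j\<in>S. cnj (d i) * d j * G i j) = F c"
      unfolding F_def by (intro sum.cong refl) (simp add: d)
    ultimately show ?thesis using G [of d] unfolding split g_def by (simp add: d)
  qed
  have "0 \<le> g" using total [of 1 "\<lambda>_. 0"] by (simp add: q_def F_def)
  then have g: "g = of_real (Re g)" "0 \<le> Re g" by (auto simp: less_eq_complex_def complex_eq_iff)
  have P_S: "0 \<le> (\<Sum>i\<in>S. \<Sum>j\<in>S. cnj (c i) * c j * P i j)" for c
  proof -
    define d where "d = c(s := 0)"
    have d: "d s = 0" "\<And>i. i \<in> S \<Longrightarrow> d i = c i" using insert.hyps by (auto simp: d_def)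
    have "(\<Sum>i\<in>S. \<Sum>j\<in>S. cnj (d i) * d j * P i j) = (\<Sum>i\<in>S. \<Sum>j\<in>S. cnj (c i) * c j * P i j)"
      by (intro sum.cong refl) (simp add: d)
    then show ?thesis using P [of d] unfolding split by (simp add: d)
  qed
  show ?case
  proof (cases "g = 0")
    case True
    \<comment> \<open>For g = 0 the form is affine in z, so a nonzero entry in row s would make it
      negative somewhere.\<close>
    have row: "G s j = 0" if j: "j \<in> S" for j
    proof -
      define c where "c i = (if i = j then 1 else 0 :: complex)" for i
      have qc: "q c = G s j" using j insert.hyps by (simp add: q_def c_def sum.delta if_distrib [of "\<lambda>x. x * _"] cong: if_cong)
      have "0 \<le> Re (F c) - 2 * t * (cmod (G s j))\<^sup>2 + t\<^sup>2 * (cmod (G s j))\<^sup>2 * 0" for t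
      proof -
        define z where "z = - of_real t * G s j"
        define N where "N = (cmod (G s j))\<^sup>2"
        have nn: "G s j * cnj (G s j) = of_real N" by (simp only: N_def complex_norm_square)
        have "cnj z * G s j = - of_real t * (G s j * cnj (G s j))" by (simp add: z_def mult_ac)
        then have e1: "cnj z * G s j = of_real (- (t * N))" by (simp only: nn) simp
        have "z * cnj (G s j) = - of_real t * (G s j * cnj (G s j))" by (simp add: z_def mult_ac)
        then have e2: "z * cnj (G s j) = of_real (- (t * N))" by (simp only: nn) simp
        have "0 \<le> of_real (- (t * N)) + of_real (- (t * N)) + F c"
          using total [of z c] by (simp only: qc True e1 e2 mult_zero_right add_0)
        then show ?thesis by (simp add: less_eq_complex_def N_def [symmetric] mult_ac)
      qed
      then have "(cmod (G s j))\<^sup>2 \<le> Re (F c) * 0" by (rule discriminant_bound) simp_all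
      then show ?thesis by simp
    qed
    have col: "G i s = 0" if "i \<in> S" for i using herm [of s i] row [OF that] that by simp
    have "0 \<le> (\<Sum>i\<in>S. \<Sum>j\<in>S. G i j * P i j)"
    proof (rule insert.IH)
      show "0 \<le> (\<Sum>i\<in>S. \<Sum>j\<in>S. cnj (c i) * c j * G i j)" for c
        using total [of 0 c] by (simp add: F_def)
      show "G j i = cnj (G i j)" if "i \<in> S" "j \<in> S" for i j
        using that by (intro herm) simp_all
    qed (rule P_S)
    moreover have "(\<Sum>j\<in>S. G s j * P s j) = 0" "(\<Sum>i\<in>S. G i s * P i s) = 0"
      by (rule sum.neutral; simp add: row col)+
    moreover have "G s s = 0" using True by (simp only: g_def)
    ultimately show ?thesis unfolding split by simp
  next
    case False
    define H where "H i j = G i j - cnj (G s i) * G s j / g" for i j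
    have cg: "cnj g = g" by (metis complex_cnj_complex_of_real g(1))
    have H_nonneg: "0 \<le> (\<Sum>i\<in>S. \<Sum>j\<in>S. cnj (c i) * c j * H i j)" for c
    proof -
      have "(\<Sum>i\<in>S. \<Sum>j\<in>S. cnj (c i) * c j * H i j)
          = F c - (\<Sum>i\<in>S. \<Sum>j\<in>S. cnj (c i * G s i) * (c j * G s j)) / g"
        unfolding F_def H_def sum_divide_distrib sum_subtractf [symmetric]
        by (intro sum.cong refl) (simp add: algebra_simps)
      also have "(\<Sum>i\<in>S. \<Sum>j\<in>S. cnj (c i * G s i) * (c j * G s j)) = cnj (q c) * q c"
        unfolding q_def cnj_sum by (simp only: sum_product)
      \<comment> \<open>Completing the square: - q c / g is the minimizing z.\<close>
      also have "F c - cnj (q c) * q c / g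
          = cnj (- q c / g) * (- q c / g) * g + cnj (- q c / g) * q c + (- q c / g) * cnj (q c) + F c"
        using False by (simp add: cg field_simps)
      finally show ?thesis using total [of "- q c / g" c] by simp
    qed
    have "0 \<le> (\<Sum>i\<in>S. \<Sum>j\<in>S. H i j * P i j)"
    proof (rule insert.IH [OF H_nonneg])
      show "H j i = cnj (H i j)" if "i \<in> S" "j \<in> S" for i j
        using herm [of i j] that by (simp add: H_def cg)
    qed (rule P_S)
    moreover have row: "H s j = 0" and col: "H j s = 0" if "j \<in> S" for j
      using False herm [of s j] that by (simp_all add: H_def g_def [symmetric] cg)
    have "(\<Sum>j\<in>S. H s j * P s j) = 0" "(\<Sum>i\<in>S. H i s * P i s) = 0"
      by (rule sum.neutral; simp add: row col)+
    moreover have "H s s = 0" using False by (simp add: H_def g_def [symmetric] cg)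
    ultimately have H: "0 \<le> (\<Sum>i\<in>insert s S. \<Sum>j\<in>insert s S. H i j * P i j)"
      unfolding split by simp
    have "0 \<le> of_real (1 / Re g) * (\<Sum>i\<in>insert s S. \<Sum>j\<in>insert s S. cnj (G s i) * G s j * P i j)"
      using P [of "G s"] g(2) by (simp add: less_eq_complex_def)
    also have "\<dots> = (\<Sum>i\<in>insert s S. \<Sum>j\<in>insert s S. cnj (G s i) * G s j / g * P i j)"
      unfolding sum_distrib_left by (intro sum.cong refl) (subst (2) g(1), simp)
    finally have "0 \<le> (\<Sum>i\<in>insert s S. \<Sum>j\<in>insert s S. H i j * P i j)
        + (\<Sum>i\<in>insert s S. \<Sum>j\<in>insert s S. cnj (G s i) * G s j / g * P i j)"
      using H by (rule add_nonneg_nonneg [rotated])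
    also have "\<dots> = (\<Sum>i\<in>insert s S. \<Sum>j\<in>insert s S. G i j * P i j)"
      unfolding sum.distrib [symmetric] by (intro sum.cong refl) (simp add: H_def algebra_simps)
    finally show ?thesis .
  qed
qed

lemma state_Gram_nonneg:
  assumes B: "cstar_subalgebra B" and st: "state_on B \<phi>" and w: "\<And>i. i \<in> S \<Longrightarrow> w i \<in> B"
  shows "0 \<le> (\<Sum>i\<in>S. \<Sum>j\<in>S. cnj (c i) * c j * \<phi> (star (w i) * w j))"
proof -
  note m = cstar_subalgebraD [OF B]
  define X where "X = (\<Sum>i\<in>S. c i *\<^sub>C w i)"
  have X: "X \<in> B" unfolding X_def by (intro cstar_subalgebra_sum [OF B] m(6) w)
  have "star X * X = (\<Sum>i\<in>S. \<Sum>j\<in>S. (cnj (c i) * c j) *\<^sub>C (star (w i) * w j))"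
    unfolding X_def linear_sum [OF bounded_linear.linear [OF bounded_linear_star]] sum_product
    by (intro sum.cong refl) (simp add: star_scaleC scaleC_mult_left scaleC_mult_right scaleC_scaleC mult.commute)
  also have "\<phi> \<dots> = (\<Sum>i\<in>S. \<Sum>j\<in>S. cnj (c i) * c j * \<phi> (star (w i) * w j))"
    by (simp add: state_sum [OF B st] cstar_subalgebra_sum [OF B] state_scaleC [OF B st] m w)
  finally show ?thesis using state_nonneg [OF B st X] by simp
qed

subsection \<open>States on increasing unions\<close>

lemma mem_increasing_union:
  fixes C :: "nat \<Rightarrow> 'a set"
  assumes mono: "\<And>m n. m \<le> n \<Longrightarrow> C m \<subseteq> C n" and xy: "x \<in> (\<Union>n. C n)" "y \<in> (\<Union>n. C n)"
  shows "\<exists>n. x \<in> C n \<and> y \<in> C n"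
proof -
  obtain m n where "x \<in> C m" "y \<in> C n" using xy by auto
  then have "x \<in> C (max m n)" "y \<in> C (max m n)"
    using mono [of m "max m n"] mono [of n "max m n"] by auto
  then show ?thesis by metis
qed

lemma mem_closure_union: "z \<in> C n \<Longrightarrow> z \<in> closure (\<Union>n. C n)"
  by (rule subsetD [OF closure_subset]) blast

lemma cstar_subalgebra_closure_union:
  fixes C :: "nat \<Rightarrow> 'a::cstar_algebra set"
  assumes C: "\<And>n. cstar_subalgebra (C n)" and mono: "\<And>m n. m \<le> n \<Longrightarrow> C m \<subseteq> C n"
  shows "cstar_subalgebra (closure (\<Union>n. C n))"
proof (rule cstar_subalgebraI)
  let ?U = "\<Union>n. C n"
  have two: "\<exists>n. x \<in> C n \<and> y \<in> C n" if "x \<in> ?U" "y \<in> ?U" for x y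
    using mono that by (rule mem_increasing_union)
  have lim: "x \<in> closure ?U" if "\<And>n::nat. s n \<in> ?U" "s \<longlonglongrightarrow> x" for s x
    unfolding closure_sequential using that by (intro exI [of _ s]) simp
  show "x \<in> closure ?U" if "\<And>n::nat. s n \<in> closure ?U" "s \<longlonglongrightarrow> x" for s x
    using closed_sequentially [OF closed_closure that] .
  show "1 \<in> closure ?U" using cstar_subalgebraD(2) [OF C] closure_subset by fastforce
  fix x assume "x \<in> closure ?U"
  then obtain s where s: "\<And>k::nat. s k \<in> ?U" "s \<longlonglongrightarrow> x" by (auto simp: closure_sequential)
  have "c *\<^sub>C s k \<in> ?U" "star (s k) \<in> ?U" for c k
  proof -
    obtain n where n: "s k \<in> C n" using s(1) [of k] by auto
    show "c *\<^sub>C s k \<in> ?U" "star (s k) \<in> ?U"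
      using cstar_subalgebraD(6,7) [OF C n] by auto
  qed
  then show "c *\<^sub>C x \<in> closure ?U" "star x \<in> closure ?U" for c
    using lim [OF _ tendsto_scaleC_cstar [OF s(2), of c]] lim [OF _ tendsto_star [OF s(2)]] by simp_all
  fix y assume "y \<in> closure ?U"
  then obtain t where t: "\<And>k::nat. t k \<in> ?U" "t \<longlonglongrightarrow> y" by (auto simp: closure_sequential)
  have "s k + t k \<in> ?U" "s k * t k \<in> ?U" for k
  proof -
    obtain n where n: "s k \<in> C n" "t k \<in> C n" using two [OF s(1) t(1)] by auto
    show "s k + t k \<in> ?U" "s k * t k \<in> ?U"
      using cstar_subalgebraD(4,5) [OF C n] by auto
  qed
  then show "x + y \<in> closure ?U" "x * y \<in> closure ?U"
    using lim [OF _ tendsto_add [OF s(2) t(2)]] lim [OF _ tendsto_mult [OF s(2) t(2)]] by simp_all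
qed

text \<open>Each state is bounded by the norm with the same constant 1, so the compatible
  functionals form a 1-Lipschitz function on the union, which extends by density. Positivity
  survives because \<open>star (s k) * s k\<close> tends to \<open>star x * x\<close>.\<close>

lemma state_on_closure_union:
  fixes C :: "nat \<Rightarrow> 'a::cstar_algebra set"
  assumes C: "\<And>n. cstar_subalgebra (C n)" and mono: "\<And>m n. m \<le> n \<Longrightarrow> C m \<subseteq> C n"
    and st: "\<And>n. state_on (C n) (f n)" and f_eq: "\<And>m n z. \<lbrakk>m \<le> n; z \<in> C m\<rbrakk> \<Longrightarrow> f n z = f m z"
  obtains \<phi> where "state_on (closure (\<Union>n. C n)) \<phi>" "\<And>n z. z \<in> C n \<Longrightarrow> \<phi> z = f n z"
proof -
  let ?U = "\<Union>n. C n"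
  define h where "h z = f (LEAST n. z \<in> C n) z" for z
  have h: "h z = f n z" if "z \<in> C n" for n z
    unfolding h_def by (rule f_eq [symmetric]) (use that in \<open>auto intro: LeastI Least_le\<close>)
  have two: "\<exists>n. x \<in> C n \<and> y \<in> C n" if "x \<in> ?U" "y \<in> ?U" for x y
    using mono that by (rule mem_increasing_union)
  have h_add: "h (x + y) = h x + h y" "x + y \<in> ?U" and h_bound: "norm (h x - h y) \<le> 1 * norm (x - y)"
    if xy: "x \<in> ?U" "y \<in> ?U" for x y
  proof -
    obtain n where n: "x \<in> C n" "y \<in> C n" using two [OF xy] by auto
    note m = cstar_subalgebraD [OF C [of n]]
    show "h (x + y) = h x + h y" using n by (simp add: h [of _ n] m state_add [OF C st])
    show "x + y \<in> ?U" using m(4) [OF n] by auto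
    show "norm (h x - h y) \<le> 1 * norm (x - y)"
      using state_norm_le [OF C st m(9) [OF n]] n by (simp add: h [of _ n] state_diff [OF C st])
  qed
  have h_scaleC: "h (c *\<^sub>C x) = c * h x" "c *\<^sub>C x \<in> ?U"
    and h_pos: "0 \<le> h (star x * x)" "star x * x \<in> ?U" if x: "x \<in> ?U" for x c
  proof -
    obtain n where n: "x \<in> C n" using x by auto
    note m = cstar_subalgebraD [OF C [of n]]
    show "h (c *\<^sub>C x) = c * h x" using n by (simp add: h [of _ n] m state_scaleC [OF C st])
    show "c *\<^sub>C x \<in> ?U" using m(6) [OF n] by auto
    show "0 \<le> h (star x * x)" using state_nonneg [OF C st n] n by (simp add: h [of _ n] m)
    show "star x * x \<in> ?U" using m(5) [OF m(7) [OF n] n] by auto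
  qed
  obtain \<phi> where lim: "\<And>s z. \<lbrakk>\<And>k. s k \<in> ?U; s \<longlonglongrightarrow> z\<rbrakk> \<Longrightarrow> (\<lambda>k. h (s k)) \<longlonglongrightarrow> \<phi> z"
    using dense_extension [of ?U h 1 "\<lambda>x. x", OF h_bound] by blast
  have phi: "\<phi> z = h z" if "z \<in> ?U" for z
    using lim [of "\<lambda>_. z" z] that by (simp add: LIMSEQ_const_iff)
  have "state_on (closure ?U) \<phi>"
    unfolding state_on_def
  proof (intro conjI ballI allI)
    fix x assume "x \<in> closure ?U"
    then obtain s where s: "\<And>k::nat. s k \<in> ?U" "s \<longlonglongrightarrow> x" by (auto simp: closure_sequential)
    have "(\<lambda>k. h (star (s k) * s k)) \<longlonglongrightarrow> \<phi> (star x * x)"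
      by (intro lim h_pos s tendsto_mult tendsto_star)
    from tendsto_Re [OF this] tendsto_Im [OF this] h_pos(1) [OF s(1)]
    have "0 \<le> Re (\<phi> (star x * x))" "Im (\<phi> (star x * x)) = 0"
      by (auto simp: less_eq_complex_def LIMSEQ_const_iff intro: LIMSEQ_le_const)
    then show "\<phi> (star x * x) \<in> \<real>" "0 \<le> Re (\<phi> (star x * x))" by (auto simp: complex_is_Real_iff)
    show "\<phi> (c *\<^sub>C x) = c * \<phi> x" for c
    proof (rule LIMSEQ_unique)
      show "(\<lambda>k. h (c *\<^sub>C s k)) \<longlonglongrightarrow> \<phi> (c *\<^sub>C x)"
        by (intro lim h_scaleC s tendsto_scaleC_cstar)
      show "(\<lambda>k. h (c *\<^sub>C s k)) \<longlonglongrightarrow> c * \<phi> x"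
        using tendsto_mult_left [OF lim [OF s], of c] by (simp only: h_scaleC s)
    qed
    fix y assume "y \<in> closure ?U"
    then obtain t where t: "\<And>k::nat. t k \<in> ?U" "t \<longlonglongrightarrow> y" by (auto simp: closure_sequential)
    show "\<phi> (x + y) = \<phi> x + \<phi> y"
    proof (rule LIMSEQ_unique)
      show "(\<lambda>k. h (s k + t k)) \<longlonglongrightarrow> \<phi> (x + y)"
        by (intro lim h_add s t tendsto_add)
      show "(\<lambda>k. h (s k + t k)) \<longlonglongrightarrow> \<phi> x + \<phi> y"
        using tendsto_add [OF lim [OF s] lim [OF t]] by (simp only: h_add s t)
    qed
  next
    have "1 \<in> C 0" by (rule cstar_subalgebraD(2) [OF C])
    then show "\<phi> 1 = 1" using phi [of 1] h [of 1 0] state_one [OF C st, of 0] by auto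
  qed
  moreover have "\<phi> z = f n z" if "z \<in> C n" for n z
    using that phi [of z] h [OF that] by auto
  ultimately show ?thesis using that by blast
qed

subsection \<open>Adjoining anticommuting self-adjoint unitaries\<close>

text \<open>An index outside J repeats the stage, so the stages run through all natural numbers even
  if J is finite or has gaps. That a stage is again a closed algebra rests on the rule
  \<open>g n * z = \<Theta> z * g n\<close> for z in the preceding one.\<close>

primrec clifford_tower :: "(nat \<Rightarrow> 'a::cstar_algebra) \<Rightarrow> nat set \<Rightarrow> 'a set \<Rightarrow> nat \<Rightarrow> 'a set" where
  "clifford_tower g J W 0 = W"
| "clifford_tower g J W (Suc n) =
    (if n \<in> J then {x + y * g n | x y. x \<in> clifford_tower g J W n \<and> y \<in> clifford_tower g J W n}
     else clifford_tower g J W n)"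

text \<open>On \<open>x + y * g k\<close>, with \<open>x\<close> and \<open>y\<close> in the preceding algebra of the tower, this is the projection to \<open>x\<close>.\<close>

definition clifford_expectation :: "('a::cstar_algebra \<Rightarrow> 'a) \<Rightarrow> (nat \<Rightarrow> 'a) \<Rightarrow> nat \<Rightarrow> 'a \<Rightarrow> 'a" where
  "clifford_expectation \<Theta> g k z = (1/2) *\<^sub>R (z + g k * \<Theta> z * g k)"

text \<open>The functional with value \<open>\<omega> x * \<psi> y\<close> at \<open>x * y\<close>, for \<open>x\<close> in the base algebra and \<open>y\<close> in the
  algebra generated by the \<open>g k\<close>.\<close>

primrec clifford_product ::
    "('a::cstar_algebra \<Rightarrow> 'a) \<Rightarrow> (nat \<Rightarrow> 'a) \<Rightarrow> nat set \<Rightarrow> ('a \<Rightarrow> complex) \<Rightarrow> nat \<Rightarrow> ('a \<Rightarrow> complex) \<Rightarrow> 'a \<Rightarrow> complex"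
  where
  "clifford_product \<Theta> g J \<omega> 0 \<psi> z = \<omega> z * \<psi> 1"
| "clifford_product \<Theta> g J \<omega> (Suc n) \<psi> z =
    (if n \<in> J then clifford_product \<Theta> g J \<omega> n \<psi> (clifford_expectation \<Theta> g n z)
       + clifford_product \<Theta> g J \<omega> n (\<lambda>y. \<psi> (y * g n)) (clifford_expectation \<Theta> g n (z * g n))
     else clifford_product \<Theta> g J \<omega> n \<psi> z)"

lemma clifford_tower_subset:
  assumes A: "cstar_subalgebra A" and W: "W \<subseteq> A" and g: "\<And>n. n \<in> J \<Longrightarrow> g n \<in> A"
  shows "clifford_tower g J W n \<subseteq> A"
proof (induction n)
  case (Suc n)
  then show ?case by (auto intro!: cstar_subalgebraD(4,5) [OF A] g intro: subsetD)
qed (simp add: W)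

lemma clifford_tower_mono:
  assumes "W \<subseteq> W'"
  shows "clifford_tower g J W n \<subseteq> clifford_tower g J W' n"
proof (induction n)
  case (Suc n)
  then show ?case by (auto simp: subset_iff)
qed (simp add: assms)

lemma clifford_tower_base:
  assumes "0 \<in> W"
  shows "W \<subseteq> clifford_tower g J W n"
proof (induction n)
  case (Suc n)
  have "x \<in> clifford_tower g J W (Suc n)" if "x \<in> W" for x
  proof (cases "n \<in> J")
    case True
    have "\<exists>u v. x = u + v * g n \<and> u \<in> clifford_tower g J W n \<and> v \<in> clifford_tower g J W n"
      by (rule exI [of _ x], rule exI [of _ 0]) (use that Suc assms in auto)
    then show ?thesis using True by simp
  qed (use that Suc in auto)
  then show ?case by blast
qed simp

lemma cstar_subalgebra_scalars: "cstar_subalgebra (range (\<lambda>c. c *\<^sub>C (1::'a::cstar_algebra)))"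
proof (rule cstar_subalgebraI)
  fix s x assume s: "\<And>n::nat. s n \<in> range (\<lambda>c. c *\<^sub>C (1::'a))" "s \<longlonglongrightarrow> x"
  have "\<forall>n. \<exists>c. s n = c *\<^sub>C 1" using s(1) by auto
  then obtain c where c: "\<And>n. s n = c n *\<^sub>C 1" by metis
  have "dist (c m) (c n) = dist (s m) (s n)" for m n
  proof -
    have "s m - s n = (c m - c n) *\<^sub>C 1"
      using scaleC_add_left [of "c m - c n" "c n" "1::'a"] by (simp add: c)
    then show ?thesis by (simp add: dist_norm norm_scaleC)
  qed
  then have "Cauchy c" using LIMSEQ_imp_Cauchy [OF s(2)] by (simp add: Cauchy_def)
  then obtain l where l: "c \<longlonglongrightarrow> l" by (auto simp: Cauchy_convergent_iff convergent_def)
  have "(\<lambda>n. norm (s n - l *\<^sub>C 1)) \<longlonglongrightarrow> 0"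
  proof -
    have "s n - l *\<^sub>C 1 = (c n - l) *\<^sub>C 1" for n
      using scaleC_add_left [of "c n - l" "l" "1::'a"] by (simp add: c)
    then show ?thesis using tendsto_norm [OF LIM_zero [OF l]] by (simp add: norm_scaleC)
  qed
  then have "s \<longlonglongrightarrow> l *\<^sub>C 1" by (simp add: tendsto_norm_zero_iff LIM_zero_cancel)
  then show "x \<in> range (\<lambda>c. c *\<^sub>C (1::'a))" using LIMSEQ_unique [OF s(2)] by auto
next
  show "1 \<in> range (\<lambda>c. c *\<^sub>C (1::'a))" by (rule range_eqI [of _ _ 1]) simp
next
  fix x y :: 'a assume "x \<in> range (\<lambda>c. c *\<^sub>C 1)" "y \<in> range (\<lambda>c. c *\<^sub>C 1)"
  then obtain c d where cd: "x = c *\<^sub>C 1" "y = d *\<^sub>C 1" by auto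
  show "x + y \<in> range (\<lambda>c. c *\<^sub>C 1)" by (rule range_eqI [of _ _ "c + d"]) (simp add: cd scaleC_add_left)
  show "x * y \<in> range (\<lambda>c. c *\<^sub>C 1)"
    by (rule range_eqI [of _ _ "c * d"]) (simp add: cd scaleC_mult_left scaleC_scaleC)
next
  fix k and x :: 'a assume "x \<in> range (\<lambda>c. c *\<^sub>C 1)"
  then obtain c where c: "x = c *\<^sub>C 1" by auto
  show "k *\<^sub>C x \<in> range (\<lambda>c. c *\<^sub>C 1)" by (rule range_eqI [of _ _ "k * c"]) (simp add: c scaleC_scaleC)
  show "star x \<in> range (\<lambda>c. c *\<^sub>C 1)" by (rule range_eqI [of _ _ "cnj c"]) (simp add: c star_scaleC)
qed

locale clifford_system =
  fixes \<Theta> :: "'a::cstar_algebra \<Rightarrow> 'a" and g :: "nat \<Rightarrow> 'a" and J :: "nat set"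
  assumes aut: "star_automorphism \<Theta>" and inv: "\<And>x. \<Theta> (\<Theta> x) = x"
    and g_star: "\<And>n. n \<in> J \<Longrightarrow> star (g n) = g n" and g_square: "\<And>n. n \<in> J \<Longrightarrow> g n * g n = 1"
    and g_odd: "\<And>n. n \<in> J \<Longrightarrow> \<Theta> (g n) = - g n"
    and g_anti: "\<And>m n. \<lbrakk>m \<in> J; n \<in> J; m \<noteq> n\<rbrakk> \<Longrightarrow> g m * g n = - (g n * g m)"
begin

lemma g_square': "n \<in> J \<Longrightarrow> x * g n * g n = x"
  by (simp add: mult.assoc g_square)

lemma expectation_add:
  "clifford_expectation \<Theta> g n (x + y) = clifford_expectation \<Theta> g n x + clifford_expectation \<Theta> g n y"
  by (simp add: clifford_expectation_def auto_add [OF aut] distrib_left distrib_right scaleR_add_right)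

lemma expectation_scaleC:
  "clifford_expectation \<Theta> g n (c *\<^sub>C x) = c *\<^sub>C clifford_expectation \<Theta> g n x"
  by (simp add: clifford_expectation_def auto_scaleC [OF aut] scaleC_mult_left scaleC_mult_right
      scaleC_scaleR scaleC_add_right)

lemma expectation_tendsto:
  "s \<longlonglongrightarrow> x \<Longrightarrow> (\<lambda>k. clifford_expectation \<Theta> g n (s k)) \<longlonglongrightarrow> clifford_expectation \<Theta> g n x"
  unfolding clifford_expectation_def by (intro tendsto_intros auto_tendsto [OF aut])

text \<open>The map \<open>z \<mapsto> g n * \<Theta> z * g n\<close> fixes elements that obey the
  twisted commutation rule and changes the sign of \<open>y * g n\<close>, so averaging it with the
  identity keeps \<open>x\<close>. Hence the components of \<open>x + y * g n\<close> are unique and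
  depend continuously on the sum.\<close>

lemma expectation_eq:
  assumes n: "n \<in> J" and x: "g n * x = \<Theta> x * g n" and y: "g n * y = \<Theta> y * g n"
  shows "clifford_expectation \<Theta> g n (x + y * g n) = x" "clifford_expectation \<Theta> g n ((x + y * g n) * g n) = y"
proof -
  have tw: "g n * \<Theta> z = z * g n" if "g n * z = \<Theta> z * g n" for z
    using arg_cong [OF that, of \<Theta>] by (simp add: auto_mult [OF aut] inv g_odd n)
  have fix_x: "clifford_expectation \<Theta> g n z = z" if "g n * z = \<Theta> z * g n" for z
    using scaleR_half_double [of z] by (simp add: clifford_expectation_def tw [OF that] g_square' n)
  have kill: "clifford_expectation \<Theta> g n (z * g n) = 0" if "g n * z = \<Theta> z * g n" for z
  proof -
    have "g n * \<Theta> (z * g n) * g n = - (g n * \<Theta> z)"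
      by (simp add: auto_mult [OF aut] g_odd n mult.assoc g_square)
    then show ?thesis by (simp add: clifford_expectation_def tw [OF that])
  qed
  show "clifford_expectation \<Theta> g n (x + y * g n) = x"
    by (simp add: expectation_add fix_x [OF x] kill [OF y])
  show "clifford_expectation \<Theta> g n ((x + y * g n) * g n) = y"
    by (simp add: distrib_right g_square' n expectation_add fix_x [OF y] kill [OF x])
qed

end

text \<open>Two bases occur: A(I1), whose tower carries the product functional, and the scalars,
  whose tower contains what the \<open>g n\<close> generate by themselves.\<close>

locale clifford_base = clifford_system \<Theta> g J
  for \<Theta> :: "'a::cstar_algebra \<Rightarrow> 'a" and g :: "nat \<Rightarrow> 'a" and J :: "nat set" +
  fixes W :: "'a set"
  assumes W: "cstar_subalgebra W" and W_parity: "\<And>w. w \<in> W \<Longrightarrow> \<Theta> w \<in> W"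
    and W_twist: "\<And>n w. \<lbrakk>n \<in> J; w \<in> W\<rbrakk> \<Longrightarrow> g n * w = \<Theta> w * g n"
begin

abbreviation "tower \<equiv> clifford_tower g J W"

text \<open>The claims support one another: products in the next stage need the twist by
  \<open>g n\<close> and invariance under \<Theta>, while the twist by a later \<open>g m\<close>
  also uses its anticommutation with \<open>g n\<close>.\<close>

lemma tower_properties:
  "cstar_subalgebra (tower n) \<and> (\<forall>z\<in>tower n. \<Theta> z \<in> tower n) \<and>
   (\<forall>m\<ge>n. m \<in> J \<longrightarrow> (\<forall>z\<in>tower n. g m * z = \<Theta> z * g m))"
proof (induction n)
  case 0
  show ?case using W W_parity W_twist by simp
next
  case (Suc n)
  show ?case
  proof (cases "n \<in> J")
    case True
    have C: "cstar_subalgebra (tower n)" and par: "\<And>z. z \<in> tower n \<Longrightarrow> \<Theta> z \<in> tower n"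
      and tw: "\<And>m z. \<lbrakk>m \<ge> n; m \<in> J; z \<in> tower n\<rbrakk> \<Longrightarrow> g m * z = \<Theta> z * g m"
      using Suc.IH by simp_all
    note m = cstar_subalgebraD [OF C]
    have tw': "g n * z = \<Theta> z * g n" if "z \<in> tower n" for z by (rule tw [OF order_refl True that])
    have mem: "x + y * g n \<in> tower (Suc n)" if "x \<in> tower n" "y \<in> tower n" for x y
      using that True by auto
    have ex: "\<exists>x y. x \<in> tower n \<and> y \<in> tower n \<and> z = x + y * g n" if "z \<in> tower (Suc n)" for z
      using that True by auto
    have "cstar_subalgebra (tower (Suc n))"
    proof (rule cstar_subalgebraI)
      fix s z assume s: "\<And>k::nat. s k \<in> tower (Suc n)" "s \<longlonglongrightarrow> z"
      \<comment> \<open>Closedness of the new stage: as E is continuous, both components of a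
        convergent sequence converge, and they do so inside the old closed stage.\<close>
      define E where "E = clifford_expectation \<Theta> g n"
      have Es: "E (s k) \<in> tower n \<and> E (s k * g n) \<in> tower n \<and> s k = E (s k) + E (s k * g n) * g n" for k
      proof -
        obtain x y where "x \<in> tower n" "y \<in> tower n" "s k = x + y * g n" using ex [OF s(1)] by blast
        then show ?thesis using expectation_eq [OF True tw' tw', of x y] by (simp add: E_def)
      qed
      have lim: "(\<lambda>k. E (s k)) \<longlonglongrightarrow> E z" "(\<lambda>k. E (s k * g n)) \<longlonglongrightarrow> E (z * g n)"
        unfolding E_def by (intro expectation_tendsto tendsto_mult tendsto_const s(2))+
      have "E z \<in> tower n" "E (z * g n) \<in> tower n"
        using closed_sequentially [OF m(1) _ lim(1)] closed_sequentially [OF m(1) _ lim(2)] Es by simp_all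
      moreover have "(\<lambda>k. E (s k) + E (s k * g n) * g n) \<longlonglongrightarrow> E z + E (z * g n) * g n"
        by (intro tendsto_intros lim)
      then have "s \<longlonglongrightarrow> E z + E (z * g n) * g n"
        by (simp only: Es [THEN conjunct2, THEN conjunct2, symmetric])
      then have "z = E z + E (z * g n) * g n" using s(2) LIMSEQ_unique by blast
      ultimately show "z \<in> tower (Suc n)" using mem by metis
    next
      show "1 \<in> tower (Suc n)" using mem [OF m(2,3)] by simp
    next
      fix z w assume "z \<in> tower (Suc n)" "w \<in> tower (Suc n)"
      then obtain x y u v where z: "x \<in> tower n" "y \<in> tower n" "z = x + y * g n"
        and w: "u \<in> tower n" "v \<in> tower n" "w = u + v * g n" using ex by metis
      have "z + w = (x + u) + (y + v) * g n" by (simp add: z w distrib_right)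
      moreover have "(x + u) + (y + v) * g n \<in> tower (Suc n)" using z w by (intro mem m)
      ultimately show "z + w \<in> tower (Suc n)" by simp
      have "y * g n * u = y * \<Theta> u * g n" "y * g n * v * g n = y * \<Theta> v"
        using tw' [OF w(1)] tw' [OF w(2)] by (simp_all add: mult.assoc g_square True)
      then have "z * w = (x * u + y * \<Theta> v) + (x * v + y * \<Theta> u) * g n"
        by (simp add: z w distrib_left distrib_right mult.assoc)
      moreover have "(x * u + y * \<Theta> v) + (x * v + y * \<Theta> u) * g n \<in> tower (Suc n)"
        using z w by (intro mem m par)
      ultimately show "z * w \<in> tower (Suc n)" by simp
    next
      fix c z assume "z \<in> tower (Suc n)"
      then obtain x y where z: "x \<in> tower n" "y \<in> tower n" "z = x + y * g n" using ex by metis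
      have "c *\<^sub>C z = c *\<^sub>C x + c *\<^sub>C y * g n" by (simp add: z scaleC_add_right scaleC_mult_left)
      moreover have "c *\<^sub>C x + c *\<^sub>C y * g n \<in> tower (Suc n)" using z by (intro mem m)
      ultimately show "c *\<^sub>C z \<in> tower (Suc n)" by simp
      have "star z = star x + \<Theta> (star y) * g n"
        using tw' [OF m(7) [OF z(2)]] by (simp add: z star_add star_mult g_star True)
      moreover have "star x + \<Theta> (star y) * g n \<in> tower (Suc n)" using z by (intro mem m par)
      ultimately show "star z \<in> tower (Suc n)" by simp
    qed
    moreover have "\<Theta> z \<in> tower (Suc n)" if zC: "z \<in> tower (Suc n)" for z
    proof -
      obtain x y where z: "x \<in> tower n" "y \<in> tower n" "z = x + y * g n" using ex [OF zC] by metis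
      have "\<Theta> z = \<Theta> x + (- \<Theta> y) * g n" by (simp add: z auto_add [OF aut] auto_mult [OF aut] g_odd True)
      moreover have "\<Theta> x + (- \<Theta> y) * g n \<in> tower (Suc n)" using z by (intro mem m par)
      ultimately show ?thesis by simp
    qed
    moreover have "g k * z = \<Theta> z * g k" if k: "k \<ge> Suc n" "k \<in> J" and zC: "z \<in> tower (Suc n)" for k z
    proof -
      obtain x y where z: "x \<in> tower n" "y \<in> tower n" "z = x + y * g n" using ex [OF zC] by metis
      have kn: "g k * g n = - (g n * g k)" using k True by (intro g_anti) auto
      have tx: "g k * x = \<Theta> x * g k" and ty: "g k * y = \<Theta> y * g k" using tw k z by simp_all
      have "g k * (y * g n) = \<Theta> y * (g k * g n)" by (simp only: mult.assoc [symmetric] ty)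
      also have "\<dots> = \<Theta> (y * g n) * g k"
        by (simp add: kn auto_mult [OF aut] g_odd True mult.assoc)
      finally show ?thesis by (simp add: z distrib_left distrib_right auto_add [OF aut] tx)
    qed
    ultimately show ?thesis by blast
  qed (use Suc in simp)
qed

lemma cstar_subalgebra_tower: "cstar_subalgebra (tower n)"
  and tower_parity: "z \<in> tower n \<Longrightarrow> \<Theta> z \<in> tower n"
  and tower_twist: "\<lbrakk>n \<le> m; m \<in> J; z \<in> tower n\<rbrakk> \<Longrightarrow> g m * z = \<Theta> z * g m"
  using tower_properties [of n] by simp_all

lemma tower_mono: "m \<le> n \<Longrightarrow> tower m \<subseteq> tower n"
proof (rule lift_Suc_mono_le)
  fix n
  have "x + 0 * g n \<in> tower (Suc n)" if "n \<in> J" "x \<in> tower n" for x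
    using that cstar_subalgebraD(3) [OF cstar_subalgebra_tower, of n] by (auto simp del: mult_zero_left)
  then show "tower n \<subseteq> tower (Suc n)" by (cases "n \<in> J") auto
qed

lemma generator_in_tower:
  assumes "k \<in> J" "k < n"
  shows "g k \<in> tower n"
proof -
  note m = cstar_subalgebraD [OF cstar_subalgebra_tower [of k]]
  have "0 + 1 * g k \<in> tower (Suc k)" using m(2,3) assms(1) by (auto simp del: add_0 mult_1)
  then show ?thesis using tower_mono [of "Suc k" n] assms(2) by auto
qed

lemma tower_SucE:
  assumes "n \<in> J" "z \<in> tower (Suc n)"
  obtains x y where "x \<in> tower n" "y \<in> tower n" "z = x + y * g n"
    "clifford_expectation \<Theta> g n z = x" "clifford_expectation \<Theta> g n (z * g n) = y"
proof -
  obtain x y where xy: "x \<in> tower n" "y \<in> tower n" "z = x + y * g n" using assms by auto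
  show ?thesis
    using that [OF xy] expectation_eq [OF assms(1) tower_twist tower_twist, OF order_refl assms(1) xy(1) order_refl assms(1) xy(2)]
    by (simp add: xy(3))
qed

section \<open>The product functional on the tower\<close>

context
  fixes \<omega> :: "'a \<Rightarrow> complex"
  assumes \<omega>: "state_on W \<omega>"
begin

abbreviation "product \<equiv> clifford_product \<Theta> g J \<omega>"

lemma product_add:
  "\<lbrakk>x \<in> tower n; y \<in> tower n\<rbrakk> \<Longrightarrow> product n \<psi> (x + y) = product n \<psi> x + product n \<psi> y"
proof (induction n arbitrary: x y \<psi>)
  case 0
  then show ?case by (simp add: state_add [OF W \<omega>] distrib_right)
next
  case (Suc n)
  show ?case
  proof (cases "n \<in> J")
    case True
    obtain u v where "u \<in> tower n" "v \<in> tower n"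
      "clifford_expectation \<Theta> g n x = u" "clifford_expectation \<Theta> g n (x * g n) = v"
      using tower_SucE [OF True Suc.prems(1)] by metis
    moreover obtain u' v' where "u' \<in> tower n" "v' \<in> tower n"
      "clifford_expectation \<Theta> g n y = u'" "clifford_expectation \<Theta> g n (y * g n) = v'"
      using tower_SucE [OF True Suc.prems(2)] by metis
    ultimately show ?thesis using True by (simp add: expectation_add distrib_right Suc.IH)
  qed (use Suc in simp)
qed

lemma product_scaleC:
  "x \<in> tower n \<Longrightarrow> product n \<psi> (c *\<^sub>C x) = c * product n \<psi> x"
proof (induction n arbitrary: x \<psi>)
  case 0
  then show ?case by (simp add: state_scaleC [OF W \<omega>])
next
  case (Suc n)
  show ?case
  proof (cases "n \<in> J")
    case True
    obtain u v where "u \<in> tower n" "v \<in> tower n"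
      "clifford_expectation \<Theta> g n x = u" "clifford_expectation \<Theta> g n (x * g n) = v"
      using tower_SucE [OF True Suc.prems(1)] by metis
    then show ?thesis using True by (simp add: expectation_scaleC scaleC_mult_left distrib_left Suc.IH)
  qed (use Suc in simp)
qed

lemma product_sum:
  "(\<And>i. i \<in> S \<Longrightarrow> x i \<in> tower n) \<Longrightarrow> product n \<psi> (sum x S) = (\<Sum>i\<in>S. product n \<psi> (x i))"
proof -
  assume x: "\<And>i. i \<in> S \<Longrightarrow> x i \<in> tower n"
  have zero: "product n \<psi> 0 = 0"
    using product_scaleC [of 0 n \<psi> 0] cstar_subalgebraD(3) [OF cstar_subalgebra_tower] by simp
  show ?thesis
    using x
    by (induction S rule: infinite_finite_induct)
       (simp_all add: zero product_add cstar_subalgebra_sum [OF cstar_subalgebra_tower])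
qed

text \<open>An element of the lower stage has component 0 along \<open>g n\<close>, which removes
  the second term of the recursion. This is the compatibility that lets the stages be glued
  together.\<close>

lemma product_Suc: "z \<in> tower n \<Longrightarrow> product (Suc n) \<psi> z = product n \<psi> z"
proof (cases "n \<in> J")
  case True
  assume z: "z \<in> tower n"
  have z0: "0 \<in> tower n" by (rule cstar_subalgebraD(3) [OF cstar_subalgebra_tower])
  have "clifford_expectation \<Theta> g n z = z" "clifford_expectation \<Theta> g n (z * g n) = 0"
    using expectation_eq [OF True tower_twist [OF order_refl True z] tower_twist [OF order_refl True z0]] by simp_all
  moreover have "product n \<psi>' 0 = 0" for \<psi>' using product_scaleC [OF z0, of \<psi>' 0] by simp
  ultimately show ?thesis using True by simp
qed simp

lemma product_le:
  assumes "m \<le> n" "z \<in> tower m"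
  shows "product n \<psi> z = product m \<psi> z"
  using assms(1)
proof (induction rule: dec_induct)
  case (step k)
  then show ?case using product_Suc [of z k \<psi>] tower_mono [of m k] assms(2) by auto
qed simp

end

section \<open>Decomposition over the scalar tower and positivity\<close>

abbreviation "scalars \<equiv> range (\<lambda>c. c *\<^sub>C (1::'a))"

lemma clifford_base_scalars: "clifford_base \<Theta> g J scalars"
proof (unfold_locales)
  show "cstar_subalgebra scalars" by (rule cstar_subalgebra_scalars)
qed (auto simp: auto_scaleC [OF aut] auto_one [OF aut] scaleC_mult_left scaleC_mult_right)

lemma scalar_tower_subset: "clifford_tower g J scalars n \<subseteq> tower n"
proof (rule clifford_tower_mono)
  show "scalars \<subseteq> W" using cstar_subalgebraD(2,6) [OF W] by auto
qed

text \<open>Exchanging \<open>g n\<close> with a factor from W costs a \<Theta> on that factor and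
  nothing else. The order, generators on the left and W on the right, brings the generator parts of
  \<open>star z * z\<close> side by side in the middle.\<close>

lemma tower_decomposition:
  "z \<in> tower n \<Longrightarrow>
    \<exists>ps. (\<forall>p\<in>set ps. fst p \<in> clifford_tower g J scalars n \<and> snd p \<in> W) \<and> z = (\<Sum>p\<leftarrow>ps. fst p * snd p)"
proof (induction n arbitrary: z)
  case 0
  have "(1::'a) \<in> scalars" by (rule range_eqI [of _ _ 1]) simp
  then show ?case using 0 by (intro exI [of _ "[(1, z)]"]) simp
next
  case (Suc n)
  interpret scal: clifford_base \<Theta> g J scalars by (rule clifford_base_scalars)
  show ?case
  proof (cases "n \<in> J")
    case True
    obtain x y where xy: "x \<in> tower n" "y \<in> tower n" "z = x + y * g n"
      using tower_SucE [OF True Suc.prems] by metis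
    obtain ps where ps: "\<And>p. p \<in> set ps \<Longrightarrow> fst p \<in> scal.tower n \<and> snd p \<in> W" "x = (\<Sum>p\<leftarrow>ps. fst p * snd p)"
      using Suc.IH [OF xy(1)] by blast
    obtain qs where qs: "\<And>p. p \<in> set qs \<Longrightarrow> fst p \<in> scal.tower n \<and> snd p \<in> W" "y = (\<Sum>p\<leftarrow>qs. fst p * snd p)"
      using Suc.IH [OF xy(2)] by blast
    define rs where "rs = map (\<lambda>p. (fst p * g n, \<Theta> (snd p))) qs"
    have "w * g n = g n * \<Theta> w" if "w \<in> W" for w
      using W_twist [OF True W_parity [OF that]] by (simp add: inv)
    then have "y * g n = (\<Sum>p\<leftarrow>rs. fst p * snd p)"
      unfolding qs(2) rs_def sum_list_mult_const [symmetric] map_map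
      by (intro arg_cong [where f = sum_list] map_cong refl) (simp add: qs(1) mult.assoc)
    then have "z = (\<Sum>p\<leftarrow>ps @ rs. fst p * snd p)" by (simp add: xy(3) ps(2))
    moreover have "fst p \<in> scal.tower (Suc n) \<and> snd p \<in> W" if p: "p \<in> set (ps @ rs)" for p
    proof -
      have up: "u \<in> scal.tower (Suc n)" if "u \<in> scal.tower n" for u
        using subsetD [OF scal.tower_mono [of n "Suc n"] that] by simp
      have mult: "u * g n \<in> scal.tower (Suc n)" if "u \<in> scal.tower n" for u
        by (intro cstar_subalgebraD(5) [OF scal.cstar_subalgebra_tower] scal.generator_in_tower True up that) simp
      consider "p \<in> set ps" | q where "q \<in> set qs" "p = (fst q * g n, \<Theta> (snd q))"
        using p unfolding rs_def by auto
      then show ?thesis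
      proof cases
        case 1
        show ?thesis by (rule conjI [OF up [OF conjunct1 [OF ps(1) [OF 1]]] conjunct2 [OF ps(1) [OF 1]]])
      next
        case 2
        show ?thesis
          unfolding 2(2) fst_conv snd_conv
          by (rule conjI [OF mult [OF conjunct1 [OF qs(1) [OF 2(1)]]] W_parity [OF conjunct2 [OF qs(1) [OF 2(1)]]]])
      qed
    qed
    ultimately show ?thesis by (intro exI [of _ "ps @ rs"]) blast
  qed (use Suc in simp)
qed

context
  fixes \<omega> :: "'a \<Rightarrow> complex" and A :: "'a set"
  assumes \<omega>: "state_on W \<omega>" and A: "cstar_subalgebra A" and g_A: "\<And>n. n \<in> J \<Longrightarrow> g n \<in> A"
begin

lemma scalar_tower_in_A: "clifford_tower g J scalars n \<subseteq> A"
  using cstar_subalgebraD(2,6) [OF A] by (intro clifford_tower_subset A g_A) auto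

text \<open>The hypothesis on \<open>\<psi>\<close> is linearity because the recursion passes to
  \<open>y \<mapsto> \<psi> (y * g n)\<close>, which need not be a state.\<close>

lemma product_value:
  assumes "\<And>u v. \<lbrakk>u \<in> A; v \<in> A\<rbrakk> \<Longrightarrow> \<psi> (u + v) = \<psi> u + \<psi> v" "\<And>c u. u \<in> A \<Longrightarrow> \<psi> (c *\<^sub>C u) = c * \<psi> u"
    and x: "x \<in> W" and "y \<in> clifford_tower g J scalars n"
  shows "clifford_product \<Theta> g J \<omega> n \<psi> (x * y) = \<omega> x * \<psi> y"
  using assms(1,2,4)
proof (induction n arbitrary: \<psi> y)
  case 0
  then obtain c where "y = c *\<^sub>C 1" by auto
  then show ?case
    using 0(2) [OF cstar_subalgebraD(2) [OF A]] by (simp add: scaleC_mult_right state_scaleC [OF W \<omega> x])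
next
  case (Suc n)
  note add = Suc.prems(1) and sc = Suc.prems(2)
  interpret scal: clifford_base \<Theta> g J scalars by (rule clifford_base_scalars)
  note mA = cstar_subalgebraD [OF A] and mC = cstar_subalgebraD [OF cstar_subalgebra_tower [of n]]
  show ?case
  proof (cases "n \<in> J")
    case True
    obtain u v where uv: "u \<in> scal.tower n" "v \<in> scal.tower n" "y = u + v * g n"
      using scal.tower_SucE [OF True Suc.prems(3)] by metis
    have uvA: "u \<in> A" "v \<in> A" using uv(1,2) scalar_tower_in_A by auto
    have "x \<in> tower n" using clifford_tower_base [of W g J n] cstar_subalgebraD(3) [OF W] x by auto
    then have xu: "x * u \<in> tower n" and xv: "x * v \<in> tower n"
      using uv(1,2) scalar_tower_subset by (auto intro!: mC(5))
    have eq: "x * y = x * u + x * v * g n" by (simp add: uv(3) distrib_left mult.assoc)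
    note ex = expectation_eq [OF True tower_twist [OF order_refl True xu] tower_twist [OF order_refl True xv]]
    have "clifford_product \<Theta> g J \<omega> n (\<lambda>y. \<psi> (y * g n)) (x * v) = \<omega> x * \<psi> (v * g n)"
      by (rule Suc.IH) (simp_all add: add sc distrib_right scaleC_mult_left mA g_A True uv(2))
    moreover have "clifford_product \<Theta> g J \<omega> n \<psi> (x * u) = \<omega> x * \<psi> u"
      by (rule Suc.IH [OF add sc uv(1)])
    moreover have "\<psi> y = \<psi> u + \<psi> (v * g n)" unfolding uv(3) by (intro add uvA mA g_A True)
    ultimately show ?thesis using True by (simp add: eq ex distrib_left)
  qed (use Suc in simp)
qed

context
  fixes \<psi> :: "'a \<Rightarrow> complex"
  assumes \<psi>: "state_on A \<psi>"
    and A_parity: "\<And>v. v \<in> A \<Longrightarrow> \<Theta> v \<in> A" and even: "\<And>v. v \<in> A \<Longrightarrow> \<psi> (\<Theta> v) = \<psi> v"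
    and commute_even: "\<And>x v. \<lbrakk>x \<in> W; v \<in> A; \<Theta> v = v\<rbrakk> \<Longrightarrow> x * v = v * x"
    and commute_odd: "\<And>x v. \<lbrakk>x \<in> W; v \<in> A; \<Theta> v = - v\<rbrakk> \<Longrightarrow> x * v = v * \<Theta> x"
begin

text \<open>Here evenness enters. The even part of \<open>v\<close> commutes with \<open>w'\<close>;
  the odd part passes \<open>w'\<close> with a twist by \<Theta>, but its value under
  \<open>\<psi>\<close> is 0 and it drops out.\<close>

lemma product_sandwich:
  assumes w: "w \<in> W" "w' \<in> W" and v: "v \<in> clifford_tower g J scalars n"
  shows "clifford_product \<Theta> g J \<omega> n \<psi> (w * v * w') = \<omega> (w * w') * \<psi> v"
proof -
  interpret scal: clifford_base \<Theta> g J scalars by (rule clifford_base_scalars)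
  note mW = cstar_subalgebraD [OF W] and mS = cstar_subalgebraD [OF scal.cstar_subalgebra_tower [of n]]
    and mA = cstar_subalgebraD [OF A] and mC = cstar_subalgebraD [OF cstar_subalgebra_tower [of n]]
  define e where "e = (1/2) *\<^sub>R (v + \<Theta> v)"
  define d where "d = (1/2) *\<^sub>R (v - \<Theta> v)"
  have v_eq: "v = e + d" and e: "\<Theta> e = e" and d: "\<Theta> d = - d"
    unfolding e_def d_def by (rule involution_split [OF aut inv])+
  have tv: "\<Theta> v \<in> scal.tower n" by (rule scal.tower_parity [OF v])
  have eS: "e \<in> scal.tower n" unfolding e_def by (intro mS v tv)
  have dS: "d \<in> scal.tower n" unfolding d_def by (intro mS v tv)
  have eA: "e \<in> A" "d \<in> A" using eS dS scalar_tower_in_A by auto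
  have "\<psi> d = 0" using even [OF eA(2)] by (simp add: d state_minus [OF A \<psi> eA(2)])
  then have "\<psi> v = \<psi> e" by (simp add: v_eq state_add [OF A \<psi> eA])
  have we: "w * e * w' = (w * w') * e" by (simp only: mult.assoc commute_even [OF w(2) eA(1) e])
  have wd: "w * d * w' = (w * \<Theta> w') * d"
    using commute_odd [OF W_parity [OF w(2)] eA(2) d] by (simp add: mult.assoc inv)
  have val: "clifford_product \<Theta> g J \<omega> n \<psi> (x * y) = \<omega> x * \<psi> y" if "x \<in> W" "y \<in> scal.tower n" for x y
    using that by (intro product_value state_add [OF A \<psi>] state_scaleC [OF A \<psi>])
  have mem: "x * y \<in> tower n" if "x \<in> W" "y \<in> scal.tower n" for x y
    using that scalar_tower_subset clifford_tower_base [of W g J n] mW(3) by (auto intro!: mC(5))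
  have "w * v * w' = (w * w') * e + (w * \<Theta> w') * d"
    by (simp only: we [symmetric] wd [symmetric] v_eq distrib_left distrib_right)
  then have "clifford_product \<Theta> g J \<omega> n \<psi> (w * v * w')
      = clifford_product \<Theta> g J \<omega> n \<psi> ((w * w') * e) + clifford_product \<Theta> g J \<omega> n \<psi> ((w * \<Theta> w') * d)"
    using w eS dS by (simp only:) (intro product_add [OF \<omega>] mem mW W_parity)
  also have "\<dots> = \<omega> (w * w') * \<psi> e"
    using w eS dS W_parity mW(5) by (simp add: val \<open>\<psi> d = 0\<close>)
  finally show ?thesis by (simp add: \<open>\<psi> v = \<psi> e\<close>)
qed

lemma product_state: "state_on (tower n) (clifford_product \<Theta> g J \<omega> n \<psi>)"
proof -
  interpret scal: clifford_base \<Theta> g J scalars by (rule clifford_base_scalars)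
  note mW = cstar_subalgebraD [OF W] and mS = cstar_subalgebraD [OF scal.cstar_subalgebra_tower [of n]]
    and mA = cstar_subalgebraD [OF A] and mC = cstar_subalgebraD [OF cstar_subalgebra_tower [of n]]
  have "0 \<le> clifford_product \<Theta> g J \<omega> n \<psi> (star z * z)" if z: "z \<in> tower n" for z
  proof -
    obtain ps where ps: "\<And>p. p \<in> set ps \<Longrightarrow> fst p \<in> scal.tower n \<and> snd p \<in> W" "z = (\<Sum>p\<leftarrow>ps. fst p * snd p)"
      using tower_decomposition [OF z] by blast
    \<comment> \<open>Positions in the list serve as indices, since a pair may occur more than
      once.\<close>
    define S where "S = {..<length ps}"
    define y where "y i = fst (ps ! i)" for i
    define w where "w i = snd (ps ! i)" for i
    have y: "y i \<in> scal.tower n" and w: "w i \<in> W" if "i \<in> S" for i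
      using ps(1) [of "ps ! i"] that by (simp_all add: S_def y_def w_def)
    have z_eq: "z = (\<Sum>i\<in>S. y i * w i)"
      unfolding ps(2) sum_list_sum_nth S_def y_def w_def by (simp add: atLeast0LessThan)
    have "star z * z = (\<Sum>i\<in>S. \<Sum>j\<in>S. star (w i) * (star (y i) * y j) * w j)"
      unfolding z_eq linear_sum [OF bounded_linear.linear [OF bounded_linear_star]] sum_product
      by (intro sum.cong refl) (simp add: star_mult mult.assoc)
    moreover have mem: "star (w i) * (star (y i) * y j) * w j \<in> tower n" if "i \<in> S" "j \<in> S" for i j
    proof -
      have sub: "W \<subseteq> tower n" "scal.tower n \<subseteq> tower n"
        using clifford_tower_base [of W g J n] mW(3) scalar_tower_subset by auto
      show ?thesis
        using y [OF that(1)] y [OF that(2)] w [OF that(1)] w [OF that(2)] sub by (intro mC(5,7)) auto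
    qed
    ultimately have "clifford_product \<Theta> g J \<omega> n \<psi> (star z * z)
        = (\<Sum>i\<in>S. \<Sum>j\<in>S. clifford_product \<Theta> g J \<omega> n \<psi> (star (w i) * (star (y i) * y j) * w j))"
      by (simp add: product_sum [OF \<omega>] cstar_subalgebra_sum [OF cstar_subalgebra_tower])
    also have "\<dots> = (\<Sum>i\<in>S. \<Sum>j\<in>S. \<omega> (star (w i) * w j) * \<psi> (star (y i) * y j))"
      using y w by (intro sum.cong refl product_sandwich mW(7) mS(5,7))
    also have "0 \<le> \<dots>"
    proof (rule Schur_product_nonneg)
      show "finite S" by (simp add: S_def)
      show "0 \<le> (\<Sum>i\<in>S. \<Sum>j\<in>S. cnj (c i) * c j * \<omega> (star (w i) * w j))" for c
        by (rule state_Gram_nonneg [OF W \<omega> w])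
      have "y i \<in> A" if "i \<in> S" for i using y [OF that] scalar_tower_in_A by blast
      then show "0 \<le> (\<Sum>i\<in>S. \<Sum>j\<in>S. cnj (c i) * c j * \<psi> (star (y i) * y j))" for c
        by (rule state_Gram_nonneg [OF A \<psi>])
      show "\<omega> (star (w j) * w i) = cnj (\<omega> (star (w i) * w j))" if "i \<in> S" "j \<in> S" for i j
        using state_star [OF W \<omega>, of "star (w i) * w j"] w that mW(5,7) by (simp add: star_mult star_star)
    qed
    finally show ?thesis .
  qed
  moreover have "clifford_product \<Theta> g J \<omega> n \<psi> 1 = 1"
    using product_sandwich [OF mW(2) mW(2) mS(2)] by (simp add: state_one [OF W \<omega>] state_one [OF A \<psi>])
  ultimately show ?thesis
    unfolding state_on_def
    by (simp add: product_add [OF \<omega>] product_scaleC [OF \<omega>] less_eq_complex_def complex_is_Real_iff)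
qed

end

end

end

subsection \<open>Product states\<close>

text \<open>Mode j supplies the indices 2 j and 2 j + 1, so \<open>k div 2\<close> is the mode of
  \<open>k\<close>. The factor \<i> makes the second combination self-adjoint, and it is also what
  gives it square 1.\<close>

definition majorana :: "(nat \<Rightarrow> 'a::cstar_algebra) \<Rightarrow> nat \<Rightarrow> 'a" where
  "majorana a k = (if even k then a (k div 2) + star (a (k div 2)) else \<i> *\<^sub>C (a (k div 2) - star (a (k div 2))))"

lemma majorana_in_car_local: "k div 2 \<in> I \<Longrightarrow> majorana a k \<in> car_local a I"
  unfolding majorana_def
  by (simp add: cstar_subalgebraD [OF cstar_subalgebra_car_local] car_local_generator)

lemma star_majorana: "star (majorana a k) = majorana a k"
  by (simp add: majorana_def star_add star_diff star_scaleC star_star add.commute scaleC_minus_left scaleC_diff_right)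

lemma generator_majorana: "a j = (1/2) *\<^sub>R (majorana a (2 * j) - \<i> *\<^sub>C majorana a (2 * j + 1))"
proof -
  have "majorana a (2 * j) - \<i> *\<^sub>C majorana a (2 * j + 1) = 2 *\<^sub>R a j"
    by (simp add: majorana_def scaleC_scaleC scaleC_minus_left scaleR_2)
  then show ?thesis by simp
qed

context
  fixes a :: "nat \<Rightarrow> 'a::cstar_algebra" and \<Theta> :: "'a \<Rightarrow> 'a"
  assumes car: "car_algebra a" and par: "parity_automorphism a \<Theta>"
begin

lemma majorana_odd:
  assumes "k div 2 \<ge> 1"
  shows "\<Theta> (majorana a k) = - majorana a k"
proof -
  note aut = parity_auto [OF car par]
  show ?thesis
    by (simp add: majorana_def auto_add [OF aut] auto_diff [OF aut] auto_scaleC [OF aut]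
        parity_generator [OF car par assms] scaleC_diff_right scaleC_minus_right)
qed

lemma majorana_relations:
  assumes "j \<ge> 1"
  shows "majorana a (2 * j) * majorana a (2 * j) = 1"
    "majorana a (2 * j + 1) * majorana a (2 * j + 1) = 1"
    "majorana a (2 * j) * majorana a (2 * j + 1) = - (majorana a (2 * j + 1) * majorana a (2 * j))"
proof -
  let ?b = "a j" and ?s = "star (a j)"
  have zero: "x = 0" if "x + x = 0" for x :: 'a
  proof -
    have "2 *\<^sub>R x = 0" using that by (simp only: scaleR_2)
    then show ?thesis by simp
  qed
  have bb: "?b * ?b = 0" by (rule zero) (rule CAR(3) [OF car par assms assms])
  have ss: "?s * ?s = 0" by (rule zero) (rule CAR(2) [OF car par assms assms])
  have sb: "?s * ?b + ?b * ?s = 1" using CAR(1) [OF car par assms assms] by simp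
  have g: "majorana a (2 * j) = ?b + ?s" "majorana a (2 * j + 1) = \<i> *\<^sub>C (?b - ?s)"
    by (simp_all add: majorana_def)
  show "majorana a (2 * j) * majorana a (2 * j) = 1"
    unfolding g using sb by (simp add: distrib_left distrib_right bb ss add.commute)
  have "(?b - ?s) * (?b - ?s) = - 1"
    using sb by (simp add: left_diff_distrib right_diff_distrib bb ss) (simp add: algebra_simps)
  then show "majorana a (2 * j + 1) * majorana a (2 * j + 1) = 1"
    unfolding g by (simp add: scaleC_mult_left scaleC_mult_right scaleC_scaleC scaleC_minus_left)
  have "(?b + ?s) * (?b - ?s) = - ((?b - ?s) * (?b + ?s))"
    by (simp add: algebra_simps bb ss)
  then show "majorana a (2 * j) * majorana a (2 * j + 1) = - (majorana a (2 * j + 1) * majorana a (2 * j))"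
    unfolding g by (simp add: scaleC_mult_left scaleC_mult_right scaleC_minus_right)
qed

lemma majorana_square:
  assumes "k div 2 \<ge> 1"
  shows "majorana a k * majorana a k = 1"
proof (cases "even k")
  case True
  then show ?thesis using majorana_relations(1) [OF assms] by simp
next
  case False
  then show ?thesis using majorana_relations(2) [OF assms] by simp
qed

lemma majorana_anticommute:
  assumes k: "k div 2 \<ge> 1" "l div 2 \<ge> 1" and "k \<noteq> l"
  shows "majorana a k * majorana a l = - (majorana a l * majorana a k)"
proof (cases "k div 2 = l div 2")
  case True
  define j where "j = k div 2"
  have "k = 2 * j \<and> l = 2 * j + 1 \<or> k = 2 * j + 1 \<and> l = 2 * j"
    using True \<open>k \<noteq> l\<close> unfolding j_def by presburger
  then show ?thesis using majorana_relations(3) [of j] k(1) unfolding j_def by (metis minus_minus)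
next
  case False
  \<comment> \<open>For different modes both elements are odd and lie in local algebras over
    disjoint index sets, so graded commutation applies.\<close>
  have "majorana a k * majorana a l = majorana a l * \<Theta> (majorana a k)"
    using k False
    by (intro car_local_commute_odd [OF car par, of "{k div 2}" "{l div 2}"] majorana_in_car_local majorana_odd) auto
  then show ?thesis by (simp add: majorana_odd [OF k(1)])
qed

section \<open>Sufficiency: the product state as a joint extension\<close>

lemma even_imp_joint_extension:
  assumes I: "I1 \<subseteq> {1..}" "I2 \<subseteq> {1..}" "I1 \<inter> I2 = {}"
    and st1: "state_on (car_local a I1) \<phi>1" and st2: "state_on (car_local a I2) \<phi>2"
    and even: "even_on \<Theta> (car_local a I2) \<phi>2"
  obtains \<phi> where "joint_extension a I1 I2 \<phi>1 \<phi>2 \<phi>"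
proof -
  define J where "J = {k. k div 2 \<in> I2}"
  define g where "g = majorana a"
  let ?A1 = "car_local a I1" and ?A2 = "car_local a I2"
  note B1 = cstar_subalgebra_car_local [of a I1] and B2 = cstar_subalgebra_car_local [of a I2]
  note aut = parity_auto [OF car par]
  have J: "k div 2 \<ge> 1" if "k \<in> J" for k using that I(2) by (auto simp: J_def)
  have gA: "g k \<in> ?A2" if "k \<in> J" for k using that by (simp add: g_def J_def majorana_in_car_local)
  have g_odd: "\<Theta> (g k) = - g k" if "k \<in> J" for k using majorana_odd [OF J [OF that]] by (simp add: g_def)
  have g_star: "star (g k) = g k" for k by (simp only: g_def star_majorana)
  have g_square: "g k * g k = 1" if "k \<in> J" for k by (simp only: g_def majorana_square [OF J [OF that]])
  have g_anti: "g k * g l = - (g l * g k)" if "k \<in> J" "l \<in> J" "k \<noteq> l" for k l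
    unfolding g_def by (rule majorana_anticommute [OF J [OF that(1)] J [OF that(2)] that(3)])
  have g_twist: "g k * w = \<Theta> w * g k" if k: "k \<in> J" and w: "w \<in> ?A1" for k w
    using car_local_commute_odd [OF car par I parity_car_local [OF car par I(1) w] gA [OF k] g_odd [OF k]]
    by (simp only: parity_involutive [OF car par])
  interpret clifford_base \<Theta> g J ?A1
    by (unfold_locales; rule aut parity_involutive [OF car par] g_star g_square g_odd g_anti B1
        parity_car_local [OF car par I(1)] g_twist; assumption)
  define f where "f n = clifford_product \<Theta> g J \<phi>1 n \<phi>2" for n
  have A2_parity: "\<Theta> v \<in> ?A2" if "v \<in> ?A2" for v by (rule parity_car_local [OF car par I(2) that])
  have even': "\<phi>2 (\<Theta> v) = \<phi>2 v" if "v \<in> ?A2" for v using even that unfolding even_on_def by blast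
  note comm = car_local_commute_even [OF car par I] car_local_commute_odd [OF car par I]
  have st: "state_on (tower n) (f n)" for n
    unfolding f_def by (rule product_state [OF st1 B2 gA st2 A2_parity even' comm])
  have f_le: "f n z = f m z" if "m \<le> n" "z \<in> tower m" for m n z
    unfolding f_def by (rule product_le [OF st1 that])
  obtain \<phi> where phi: "state_on (closure (\<Union>n. tower n)) \<phi>" and phi_eq: "\<And>n z. z \<in> tower n \<Longrightarrow> \<phi> z = f n z"
  proof (rule state_on_closure_union [of tower f, OF cstar_subalgebra_tower tower_mono st f_le])
    fix \<phi> assume "state_on (closure (\<Union>n. tower n)) \<phi>" "\<And>n z. z \<in> tower n \<Longrightarrow> \<phi> z = f n z"
    then show thesis by (rule that)
  qed
  let ?T = "closure (\<Union>n. tower n)"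
  have T: "cstar_subalgebra ?T" by (rule cstar_subalgebra_closure_union [of tower, OF cstar_subalgebra_tower tower_mono])
  \<comment> \<open>The base is left arbitrary because two are needed: A(I1), to place the joint
    algebra inside the closure of the tower, and the scalars, to approximate elements of
    A(I2).\<close>
  have generators: "a j \<in> closure (\<Union>n. clifford_tower g J W n)"
    if base: "clifford_base \<Theta> g J W" and j: "j \<in> I2" for W j
  proof -
    interpret W: clifford_base \<Theta> g J W by (rule base)
    have jJ: "2 * j \<in> J" "2 * j + 1 \<in> J" using j by (simp_all add: J_def)
    have "g (2 * j) \<in> W.tower (2 * j + 2)" by (rule W.generator_in_tower [OF jJ(1)]) linarith
    moreover have "g (2 * j + 1) \<in> W.tower (2 * j + 2)" by (rule W.generator_in_tower [OF jJ(2)]) linarith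
    ultimately have "a j \<in> W.tower (2 * j + 2)"
      unfolding generator_majorana [of a j] g_def [symmetric]
      by (intro cstar_subalgebraD(6,9,10) [OF W.cstar_subalgebra_tower])
    then show ?thesis by (rule mem_closure_union)
  qed
  have A1_T: "x \<in> tower 0" if "x \<in> ?A1" for x using that by simp
  have sub: "car_local a (I1 \<union> I2) \<subseteq> ?T"
  proof (rule car_local_minimal [OF T])
    fix i assume i: "i \<in> I1 \<union> I2"
    show "a i \<in> ?T"
    proof (cases "i \<in> I2")
      case False
      then have "a i \<in> tower 0" using i by (simp add: car_local_generator)
      then show ?thesis by (rule mem_closure_union)
    qed (rule generators [OF clifford_base_axioms])
  qed
  interpret scal: clifford_base \<Theta> g J scalars by (rule clifford_base_scalars)
  \<comment> \<open>On the scalar tower the sandwich formula with w = w' = 1 gives \<phi>2. This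
    tower is dense in A(I2), and both functionals are continuous.\<close>
  have "\<phi> x = \<phi>2 x" if x: "x \<in> ?A2" for x
  proof -
    have S: "cstar_subalgebra (closure (\<Union>n. scal.tower n))"
      by (rule cstar_subalgebra_closure_union [of scal.tower, OF scal.cstar_subalgebra_tower scal.tower_mono])
    have "?A2 \<subseteq> closure (\<Union>n. scal.tower n)"
      by (rule car_local_minimal [OF S]) (rule generators [OF clifford_base_scalars])
    then have "x \<in> closure (\<Union>n. scal.tower n)" using x by (rule subsetD)
    then obtain s where s': "(\<forall>k::nat. s k \<in> (\<Union>n. scal.tower n)) \<and> s \<longlonglongrightarrow> x"
      unfolding closure_sequential ..
    note s = spec [OF conjunct1 [OF s']] conjunct2 [OF s']
    have sA: "s k \<in> ?A2" and sT: "s k \<in> ?T" and phi_s: "\<phi> (s k) = \<phi>2 (s k)" for k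
    proof -
      obtain n where n: "s k \<in> scal.tower n" using s(1) [of k] by auto
      have sn: "s k \<in> tower n" by (rule subsetD [OF scalar_tower_subset n])
      show "s k \<in> ?A2" by (rule subsetD [OF scalar_tower_in_A [OF st1 B2 gA] n])
      show "s k \<in> ?T" using sn by (rule mem_closure_union)
      show "\<phi> (s k) = \<phi>2 (s k)"
      proof -
        have "f n (1 * s k * 1) = \<phi>1 (1 * 1) * \<phi>2 (s k)"
          unfolding f_def
          by (rule product_sandwich [OF st1 B2 gA st2 A2_parity even' comm
                cstar_subalgebraD(2) [OF B1] cstar_subalgebraD(2) [OF B1] n])
        then show ?thesis by (simp only: phi_eq [OF sn] state_one [OF B1 st1] mult_1_left mult_1_right)
      qed
    qed
    have "x \<in> ?T" by (rule subsetD [OF sub subsetD [OF car_local_mono [OF Un_upper2] x]])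
    then have "(\<lambda>k. \<phi> (s k)) \<longlonglongrightarrow> \<phi> x" by (rule state_tendsto [OF T phi sT s(2)])
    then have "(\<lambda>k. \<phi>2 (s k)) \<longlonglongrightarrow> \<phi> x" by (simp only: phi_s)
    then show ?thesis using state_tendsto [OF B2 st2 sA s(2) x] by (rule LIMSEQ_unique)
  qed
  \<comment> \<open>A(I1) is stage 0, where the product functional is
    \<open>\<phi>1 z * \<phi>2 1\<close>.\<close>
  moreover have "\<phi> x = \<phi>1 x" if "x \<in> ?A1" for x
    using phi_eq [OF A1_T [OF that]] by (simp add: f_def state_one [OF B2 st2])
  ultimately show ?thesis
    using state_on_subset [OF phi sub] by (intro that [of \<phi>]) (simp add: joint_extension_def)
qed

end

theorem theorem5:
  fixes a :: "nat \<Rightarrow> 'a::cstar_algebra"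
    and \<Theta> :: "'a \<Rightarrow> 'a"
    and I1 I2 :: "nat set"
    and \<phi>1 \<phi>2 :: "'a \<Rightarrow> complex"
    and H1 :: "'h1::complex_hilbert set" and \<pi>1 :: "'a \<Rightarrow> 'h1 \<Rightarrow> 'h1" and \<Omega>1 :: 'h1
    and H2 :: "'h2::complex_hilbert set" and \<pi>2 :: "'a \<Rightarrow> 'h2 \<Rightarrow> 'h2" and \<Omega>2 :: 'h2
  assumes "car_algebra a"
    and "parity_automorphism a \<Theta>"
    and "I1 \<subseteq> {1..}" and "I2 \<subseteq> {1..}" and "I1 \<inter> I2 = {}"
    and "state_on (car_local a I1) \<phi>1"
    and "state_on (car_local a I2) \<phi>2"
    and "gns_triple (car_local a I1) \<phi>1 H1 \<pi>1 \<Omega>1"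
    and "gns_triple (car_local a I1) (\<phi>1 \<circ> \<Theta>) H2 \<pi>2 \<Omega>2"
    and "disjoint_representations (car_local a I1) H1 \<pi>1 H2 \<pi>2"
  shows "(\<exists>\<phi>. joint_extension a I1 I2 \<phi>1 \<phi>2 \<phi>) \<longleftrightarrow> even_on \<Theta> (car_local a I2) \<phi>2"
proof
  assume "\<exists>\<phi>. joint_extension a I1 I2 \<phi>1 \<phi>2 \<phi>"
  then show "even_on \<Theta> (car_local a I2) \<phi>2"
    using joint_extension_imp_even [OF assms(1-5,8-10)] by blast
next
  assume "even_on \<Theta> (car_local a I2) \<phi>2"
  then show "\<exists>\<phi>. joint_extension a I1 I2 \<phi>1 \<phi>2 \<phi>"
    using even_imp_joint_extension [OF assms(1-7)] by blast
qed

end
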